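(* Let $u_D^*\in H_0^1(\Omega)$ and $u_N^*\in H^1(\Omega)$ be the weak solutions of the Dirichlet problem $-\nabla\cdot(A\nabla u)+cu=f$ in $\Omega$, $u=0$ on $\partial\Omega$, and of the Neumann problem $-\nabla\cdot(A\nabla u)+cu=f$ in $\Omega$, $A\nabla u\cdot\nu=0$ on $\partial\Omega$, respectively. Suppose the basic assumptions on $(A,c,f)$ and the Barron assumptions on $A$ and $c$ given in the context hold. (1) (Dirichlet.) Suppose in addition that $f\in\mathcal B_s^0(\Omega)$ and put $\ell_{f,D}=\|f\|_{\mathcal B_s^0(\Omega)}$. Then for every $0<\varepsilon<1/2$ there exist a positive integer $k$ and a two-layer cosine network $$N_k(x)=\frac1k\sum_{i=1}^k a_i\cos(w_i^\top x+b_i),\qquad a_i,b_i\in\mathbb R,\ w_i\in\mathbb R^d,$$ such that $$|a_i|\le M_D,\quad w_i\in\pi\mathbb Z^d\quad(i=1,\dots,k),\qquad \frac1k\sum_{i=1}^k|a_i|(1+|w_i|^2)\le M_D,\qquad \|N_k\|_{\mathcal B_e^2(\Omega)}\le M_D,$$ and $\|N_k-u_D^*\|_{H^1(\Omega)}\le\varepsilon$. (2) (Neumann.) Suppose instead in addition that $f\in\mathcal B_c^0(\Omega)$ and put $\ell_{f,N}=\|f\|_{\mathcal B_c^0(\Omega)}$. Then for every $0<\varepsilon<1/2$ there exist a positive integer $k$ and a network $N_k$ of the same form satisfying the same bounds with $M_D$ replaced by $M_N$, and $\|N_k-u_N^*\|_{H^1(\Omega)}\le\varepsilon$. Moreover,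 in case $X\in\{D,N\}$ the width can be chosen such that $k=\mathcal O(d^{C_1|\log\varepsilon|})$, and $M_X=\mathcal O(d^{C_2|\log\varepsilon|})$; that is, there are constants $C_0,C_1,C_2>0$, depending only on $a_{\min},a_{\max},c_{\min},c_{\max},\ell_A,\ell_c,\ell_{f,X}$ and $\|f\|_{H^{-1}(\Omega)}$ (if $X=D$) or $\|f\|_{(H^1(\Omega))^*}$ (if $X=N$), and not otherwise on $d$ or $\varepsilon$, such that $k\le C_0d^{C_1|\log\varepsilon|}$ and $M_X\le C_0d^{C_2|\log\varepsilon|}$.
   Context: **Setting.** $d\ge2$ is an integer, $\Omega=(0,1)^d\subset\mathbb R^d$, $\nu$ is the outward unit normal on $\partial\Omega$, $\mathbb N=\{0,1,2,\dots\}$, $|\cdot|$ is the Euclidean norm, all functions are real-valued, and $(u,v)_{H^1(\Omega)}=\int_\Omega\nabla u\cdot\nabla v+uv\,dx$ (used also on $H_0^1(\Omega)$). **Basic assumptions on $(A,c,f)$.** $A(x)=(A_{ij}(x))_{1\le i,j\le d}$ is a symmetric (measurable) matrix-valued function on $\Omega$; there is $a_{\min}>0$ with $v^\top A(x)v\ge a_{\min}|v|^2$ for all $x\in\Omega$, $v\in\mathbb R^d$; $a_{\max}:=\sup_{x\in\Omega}\sup_{v\ne0}|A(x)v|/|v|<\infty$. The (measurable) function $c$ satisfies $0<c_{\min}\le c(x)\le c_{\max}<\infty$ on $\Omega$. $f\in L^2(\Omega)$. **Weak solutions.** $u_D^*\in H_0^1(\Omega)$ is the unique function with $\int_\Omega(\nabla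 u_D^*\cdot A\nabla v+cu_D^*v-fv)\,dx=0$ for all $v\in H_0^1(\Omega)$; $u_N^*\in H^1(\Omega)$ is the unique function with the same identity (with $u_N^*$ in place of $u_D^*$) for all $v\in H^1(\Omega)$. **Barron spaces.** For $g\in L^2(\Omega)$, $n\ge0$ (convention $0^0=1$): - $\|g\|_{\mathcal B_e^n(\Omega)}=\inf\{\sum_{\omega\in\mathbb Z^d}|a_\omega|(1+\pi^n|\omega|^n): g(x)=\sum_{\omega\in\mathbb Z^d}a_\omega e^{i\pi\omega^\top x}\text{ in }L^2(\Omega),\ a_\omega\in\mathbb C\}$. - With $S_k(x)=\prod_{m=1}^d\sin(\pi k_mx_m)$, and $g=\sum_{k\in\mathbb N^d}a_kS_k$ in $L^2(\Omega)$ the (unique, real) expansion, where $a_k=0$ whenever some $k_m=0$: $\|g\|_{\mathcal B_s^n(\Omega)}=\sum_k|a_k|(1+\pi^n|k|^n)$. - With $C_k(x)=\prod_{m=1}^d\cos(\pi k_mx_m)$ and $g=\sum_{k\in\mathbb N^d}a_kC_k$: $\|g\|_{\mathcal B_c^n(\Omega)}=\sum_k|a_k|(1+\pi^n|k|^n)$. - For $i\ne j$, with $M_{k,i,j}(x)=\sin(\pi k_ix_i)\sin(\pi k_jx_j)\prod_{m\ne i,j}\cos(\pi k_mx_m)$ and $g=\sum_{k\in\mathbb N^d}a_kM_{k,i,j}$, where $a_k=0$ if $k_i=0$ or $k_j=0$: $\|g\|_{\mathcal B_{i,j}^n(\Omega)}=\sum_k|a_k|(1+\pi^n|k|^n)$.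 Each space consists of those $g\in L^2(\Omega)$ for which the corresponding norm is finite. **Barron assumptions on $A$ and $c$.** $A_{ii}\in\mathcal B_c^1(\Omega)$ for all $i$; $A_{ij}\in\mathcal B_{i,j}^1(\Omega)$ for all $i\ne j$; $\ell_A:=\max\{\max_i\|A_{ii}\|_{\mathcal B_c^1(\Omega)},\max_{i\ne j}\|A_{ij}\|_{\mathcal B_{i,j}^1(\Omega)}\}$; $c\in\mathcal B_c^2(\Omega)$ with $\ell_c:=\|c\|_{\mathcal B_c^2(\Omega)}$. **Constants.** $\lambda_{\min}=\min\{a_{\min},c_{\min}\}$, $\lambda_{\max}=\max\{a_{\max},c_{\max}\}$, $\alpha_*=\lambda_{\min}/\lambda_{\max}^2$, $\beta_*=(1-\lambda_{\min}^2/\lambda_{\max}^2)^{1/2}$, $p(d)=\frac{1+\pi}{\pi}\alpha_*\ell_Ad^2+\alpha_*\ell_c+1$, $\log_+t=\max\{\log t,0\}$ (with $\log_+0=0$), $$T_D=\left\lceil\frac{\log_+(2\|f\|_{H^{-1}(\Omega)}/(\varepsilon\lambda_{\min}))}{|\log\beta_*|}\right\rceil,\qquad T_N=\left\lceil\frac{\log_+(2\|f\|_{(H^1(\Omega))^*}/(\varepsilon\lambda_{\min}))}{|\log\beta_*|}\right\rceil,$$ with $T_D=T_N=1$ when $\beta_*=0$, and for $X\in\{D,N\}$ $$M_X=\frac{\alpha_*\ell_{f,X}(p(d)^{T_X}-1)}{2(p(d)-1)}.$$ Here $\|f\|_{H^{-1}(\Omega)}=\sup\{\int_\Omega f\phi\,dx:\phi\in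 H_0^1(\Omega),\ \|\nabla\phi\|_{L^2(\Omega)}\le1\}$ and $\|f\|_{(H^1(\Omega))^*}=\sup\{\int_\Omega f\phi\,dx:\phi\in H^1(\Omega),\ \|\phi\|_{H^1(\Omega)}\le1\}$. *)

theory Defs
  imports "HOL-Analysis.Analysis"
begin

text \<open>
  The constants in the final estimate have to be uniform in the dimension \<open>d\<close>, so \<open>d\<close> is a natural
  number and not a type. A point of the \<open>d\<close>-dimensional space is a function \<open>nat \<Rightarrow> real\<close>
  of which only the coordinates \<open>i < d\<close> matter; Euclidean norms are \<open>L2_set v {..<d}\<close>.
  Values of functions outside \<open>\<Omega> d\<close> are irrelevant throughout.
\<close>

definition \<Omega> :: "nat \<Rightarrow> (nat \<Rightarrow> real) set" where
  "\<Omega> d = {..<d} \<rightarrow>\<^sub>E {0<..<1}"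

text \<open>Lebesgue measure on the cube, with the Lebesgue (not just Borel) measurable sets.\<close>

definition leb :: "nat \<Rightarrow> (nat \<Rightarrow> real) measure" where
  "leb d = completion (PiM {..<d} (\<lambda>_. restrict_space lborel {0<..<1}))"

lemma space_leb [simp]: "space (leb d) = \<Omega> d"
  by (simp add: leb_def \<Omega>_def space_PiM space_restrict_space)

definition L2 :: "nat \<Rightarrow> ((nat \<Rightarrow> real) \<Rightarrow> real) set" where
  "L2 d = {g. g \<in> borel_measurable (leb d) \<and> integrable (leb d) (\<lambda>x. (g x)\<^sup>2)}"


section \<open>Sobolev spaces\<close>

definition partial_deriv :: "nat \<Rightarrow> ((nat \<Rightarrow> real) \<Rightarrow> real) \<Rightarrow> (nat \<Rightarrow> real) \<Rightarrow> real" where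
  "partial_deriv i \<phi> x = deriv (\<lambda>t. \<phi> (x(i := t))) (x i)"

text \<open>Smooth: all iterated partial derivatives exist and are continuous. Continuity and
  compactness below refer to the product topology, which on \<open>\<Omega> d\<close> is the Euclidean one.\<close>

definition smooth :: "nat \<Rightarrow> ((nat \<Rightarrow> real) \<Rightarrow> real) \<Rightarrow> bool" where
  "smooth d \<phi> \<longleftrightarrow> (\<forall>is. set is \<subseteq> {..<d} \<longrightarrow>
     continuous_on (\<Omega> d) (foldr partial_deriv is \<phi>) \<and>
     (\<forall>i<d. \<forall>x\<in>\<Omega> d. (\<lambda>t. foldr partial_deriv is \<phi> (x(i := t))) field_differentiable (at (x i))))"

definition test_functions :: "nat \<Rightarrow> ((nat \<Rightarrow> real) \<Rightarrow> real) set" where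
  "test_functions d = {\<phi>. smooth d \<phi> \<and> (\<exists>K. compact K \<and> K \<subseteq> \<Omega> d \<and> (\<forall>x\<in>\<Omega> d - K. \<phi> x = 0))}"

definition is_weak_deriv ::
  "nat \<Rightarrow> nat \<Rightarrow> ((nat \<Rightarrow> real) \<Rightarrow> real) \<Rightarrow> ((nat \<Rightarrow> real) \<Rightarrow> real) \<Rightarrow> bool" where
  "is_weak_deriv d i u g \<longleftrightarrow> g \<in> L2 d \<and>
     (\<forall>\<phi>\<in>test_functions d. (\<integral>x. u x * partial_deriv i \<phi> x \<partial>leb d) = - (\<integral>x. g x * \<phi> x \<partial>leb d))"

definition H1 :: "nat \<Rightarrow> ((nat \<Rightarrow> real) \<Rightarrow> real) set" where
  "H1 d = {u \<in> L2 d. \<forall>i<d. \<exists>g. is_weak_deriv d i u g}"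

text \<open>A representative of the weak derivative, which is unique up to null sets;
  meaningful for \<open>u \<in> H1 d\<close> and \<open>i < d\<close>.\<close>

definition wderiv :: "nat \<Rightarrow> nat \<Rightarrow> ((nat \<Rightarrow> real) \<Rightarrow> real) \<Rightarrow> (nat \<Rightarrow> real) \<Rightarrow> real" where
  "wderiv d i u = (SOME g. is_weak_deriv d i u g)"

definition H1_inner :: "nat \<Rightarrow> ((nat \<Rightarrow> real) \<Rightarrow> real) \<Rightarrow> ((nat \<Rightarrow> real) \<Rightarrow> real) \<Rightarrow> real" where
  "H1_inner d u v = (\<integral>x. (\<Sum>i<d. wderiv d i u x * wderiv d i v x) + u x * v x \<partial>leb d)"

definition H1_norm :: "nat \<Rightarrow> ((nat \<Rightarrow> real) \<Rightarrow> real) \<Rightarrow> real" where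
  "H1_norm d u = sqrt (H1_inner d u u)"

definition grad_norm :: "nat \<Rightarrow> ((nat \<Rightarrow> real) \<Rightarrow> real) \<Rightarrow> real" where
  "grad_norm d u = sqrt (\<integral>x. (\<Sum>i<d. (wderiv d i u x)\<^sup>2) \<partial>leb d)"

definition H10 :: "nat \<Rightarrow> ((nat \<Rightarrow> real) \<Rightarrow> real) set" where
  "H10 d = {u \<in> H1 d. \<forall>\<delta>>0. \<exists>\<phi>\<in>test_functions d. H1_norm d (\<lambda>x. u x - \<phi> x) < \<delta>}"

definition H_minus1_norm :: "nat \<Rightarrow> ((nat \<Rightarrow> real) \<Rightarrow> real) \<Rightarrow> real" where
  "H_minus1_norm d f = Sup {\<integral>x. f x * \<phi> x \<partial>leb d | \<phi>. \<phi> \<in> H10 d \<and> grad_norm d \<phi> \<le> 1}"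

definition H1_dual_norm :: "nat \<Rightarrow> ((nat \<Rightarrow> real) \<Rightarrow> real) \<Rightarrow> real" where
  "H1_dual_norm d f = Sup {\<integral>x. f x * \<phi> x \<partial>leb d | \<phi>. \<phi> \<in> H1 d \<and> H1_norm d \<phi> \<le> 1}"


section \<open>The boundary value problems\<close>

definition is_amax :: "nat \<Rightarrow> (nat \<Rightarrow> nat \<Rightarrow> (nat \<Rightarrow> real) \<Rightarrow> real) \<Rightarrow> real \<Rightarrow> bool" where
  "is_amax d A amax \<longleftrightarrow>
     (let Q = {L2_set (\<lambda>i. \<Sum>j<d. A i j x * v j) {..<d} / L2_set v {..<d} | x v.
                x \<in> \<Omega> d \<and> (\<exists>i<d. v i \<noteq> 0)}
      in bdd_above Q \<and> amax = Sup Q)"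

definition basic_assumptions ::
  "nat \<Rightarrow> real \<Rightarrow> real \<Rightarrow> real \<Rightarrow> real \<Rightarrow> (nat \<Rightarrow> nat \<Rightarrow> (nat \<Rightarrow> real) \<Rightarrow> real) \<Rightarrow>
    ((nat \<Rightarrow> real) \<Rightarrow> real) \<Rightarrow> ((nat \<Rightarrow> real) \<Rightarrow> real) \<Rightarrow> bool" where
  "basic_assumptions d amin amax cmin cmax A c f \<longleftrightarrow>
     (\<forall>i<d. \<forall>j<d. A i j \<in> borel_measurable (leb d) \<and> (\<forall>x\<in>\<Omega> d. A i j x = A j i x)) \<and>
     0 < amin \<and>
     (\<forall>x\<in>\<Omega> d. \<forall>v. (\<Sum>i<d. \<Sum>j<d. v i * A i j x * v j) \<ge> amin * (L2_set v {..<d})\<^sup>2) \<and>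
     is_amax d A amax \<and>
     c \<in> borel_measurable (leb d) \<and> 0 < cmin \<and> (\<forall>x\<in>\<Omega> d. cmin \<le> c x \<and> c x \<le> cmax) \<and>
     f \<in> L2 d"

definition weak_identity ::
  "nat \<Rightarrow> (nat \<Rightarrow> nat \<Rightarrow> (nat \<Rightarrow> real) \<Rightarrow> real) \<Rightarrow> ((nat \<Rightarrow> real) \<Rightarrow> real) \<Rightarrow> ((nat \<Rightarrow> real) \<Rightarrow> real) \<Rightarrow>
    ((nat \<Rightarrow> real) \<Rightarrow> real) \<Rightarrow> ((nat \<Rightarrow> real) \<Rightarrow> real) \<Rightarrow> bool" where
  "weak_identity d A c f u v \<longleftrightarrow>
     (\<integral>x. (\<Sum>i<d. wderiv d i u x * (\<Sum>j<d. A i j x * wderiv d j v x))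
          + c x * u x * v x - f x * v x \<partial>leb d) = 0"

definition weak_sol_dirichlet ::
  "nat \<Rightarrow> (nat \<Rightarrow> nat \<Rightarrow> (nat \<Rightarrow> real) \<Rightarrow> real) \<Rightarrow> ((nat \<Rightarrow> real) \<Rightarrow> real) \<Rightarrow> ((nat \<Rightarrow> real) \<Rightarrow> real) \<Rightarrow>
    ((nat \<Rightarrow> real) \<Rightarrow> real) \<Rightarrow> bool" where
  "weak_sol_dirichlet d A c f u \<longleftrightarrow> u \<in> H10 d \<and> (\<forall>v\<in>H10 d. weak_identity d A c f u v)"

definition weak_sol_neumann ::
  "nat \<Rightarrow> (nat \<Rightarrow> nat \<Rightarrow> (nat \<Rightarrow> real) \<Rightarrow> real) \<Rightarrow> ((nat \<Rightarrow> real) \<Rightarrow> real) \<Rightarrow> ((nat \<Rightarrow> real) \<Rightarrow> real) \<Rightarrow>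
    ((nat \<Rightarrow> real) \<Rightarrow> real) \<Rightarrow> bool" where
  "weak_sol_neumann d A c f u \<longleftrightarrow> u \<in> H1 d \<and> (\<forall>v\<in>H1 d. weak_identity d A c f u v)"


section \<open>Barron spaces\<close>

text \<open>Unconditional convergence of the series in the \<open>L\<^sup>2\<close> norm.\<close>

definition has_L2_expansion ::
  "nat \<Rightarrow> 'k set \<Rightarrow> ('k \<Rightarrow> (nat \<Rightarrow> real) \<Rightarrow> 'b::real_normed_field) \<Rightarrow> ('k \<Rightarrow> 'b) \<Rightarrow>
    ((nat \<Rightarrow> real) \<Rightarrow> 'b) \<Rightarrow> bool" where
  "has_L2_expansion d I e a g \<longleftrightarrow>
     ((\<lambda>F. \<integral>\<^sup>+x. ennreal ((norm (g x - (\<Sum>k\<in>F. a k * e k x)))\<^sup>2) \<partial>leb d) \<longlongrightarrow> 0)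
       (finite_subsets_at_top I)"

definition Zd :: "nat \<Rightarrow> (nat \<Rightarrow> int) set" where
  "Zd d = {..<d} \<rightarrow>\<^sub>E UNIV"

definition Nd :: "nat \<Rightarrow> (nat \<Rightarrow> nat) set" where
  "Nd d = {..<d} \<rightarrow>\<^sub>E UNIV"

definition exp_basis :: "nat \<Rightarrow> (nat \<Rightarrow> int) \<Rightarrow> (nat \<Rightarrow> real) \<Rightarrow> complex" where
  "exp_basis d \<omega> x = exp (\<i> * complex_of_real (pi * (\<Sum>j<d. real_of_int (\<omega> j) * x j)))"

definition barron_e_norm :: "nat \<Rightarrow> nat \<Rightarrow> ((nat \<Rightarrow> real) \<Rightarrow> real) \<Rightarrow> ennreal" where
  "barron_e_norm d n g =
     (INF a \<in> {a. has_L2_expansion d (Zd d) (exp_basis d) a (\<lambda>x. complex_of_real (g x))}.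
        \<Sum>\<^sub>\<infinity>\<omega>\<in>Zd d. ennreal (cmod (a \<omega>) * (1 + pi ^ n * (L2_set (\<lambda>i. real_of_int (\<omega> i)) {..<d}) ^ n)))"

text \<open>The sine, cosine and mixed systems are orthogonal, so the coefficient family picked out by
  \<open>SOME\<close> below is the only admissible one (on \<open>Nd d\<close>, which is all that is used); the norm is
  infinite if there is none. \<open>Z\<close> is the set of indices whose coefficients are required to vanish.\<close>

definition orth_barron_norm ::
  "nat \<Rightarrow> (nat \<Rightarrow> nat) set \<Rightarrow> ((nat \<Rightarrow> nat) \<Rightarrow> (nat \<Rightarrow> real) \<Rightarrow> real) \<Rightarrow> nat \<Rightarrow>
    ((nat \<Rightarrow> real) \<Rightarrow> real) \<Rightarrow> ennreal" where
  "orth_barron_norm d Z e n g =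
     (let P = (\<lambda>a. has_L2_expansion d (Nd d) e a g \<and> (\<forall>k\<in>Nd d \<inter> Z. a k = 0))
      in if \<exists>a. P a
         then \<Sum>\<^sub>\<infinity>k\<in>Nd d. ennreal (\<bar>(SOME a. P a) k\<bar> * (1 + pi ^ n * (L2_set (\<lambda>i. real (k i)) {..<d}) ^ n))
         else \<infinity>)"

definition sin_basis :: "nat \<Rightarrow> (nat \<Rightarrow> nat) \<Rightarrow> (nat \<Rightarrow> real) \<Rightarrow> real" where
  "sin_basis d k x = (\<Prod>m<d. sin (pi * real (k m) * x m))"

definition cos_basis :: "nat \<Rightarrow> (nat \<Rightarrow> nat) \<Rightarrow> (nat \<Rightarrow> real) \<Rightarrow> real" where
  "cos_basis d k x = (\<Prod>m<d. cos (pi * real (k m) * x m))"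

definition mixed_basis :: "nat \<Rightarrow> nat \<Rightarrow> nat \<Rightarrow> (nat \<Rightarrow> nat) \<Rightarrow> (nat \<Rightarrow> real) \<Rightarrow> real" where
  "mixed_basis d i j k x =
     sin (pi * real (k i) * x i) * sin (pi * real (k j) * x j) *
     (\<Prod>m\<in>{..<d} - {i, j}. cos (pi * real (k m) * x m))"

definition barron_s_norm :: "nat \<Rightarrow> nat \<Rightarrow> ((nat \<Rightarrow> real) \<Rightarrow> real) \<Rightarrow> ennreal" where
  "barron_s_norm d = orth_barron_norm d {k. \<exists>m<d. k m = 0} (sin_basis d)"

definition barron_c_norm :: "nat \<Rightarrow> nat \<Rightarrow> ((nat \<Rightarrow> real) \<Rightarrow> real) \<Rightarrow> ennreal" where
  "barron_c_norm d = orth_barron_norm d {} (cos_basis d)"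

definition barron_m_norm :: "nat \<Rightarrow> nat \<Rightarrow> nat \<Rightarrow> nat \<Rightarrow> ((nat \<Rightarrow> real) \<Rightarrow> real) \<Rightarrow> ennreal" where
  "barron_m_norm d i j = orth_barron_norm d {k. k i = 0 \<or> k j = 0} (mixed_basis d i j)"

definition barron_s :: "nat \<Rightarrow> nat \<Rightarrow> ((nat \<Rightarrow> real) \<Rightarrow> real) set" where
  "barron_s d n = {g \<in> L2 d. barron_s_norm d n g < \<infinity>}"

definition barron_c :: "nat \<Rightarrow> nat \<Rightarrow> ((nat \<Rightarrow> real) \<Rightarrow> real) set" where
  "barron_c d n = {g \<in> L2 d. barron_c_norm d n g < \<infinity>}"

definition barron_m :: "nat \<Rightarrow> nat \<Rightarrow> nat \<Rightarrow> nat \<Rightarrow> ((nat \<Rightarrow> real) \<Rightarrow> real) set" where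
  "barron_m d i j n = {g \<in> L2 d. barron_m_norm d i j n g < \<infinity>}"

definition barron_assumptions ::
  "nat \<Rightarrow> (nat \<Rightarrow> nat \<Rightarrow> (nat \<Rightarrow> real) \<Rightarrow> real) \<Rightarrow> ((nat \<Rightarrow> real) \<Rightarrow> real) \<Rightarrow> bool" where
  "barron_assumptions d A c \<longleftrightarrow>
     (\<forall>i<d. A i i \<in> barron_c d 1) \<and>
     (\<forall>i<d. \<forall>j<d. i \<noteq> j \<longrightarrow> A i j \<in> barron_m d i j 1) \<and>
     c \<in> barron_c d 2"

definition ell_A :: "nat \<Rightarrow> (nat \<Rightarrow> nat \<Rightarrow> (nat \<Rightarrow> real) \<Rightarrow> real) \<Rightarrow> real" where
  "ell_A d A = enn2real (max
     (Max {barron_c_norm d 1 (A i i) | i. i < d})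
     (Max {barron_m_norm d i j 1 (A i j) | i j. i < d \<and> j < d \<and> i \<noteq> j}))"

definition ell_c :: "nat \<Rightarrow> ((nat \<Rightarrow> real) \<Rightarrow> real) \<Rightarrow> real" where
  "ell_c d c = enn2real (barron_c_norm d 2 c)"


section \<open>Constants\<close>

definition lam_min :: "real \<Rightarrow> real \<Rightarrow> real" where
  "lam_min amin cmin = min amin cmin"

definition lam_max :: "real \<Rightarrow> real \<Rightarrow> real" where
  "lam_max amax cmax = max amax cmax"

definition alpha_star :: "real \<Rightarrow> real \<Rightarrow> real \<Rightarrow> real \<Rightarrow> real" where
  "alpha_star amin amax cmin cmax = lam_min amin cmin / (lam_max amax cmax)\<^sup>2"

definition beta_star :: "real \<Rightarrow> real \<Rightarrow> real \<Rightarrow> real \<Rightarrow> real" where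
  "beta_star amin amax cmin cmax = sqrt (1 - (lam_min amin cmin)\<^sup>2 / (lam_max amax cmax)\<^sup>2)"

definition p_const :: "real \<Rightarrow> real \<Rightarrow> real \<Rightarrow> real \<Rightarrow> real \<Rightarrow> real \<Rightarrow> nat \<Rightarrow> real" where
  "p_const amin amax cmin cmax lA lc d =
     (1 + pi) / pi * alpha_star amin amax cmin cmax * lA * (real d)\<^sup>2
       + alpha_star amin amax cmin cmax * lc + 1"

definition log_plus :: "real \<Rightarrow> real" where
  "log_plus t = (if t = 0 then 0 else max (ln t) 0)"

definition T_const :: "real \<Rightarrow> real \<Rightarrow> real \<Rightarrow> real \<Rightarrow> real \<Rightarrow> real \<Rightarrow> nat" where
  "T_const amin amax cmin cmax F \<epsilon> =
     (if beta_star amin amax cmin cmax = 0 then 1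
      else nat \<lceil>log_plus (2 * F / (\<epsilon> * lam_min amin cmin)) / \<bar>ln (beta_star amin amax cmin cmax)\<bar>\<rceil>)"

text \<open>\<open>lf\<close> is the Barron norm of the right-hand side and \<open>F\<close> its dual norm, in the version that
  belongs to the boundary condition.\<close>

definition M_const ::
  "real \<Rightarrow> real \<Rightarrow> real \<Rightarrow> real \<Rightarrow> real \<Rightarrow> real \<Rightarrow> real \<Rightarrow> real \<Rightarrow> nat \<Rightarrow> real \<Rightarrow> real" where
  "M_const amin amax cmin cmax lA lc lf F d \<epsilon> =
     (let p = p_const amin amax cmin cmax lA lc d
      in alpha_star amin amax cmin cmax * lf * (p ^ T_const amin amax cmin cmax F \<epsilon> - 1) / (2 * (p - 1)))"

definition cos_network ::
  "nat \<Rightarrow> nat \<Rightarrow> (nat \<Rightarrow> real) \<Rightarrow> (nat \<Rightarrow> nat \<Rightarrow> real) \<Rightarrow> (nat \<Rightarrow> real) \<Rightarrow> (nat \<Rightarrow> real) \<Rightarrow> real" where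
  "cos_network d k a w b x =
     1 / real k * (\<Sum>i=1..k. a i * cos ((\<Sum>j<d. w i j * x j) + b i))"

end

theory Submission
  imports Defs
begin

text \<open>
  Why the theorem is true. Write \<open>L\<close> for the differential operator, \<open>\<alpha>\<close>, \<open>\<beta>\<close>, \<open>p(d)\<close>, \<open>T\<close>, \<open>M\<close> for the
  constants of the statement. The weak solution is the limit of the iteration
  \<open>u\<^sub>t\<^sub>+\<^sub>1 = u\<^sub>t - \<alpha> (I - \<Delta>)\<^sup>-\<^sup>1 (L u\<^sub>t - f)\<close>, \<open>u\<^sub>0 = 0\<close>, that is, of the gradient descent of the energy in
  the \<open>H\<^sup>1\<close> inner product. One step multiplies the \<open>H\<^sup>1\<close> distance to the solution by at most \<open>\<beta>\<close>
  (\<open>contraction_step\<close>), and the solution has norm at most the dual norm of \<open>f\<close> over the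
  ellipticity constant; the number \<open>T\<close> is what makes the remaining distance at most \<open>\<epsilon> / 2\<close>.

  The iterates are finite combinations of products of sines (Dirichlet) or of cosines (Neumann).
  A product of two trigonometric products is an average of such products with the sums and
  differences of the frequencies (\<open>trig_mult\<close>). Since \<open>A\<^sub>i\<^sub>j\<close> has sine factors exactly in the two
  directions \<open>i \<noteq> j\<close>, and none if \<open>i = j\<close>, the function \<open>\<partial>\<^sub>j (A\<^sub>i\<^sub>j \<partial>\<^sub>i u)\<close> has the parities of \<open>u\<close> again, and
  the flux has a vanishing boundary term in the integration by parts (\<open>represented_flux\<close>).
  Applying \<open>(I - \<Delta>)\<^sup>-\<^sup>1\<close> divides the coefficient of frequency \<open>k\<close> by \<open>1 + \<pi>\<^sup>2 |k|\<^sup>2\<close>. Hence the mass of an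
  iterate, the sum of its absolute coefficients with these weights, grows per step at most by the
  factor \<open>p(d)\<close> and the summand \<open>\<alpha> l\<^sub>f / 2\<close> (\<open>represented_residual\<close>). The resulting geometric sum is \<open>M\<close>.

  Two devices keep all sums finite. The expansions of \<open>A\<close>, \<open>c\<close> and \<open>f\<close> are truncated anew in every step,
  with a tolerance chosen after the current iterate is known (\<open>iteration\<close>). And the mass is an
  upper bound for some representation of a function as a combination (\<open>combo\<close>), not a norm.
  The Riesz representative of the residual is written down explicitly, so that no existence
  theorem in Hilbert spaces enters.

  Finally, a product of sines and cosines is an average of plane waves \<open>cos (w \<bullet> x + b)\<close>
  (\<open>trig_combo_wave\<close>), so the last iterate is a combination of plane waves of mass at most \<open>M\<close>, and
  Maurey's sampling argument (\<open>maurey\<close>) yields a network of width \<open>k\<close> at distance \<open>M / \<surd>k\<close>. As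
  \<open>T = O(|ln \<epsilon>|)\<close> and \<open>p(d) = O(d\<^sup>2)\<close>, both \<open>M\<close> and \<open>k = O(M\<^sup>2 / \<epsilon>\<^sup>2)\<close> are bounded by a
  constant times a power of \<open>d\<close> whose exponent is a multiple of \<open>|ln \<epsilon>|\<close>.

  Everything concerning Sobolev spaces rests on one family of cut-off functions (\<open>plateau\<close>). They
  approximate indicators of boxes, which shows that weak derivatives are unique
  (\<open>fundamental_lemma\<close>), and they turn a trigonometric product into a test function without
  destroying a bound on a derivative in a direction with a sine factor (\<open>trig_cut_deriv\<close>), which
  gives the integration by parts.
\<close>

section \<open>Smooth cut-off functions\<close>

text \<open>The function \<open>exp (- 1 / t)\<close> with all powers of \<open>1 / t\<close> as factors, which is a family closed under
  differentiation.\<close>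

definition ebump :: "nat \<Rightarrow> real \<Rightarrow> real" where
  "ebump n t = (if t > 0 then exp (- 1 / t) / t ^ n else 0)"

lemma ebump_nonneg: "0 \<le> ebump n t"
  by (simp add: ebump_def)

lemma ebump_0_le_1: "ebump 0 t \<le> 1"
  by (simp add: ebump_def)

lemma power_over_fact_le_exp:
  assumes "0 \<le> (x::real)" shows "x ^ n / fact n \<le> exp x"
proof -
  have "(\<Sum>k\<in>{n}. x ^ k /\<^sub>R fact k) \<le> (\<Sum>k. x ^ k /\<^sub>R fact k)"
    using assms by (intro sum_le_suminf summable_exp_generic) auto
  then show ?thesis by (simp add: exp_def divide_inverse mult.commute)
qed

text \<open>From \<open>s\<^sup>m / m! \<le> exp s\<close> with \<open>s = 1 / t\<close> and \<open>m = n + 2\<close>. The factor \<open>t\<^sup>2\<close> is what makes the derivative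
  at \<open>0\<close> vanish.\<close>

lemma ebump_le: "\<bar>ebump n t\<bar> \<le> fact (n + 2) * t\<^sup>2"
proof (cases "t > 0")
  case True
  have "(1 / t) ^ (n+2) / fact (n+2) \<le> exp (1 / t)"
    using True by (intro power_over_fact_le_exp) simp
  then have "1 / (t ^ (n+2)) \<le> fact (n+2) * exp (1 / t)"
    using pos_divide_le_eq[THEN iffD1, OF fact_gt_zero, of "(1 / t) ^ (n+2)" "n + 2" "exp (1 / t)"]
    by (simp add: power_one_over mult.commute del: fact_Suc power_Suc)
  then have "t\<^sup>2 * (1 / (t ^ (n+2))) \<le> t\<^sup>2 * (fact (n+2) * exp (1 / t))"
    by (intro mult_left_mono) auto
  then have "1 / t ^ n \<le> (fact (n+2) * t\<^sup>2) * exp (1 / t)"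
    using True by (simp add: power_add power2_eq_square mult_ac del: fact_Suc)
  then have "exp (- 1 / t) / (t ^ n) \<le> fact (n+2) * t\<^sup>2"
    using pos_divide_le_eq[of "exp (1 / t)" "1 / t ^ n" "fact (n+2) * t\<^sup>2"]
    by (simp add: exp_minus inverse_eq_divide mult.commute del: fact_Suc)
  then show ?thesis using True by (simp add: ebump_def)
qed (simp add: ebump_def)

lemma has_deriv_ebump:
  "(ebump n has_real_derivative (ebump (n + 2) t - real n * ebump (n + 1) t)) (at t)"
proof -
  consider "t > 0" | "t < 0" | "t = 0" by linarith
  then show ?thesis
  proof cases
    case 1
    have "((\<lambda>t. exp (- 1 / t) / t ^ n) has_real_derivative (ebump (n + 2) t - real n * ebump (n + 1) t)) (at t)"
    proof (rule DERIV_cong)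
      show "((\<lambda>t. exp (- 1 / t) / t ^ n) has_real_derivative
          (exp (- 1 / t) * (1 / t\<^sup>2) * t ^ n - exp (- 1 / t) * (real n * t ^ (n - 1))) / (t ^ n * t ^ n)) (at t)"
        using 1 by (auto intro!: derivative_eq_intros simp: power2_eq_square)
      have "real n * t ^ (n - 1) = real n * (t ^ n / t)"
        using 1 by (cases n) auto
      then show "(exp (- 1 / t) * (1 / t\<^sup>2) * t ^ n - exp (- 1 / t) * (real n * t ^ (n - 1))) / (t ^ n * t ^ n)
          = ebump (n + 2) t - real n * ebump (n + 1) t"
        using 1 by (simp add: ebump_def power2_eq_square diff_divide_distrib)
    qed
    moreover have "\<forall>\<^sub>F x in nhds t. ebump n x = exp (- 1 / x) / x ^ n"
      using eventually_nhds_in_open[of "{0<..}" t] 1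
      by (auto elim!: eventually_mono simp: ebump_def)
    ultimately show ?thesis by (simp add: DERIV_cong_ev)
  next
    case 2
    have "\<forall>\<^sub>F x in nhds t. ebump n x = 0"
      using eventually_nhds_in_open[of "{..<0}" t] 2
      by (auto elim!: eventually_mono simp: ebump_def)
    then have "(ebump n has_real_derivative 0) (at t) \<longleftrightarrow> ((\<lambda>_. 0) has_real_derivative 0) (at t)"
      by (intro DERIV_cong_ev) auto
    then show ?thesis using 2 by (simp add: ebump_def)
  next
    case 3
    have "((\<lambda>h. ebump n h / h) \<longlongrightarrow> 0) (at 0)"
    proof (rule Lim_null_comparison)
      have "norm (ebump n h / h) \<le> fact (n+2) * \<bar>h\<bar>" if "h \<noteq> 0" for h
      proof -
        have "\<bar>ebump n h\<bar> / \<bar>h\<bar> \<le> (fact (n+2) * h\<^sup>2) / \<bar>h\<bar>"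
          using ebump_le[of n h] by (intro divide_right_mono) auto
        also have "\<dots> = fact (n+2) * (h\<^sup>2 / \<bar>h\<bar>)"
          by (rule times_divide_eq_right[symmetric])
        also have "h\<^sup>2 / \<bar>h\<bar> = \<bar>h\<bar>"
          using that by (auto simp: power2_eq_square abs_if)
        finally show ?thesis unfolding real_norm_def abs_divide .
      qed
      then show "\<forall>\<^sub>F h in at 0. norm (ebump n h / h) \<le> fact (n+2) * \<bar>h\<bar>"
        by (auto simp: eventually_at intro!: exI[of _ 1])
      show "((\<lambda>h. fact (n+2) * \<bar>h\<bar>) \<longlongrightarrow> (0::real)) (at 0)"
        by (intro tendsto_mult_right_zero tendsto_rabs_zero tendsto_ident_at)
    qed
    moreover have "ebump m 0 = 0" for m by (simp add: ebump_def)
    ultimately show ?thesis unfolding DERIV_def 3 by simp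
  qed
qed

text \<open>Instead of iterated differentiability, a syntax of functions on which differentiation
  acts as an operation, so that all derivatives exist.\<close>

datatype smooth_term =
  Const real | Sine real | Cosine real | Bump nat real real
| Plus smooth_term smooth_term | Times smooth_term smooth_term

primrec sval :: "smooth_term \<Rightarrow> real \<Rightarrow> real" where
  "sval (Const c) t = c"
| "sval (Sine a) t = sin (a * t)"
| "sval (Cosine a) t = cos (a * t)"
| "sval (Bump n a b) t = ebump n (a * t + b)"
| "sval (Plus e e') t = sval e t + sval e' t"
| "sval (Times e e') t = sval e t * sval e' t"

primrec sderiv :: "smooth_term \<Rightarrow> smooth_term" where
  "sderiv (Const c) = Const 0"
| "sderiv (Sine a) = Times (Const a) (Cosine a)"
| "sderiv (Cosine a) = Times (Const (- a)) (Sine a)"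
| "sderiv (Bump n a b) = Times (Const a) (Plus (Bump (n + 2) a b) (Times (Const (- real n)) (Bump (n + 1) a b)))"
| "sderiv (Plus e e') = Plus (sderiv e) (sderiv e')"
| "sderiv (Times e e') = Plus (Times (sderiv e) e') (Times (sderiv e') e)"

definition smooth1 :: "(real \<Rightarrow> real) \<Rightarrow> bool" where
  "smooth1 f \<longleftrightarrow> f \<in> range sval"

lemma sval_abs:
  "sval (Const c) = (\<lambda>t. c)" "sval (Sine a) = (\<lambda>t. sin (a * t))"
  "sval (Cosine a) = (\<lambda>t. cos (a * t))" "sval (Bump n a b) = (\<lambda>t. ebump n (a * t + b))"
  "sval (Plus e e') = (\<lambda>t. sval e t + sval e' t)"
  "sval (Times e e') = (\<lambda>t. sval e t * sval e' t)"
  by (simp_all add: fun_eq_iff)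

lemma sval_has_deriv: "(sval e has_real_derivative sval (sderiv e) t) (at t)"
proof (induction e)
  case (Const c)
  show ?case by (simp add: sval_abs)
next
  case (Sine a)
  have "((\<lambda>t. sin (a * t)) has_real_derivative a * cos (a * t)) (at t)"
    by (auto intro!: derivative_eq_intros)
  then show ?case by (simp add: sval_abs)
next
  case (Cosine a)
  have "((\<lambda>t. cos (a * t)) has_real_derivative (- a) * sin (a * t)) (at t)"
    by (auto intro!: derivative_eq_intros)
  then show ?case by (simp add: sval_abs)
next
  case (Bump n a b)
  have "((\<lambda>t. ebump n (a * t + b)) has_real_derivative
      (ebump (n + 2) (a * t + b) - real n * ebump (n + 1) (a * t + b)) * a) (at t)"
  proof (rule DERIV_chain2[where f = "ebump n", OF has_deriv_ebump])
    show "((\<lambda>t. a * t + b) has_real_derivative a) (at t)"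
      by (auto intro!: derivative_eq_intros)
  qed
  then show ?case by (simp add: sval_abs algebra_simps)
next
  case (Plus e e')
  then show ?case by (simp add: sval_abs DERIV_add)
next
  case (Times e e')
  then show ?case by (simp add: sval_abs DERIV_mult)
qed

lemma smooth1_deriv:
  assumes "smooth1 f"
  shows "smooth1 (deriv f)" and "(f has_real_derivative deriv f t) (at t)"
proof -
  obtain e where f: "f = sval e" using assms by (auto simp: smooth1_def)
  have "deriv f = sval (sderiv e)"
    unfolding f by (rule ext) (rule DERIV_imp_deriv[OF sval_has_deriv])
  then show "smooth1 (deriv f)" "(f has_real_derivative deriv f t) (at t)"
    using sval_has_deriv[of e t] by (auto simp: f smooth1_def)
qed

lemma smooth1_mult: "smooth1 f \<Longrightarrow> smooth1 g \<Longrightarrow> smooth1 (\<lambda>t. f t * g t)"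
proof -
  assume "smooth1 f" "smooth1 g"
  then obtain e e' where "f = sval e" "g = sval e'" by (auto simp: smooth1_def)
  then have "(\<lambda>t. f t * g t) = sval (Times e e')" by (simp add: fun_eq_iff)
  then show ?thesis by (simp add: smooth1_def)
qed

lemma smooth1_sin: "smooth1 (\<lambda>t. sin (a * t))"
  and smooth1_cos: "smooth1 (\<lambda>t. cos (a * t))"
  and smooth1_ebump: "smooth1 (\<lambda>t. ebump n (a * t + b))"
  using rangeI[of sval "Sine a"] rangeI[of sval "Cosine a"]
    rangeI[of sval "Bump n a b"]
  by (simp_all add: smooth1_def sval_abs)

lemma smooth1_continuous: "smooth1 f \<Longrightarrow> continuous_on S f"
  using DERIV_isCont[OF smooth1_deriv(2)] by (intro continuous_at_imp_continuous_on ballI)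

text \<open>A smooth function that tends to the indicator of \<open>{a<..<b}\<close> from below as \<open>n\<close> grows and
  vanishes within distance \<open>1 / n\<close> of the complement.\<close>

definition plateau :: "real \<Rightarrow> real \<Rightarrow> nat \<Rightarrow> real \<Rightarrow> real" where
  "plateau a b n t = ebump 0 (real n * t + (- real n * a - 1)) * ebump 0 ((- real n) * t + (real n * b - 1))"

lemma plateau_smooth1: "smooth1 (plateau a b n)"
  unfolding plateau_def[abs_def] by (rule smooth1_mult[OF smooth1_ebump smooth1_ebump])

lemma plateau_bounds: "0 \<le> plateau a b n t" "plateau a b n t \<le> 1"
  unfolding plateau_def
  by (rule mult_nonneg_nonneg mult_le_one ebump_nonneg ebump_0_le_1)+

lemma plateau_eq_0: "t \<notin> {a + 1 / real n .. b - 1 / real n} \<Longrightarrow> plateau a b n t = 0"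
proof (cases "n = 0")
  case False
  assume "t \<notin> {a + 1 / real n .. b - 1 / real n}"
  then consider "t < a + 1 / real n" | "t > b - 1 / real n" by fastforce
  then show ?thesis
  proof cases
    case 1
    then have "real n * t < real n * (a + 1 / real n)"
      using False by (intro mult_strict_left_mono) auto
    then have "real n * t + (- real n * a - 1) < 0"
      using False by (simp add: algebra_simps)
    then show ?thesis by (simp add: plateau_def ebump_def)
  next
    case 2
    then have "real n * t > real n * (b - 1 / real n)"
      using False by (intro mult_strict_left_mono) auto
    then have "(- real n) * t + (real n * b - 1) < 0"
      using False by (simp add: algebra_simps)
    then show ?thesis by (simp add: plateau_def ebump_def)
  qed
qed (simp add: plateau_def ebump_def)

lemma ebump_0_tendsto:
  assumes "s > 0" shows "(\<lambda>n. ebump 0 (real n * s - 1)) \<longlonglongrightarrow> 1"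
proof -
  have "filterlim (\<lambda>n. -1 + s * real n) at_top sequentially"
    by (rule filterlim_tendsto_add_at_top[OF tendsto_const
        filterlim_tendsto_pos_mult_at_top[OF tendsto_const assms filterlim_real_sequentially]])
  then have lim: "filterlim (\<lambda>n. real n * s - 1) at_top sequentially"
    by (simp add: mult.commute)
  have "(\<lambda>n. exp (- inverse (real n * s - 1))) \<longlonglongrightarrow> exp (- 0)"
    by (rule tendsto_exp[OF tendsto_minus[OF tendsto_inverse_0_at_top[OF lim]]])
  then have 1: "(\<lambda>n. exp (- inverse (real n * s - 1))) \<longlonglongrightarrow> 1" by simp
  have "\<forall>\<^sub>F n in sequentially. 0 < real n * s - 1"
    using lim unfolding filterlim_at_top_dense by blast
  then have "\<forall>\<^sub>F n in sequentially. exp (- inverse (real n * s - 1)) = ebump 0 (real n * s - 1)"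
    by eventually_elim (simp add: ebump_def divide_inverse)
  from Lim_transform_eventually[OF 1 this] show ?thesis .
qed

lemma plateau_tendsto: "(\<lambda>n. plateau a b n t) \<longlonglongrightarrow> indicator {a<..<b} t"
proof (cases "t \<in> {a<..<b}")
  case True
  then have "(\<lambda>n. ebump 0 (real n * (t - a) - 1) * ebump 0 (real n * (b - t) - 1)) \<longlonglongrightarrow> 1 * 1"
    by (intro tendsto_mult ebump_0_tendsto) auto
  moreover have "plateau a b n t = ebump 0 (real n * (t - a) - 1) * ebump 0 (real n * (b - t) - 1)" for n
    by (simp add: plateau_def algebra_simps)
  ultimately show ?thesis using True by simp
next
  case False
  have "plateau a b n t = 0" for n
  proof (cases "n = 0")
    case False
    then have "0 < 1 / real n" by simp
    with \<open>t \<notin> {a<..<b}\<close> have "t \<notin> {a + 1 / real n .. b - 1 / real n}"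
      unfolding atLeastAtMost_iff greaterThanLessThan_iff by linarith
    then show ?thesis by (rule plateau_eq_0)
  qed (simp add: plateau_def ebump_def)
  with False show ?thesis by simp
qed

definition plateau' :: "real \<Rightarrow> real \<Rightarrow> nat \<Rightarrow> real \<Rightarrow> real" where
  "plateau' a b n t =
     real n * ebump 2 (real n * t + (- real n * a - 1)) * ebump 0 ((- real n) * t + (real n * b - 1))
     - ebump 0 (real n * t + (- real n * a - 1)) * (real n * ebump 2 ((- real n) * t + (real n * b - 1)))"

lemma has_deriv_plateau: "(plateau a b n has_real_derivative plateau' a b n t) (at t)"
proof -
  have 0: "(ebump 0 has_real_derivative ebump 2 s) (at s)" for s
    using has_deriv_ebump[of 0 s] by (simp add: numeral_2_eq_2)
  have *: "((\<lambda>t. ebump 0 (c * t + e)) has_real_derivative ebump 2 (c * t + e) * c) (at t)" for c e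
  proof (rule DERIV_chain2[where f = "ebump 0", OF 0])
    show "((\<lambda>t. c * t + e) has_real_derivative c) (at t)"
      by (auto intro!: derivative_eq_intros)
  qed
  show ?thesis unfolding plateau_def[abs_def]
    by (rule DERIV_cong[OF DERIV_mult[OF * *]]) (simp add: plateau'_def mult_ac)
qed

text \<open>For \<open>s > 1\<close> and with \<open>z = 1 / (s - 1)\<close> the claim becomes \<open>z + z\<^sup>2 \<le> 2 exp z\<close>.\<close>

lemma hardy_bound:
  assumes "0 \<le> s" shows "s * ebump 2 (s - 1) \<le> 2"
proof (cases "s > 1")
  case True
  define z where "z = 1 / (s - 1)"
  have "z > 0" "s = 1 + 1 / z" using True by (auto simp: z_def)
  have "1 + z + z\<^sup>2 / 2 \<le> exp z" using exp_lower_Taylor_quadratic[of z] \<open>z > 0\<close> by simp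
  then have "z + z\<^sup>2 \<le> 2 * exp z" using \<open>z > 0\<close> by (simp add: field_simps)
  then have "(z + z\<^sup>2) * exp (- z) \<le> 2 * exp z * exp (- z)" by (intro mult_right_mono) auto
  also have "\<dots> = 2" by (simp flip: exp_add)
  finally show ?thesis using \<open>z > 0\<close> unfolding \<open>s = 1 + 1 / z\<close> 
    by (simp add: ebump_def power_divide algebra_simps power2_eq_square)
qed (simp add: ebump_def)

lemma hardy_tendsto:
  assumes "t > 0" shows "(\<lambda>n. real n * t * ebump 2 (real n * t - 1)) \<longlonglongrightarrow> 0"
proof (rule Lim_null_comparison)
  have "filterlim (\<lambda>n. -1 + t * real n) at_top sequentially"
    by (rule filterlim_tendsto_add_at_top[OF tendsto_const
        filterlim_tendsto_pos_mult_at_top[OF tendsto_const assms filterlim_real_sequentially]])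
  then have lim: "filterlim (\<lambda>n. real n * t - 1) at_top sequentially"
    by (simp add: mult.commute)
  have i: "(\<lambda>n. inverse (real n * t - 1)) \<longlonglongrightarrow> 0"
    by (rule tendsto_inverse_0_at_top[OF lim])
  have "(\<lambda>n. inverse (real n * t - 1) + inverse (real n * t - 1) * inverse (real n * t - 1)) \<longlonglongrightarrow> 0 + 0 * 0"
    by (rule tendsto_add[OF i tendsto_mult[OF i i]])
  then show "(\<lambda>n. inverse (real n * t - 1) + inverse (real n * t - 1) * inverse (real n * t - 1)) \<longlonglongrightarrow> 0"
    by simp
  have "\<forall>\<^sub>F n in sequentially. 0 < real n * t - 1"
    using lim unfolding filterlim_at_top_dense by blast
  then show "\<forall>\<^sub>F n in sequentially. norm (real n * t * ebump 2 (real n * t - 1))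
      \<le> inverse (real n * t - 1) + inverse (real n * t - 1) * inverse (real n * t - 1)"
  proof eventually_elim
    case (elim n)
    define y where "y = real n * t - 1"
    have y: "y > 0" "real n * t = y + 1" using elim by (auto simp: y_def)
    have "(y + 1) * (exp (- 1 / y) / y\<^sup>2) \<le> (y + 1) * (1 / y\<^sup>2)"
      using y by (intro mult_left_mono divide_right_mono) auto
    also have "\<dots> = inverse y + inverse y * inverse y"
      using y by (simp add: field_simps power2_eq_square)
    finally show ?case using y(1) unfolding y(2) by (simp add: ebump_def)
  qed
qed

text \<open>A factor that vanishes linearly at both endpoints compensates the growth of the
  derivative of the cut-off function.\<close>

lemma plateau'_mult:
  assumes "0 < t" "t < 1" and "\<bar>c\<bar> \<le> C * t" "\<bar>c\<bar> \<le> C * (1 - t)"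
  shows "\<bar>c * plateau' 0 1 n t\<bar> \<le> 4 * C" and "(\<lambda>n. c * plateau' 0 1 n t) \<longlonglongrightarrow> 0"
proof -
  define q where "q s n = real n * s * ebump 2 (real n * s - 1)" for s n
  have "0 \<le> C" using assms by (smt (verit) mult_less_0_iff)
  have b: "\<bar>c * plateau' 0 1 n t\<bar> \<le> C * (q t n + q (1 - t) n)" for n
  proof -
    have eq: "plateau' 0 1 n t = real n * ebump 2 (real n * t - 1) * ebump 0 (real n * (1 - t) - 1)
        - real n * ebump 2 (real n * (1 - t) - 1) * ebump 0 (real n * t - 1)"
      by (simp add: plateau'_def algebra_simps)
    have A: "\<bar>c * (real n * ebump 2 (real n * s - 1) * ebump 0 r)\<bar> \<le> C * q s n"
      if "\<bar>c\<bar> \<le> C * s" for s r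
    proof -
      have "\<bar>c\<bar> * (real n * ebump 2 (real n * s - 1) * ebump 0 r)
          \<le> (C * s) * (real n * ebump 2 (real n * s - 1) * 1)"
        using that by (intro mult_mono) (auto simp: ebump_nonneg ebump_0_le_1 intro: order_trans[OF abs_ge_zero])
      then show ?thesis by (simp add: abs_mult ebump_nonneg q_def mult_ac)
    qed
    have "\<bar>c * plateau' 0 1 n t\<bar> \<le> \<bar>c * (real n * ebump 2 (real n * t - 1) * ebump 0 (real n * (1 - t) - 1))\<bar>
       + \<bar>c * (real n * ebump 2 (real n * (1 - t) - 1) * ebump 0 (real n * t - 1))\<bar>"
      unfolding eq right_diff_distrib by (rule abs_triangle_ineq4)
    also have "\<dots> \<le> C * q t n + C * q (1 - t) n"
      by (rule add_mono[OF A[OF assms(3)] A[OF assms(4)]])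
    finally show ?thesis by (simp add: distrib_left)
  qed
  have "q s n \<le> 2" if "0 \<le> s" for s n
    unfolding q_def using that by (intro hardy_bound) auto
  then have "q t n + q (1 - t) n \<le> 4" using assms(1,2) by (smt (verit))
  then have "C * (q t n + q (1 - t) n) \<le> C * 4" using \<open>0 \<le> C\<close> by (rule mult_left_mono)
  then show "\<bar>c * plateau' 0 1 n t\<bar> \<le> 4 * C" using b[of n] by linarith
  have "(\<lambda>n. C * (q t n + q (1 - t) n)) \<longlonglongrightarrow> C * (0 + 0)"
    unfolding q_def using assms(1,2) by (intro tendsto_intros hardy_tendsto) auto
  then have l: "(\<lambda>n. C * (q t n + q (1 - t) n)) \<longlonglongrightarrow> 0" by simp
  show "(\<lambda>n. c * plateau' 0 1 n t) \<longlonglongrightarrow> 0"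
    by (rule Lim_null_comparison[OF always_eventually l]) (use b in auto)
qed


section \<open>Tensor products as test functions\<close>

definition tensor :: "nat \<Rightarrow> (nat \<Rightarrow> real \<Rightarrow> real) \<Rightarrow> (nat \<Rightarrow> real) \<Rightarrow> real" where
  "tensor d g x = (\<Prod>m<d. g m (x m))"

lemma tensor_upd:
  assumes "i < d"
  shows "tensor d (g(i := h)) x = h (x i) * (\<Prod>m\<in>{..<d} - {i}. g m (x m))"
  unfolding tensor_def by (subst prod.remove[of _ i]) (use assms in auto)

lemma tensor_split: "i < d \<Longrightarrow> tensor d g x = g i (x i) * (\<Prod>m\<in>{..<d} - {i}. g m (x m))"
  using tensor_upd[of i d g "g i" x] by simp

lemma tensor_has_deriv:
  assumes "i < d" "(g i has_real_derivative h (x i)) (at (x i))"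
  shows "((\<lambda>t. tensor d g (x(i := t))) has_real_derivative tensor d (g(i := h)) x) (at (x i))"
proof -
  have "(\<lambda>t. tensor d g (x(i := t))) = (\<lambda>t. g i t * (\<Prod>m\<in>{..<d} - {i}. g m (x m)))"
    using assms(1) by (auto simp: tensor_split fun_eq_iff)
  then show ?thesis
    using DERIV_cmult_right[OF assms(2)] by (simp add: tensor_upd[OF assms(1)])
qed

lemma partial_deriv_tensor:
  assumes "i < d" "\<And>t. (g i has_real_derivative h t) (at t)"
  shows "partial_deriv i (tensor d g) = tensor d (g(i := h))"
  unfolding partial_deriv_def
  by (rule ext) (rule DERIV_imp_deriv[OF tensor_has_deriv[where h = h]], use assms in auto)

lemma continuous_on_tensor:
  assumes "\<And>m. m < d \<Longrightarrow> continuous_on UNIV (g m)"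
  shows "continuous_on S (tensor d g)"
proof -
  have "continuous_on S (\<lambda>x. \<Prod>m<d. g m (x m))"
    by (intro continuous_on_prod continuous_on_compose2[OF assms] continuous_on_product_coordinates
        continuous_on_subset[OF continuous_on_product_coordinates]) auto
  then show ?thesis by (simp add: tensor_def[abs_def])
qed

text \<open>A partial derivative changes one factor only, so tensor products are closed under iterated
  partial derivatives.\<close>

lemma foldr_partial_deriv_tensor:
  assumes "\<And>m. m < d \<Longrightarrow> smooth1 (g m)" "set is \<subseteq> {..<d}"
  shows "\<exists>h. (\<forall>m<d. smooth1 (h m)) \<and> foldr partial_deriv is (tensor d g) = tensor d h"
  using assms(2)
proof (induction "is")
  case Nil
  then show ?case using assms(1) by auto
next
  case (Cons i "is")
  then obtain h where h: "\<forall>m<d. smooth1 (h m)" "foldr partial_deriv is (tensor d g) = tensor d h"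
    by auto
  have i: "i < d" using Cons.prems by auto
  have "foldr partial_deriv (i # is) (tensor d g) = tensor d (h(i := deriv (h i)))"
    using h i by (simp add: partial_deriv_tensor[OF i smooth1_deriv(2)])
  moreover have "\<forall>m<d. smooth1 ((h(i := deriv (h i))) m)"
    using h(1) smooth1_deriv(1) i by auto
  ultimately show ?case by blast
qed

lemma smooth_tensor:
  assumes "\<And>m. m < d \<Longrightarrow> smooth1 (g m)"
  shows "smooth d (tensor d g)"
  unfolding smooth_def
proof (intro allI impI)
  fix "is" :: "nat list" assume "set is \<subseteq> {..<d}"
  from foldr_partial_deriv_tensor[of d g, OF assms this] obtain h where
    h: "\<forall>m<d. smooth1 (h m)" and eq: "foldr partial_deriv is (tensor d g) = tensor d h" by blast
  show "continuous_on (\<Omega> d) (foldr partial_deriv is (tensor d g)) \<and>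
     (\<forall>i<d. \<forall>x\<in>\<Omega> d. (\<lambda>t. foldr partial_deriv is (tensor d g) (x(i := t))) field_differentiable (at (x i)))"
    unfolding eq
  proof (intro conjI allI impI ballI)
    show "continuous_on (\<Omega> d) (tensor d h)"
      using h by (intro continuous_on_tensor smooth1_continuous) auto
    fix i x assume "i < d"
    then show "(\<lambda>t. tensor d h (x(i := t))) field_differentiable (at (x i))"
      using tensor_has_deriv[of i d h "deriv (h i)" x] smooth1_deriv(2) h
      by (auto simp: field_differentiable_def)
  qed
qed

text \<open>The coordinates from \<open>d\<close> on are frozen, which makes a box a full product and Tychonoff's theorem
  applicable.\<close>

lemma PiE_lessThan_eq: "{..<d} \<rightarrow>\<^sub>E S = PiE UNIV (\<lambda>m. if m < (d::nat) then S else {undefined})"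
  by (auto simp: PiE_def Pi_def extensional_def split: if_splits)

lemma compact_box: "compact ({..<d::nat} \<rightarrow>\<^sub>E {a..b::real})"
proof -
  have "compactin (product_topology (\<lambda>m::nat. euclidean :: real topology) UNIV)
      (PiE UNIV (\<lambda>m. if m < d then {a..b} else {undefined}))"
    by (simp add: compactin_PiE)
  then show ?thesis
    unfolding PiE_lessThan_eq euclidean_product_topology by simp
qed

lemma tensor_test_function:
  assumes g: "\<And>m. m < d \<Longrightarrow> smooth1 (g m)" and ab: "0 < a" "b < 1"
    and z: "\<And>m t. m < d \<Longrightarrow> 0 < t \<Longrightarrow> t < 1 \<Longrightarrow> t \<notin> {a..b} \<Longrightarrow> g m t = 0"
  shows "tensor d g \<in> test_functions d"
proof -
  let ?K = "{..<d} \<rightarrow>\<^sub>E {a..b}"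
  have "?K \<subseteq> \<Omega> d" using ab by (auto simp: \<Omega>_def PiE_def Pi_def)
  moreover have "tensor d g x = 0" if x: "x \<in> \<Omega> d - ?K" for x
  proof -
    obtain m where m: "m < d" "x m \<notin> {a..b}" using x by (auto simp: \<Omega>_def PiE_iff)
    have "0 < x m" "x m < 1" using x m(1) by (auto simp: \<Omega>_def PiE_iff)
    with z m have "g m (x m) = 0" by blast
    then show ?thesis using m(1) by (auto simp: tensor_def)
  qed
  ultimately show ?thesis
    using smooth_tensor[of d g, OF g] compact_box[of d a b] unfolding test_functions_def by blast
qed

section \<open>Integration over the cube\<close>

abbreviation interval_measure01 :: "real measure" where
  "interval_measure01 \<equiv> restrict_space lborel {0<..<1}"

text \<open>Fubini's theorem is applied to the product measure itself and the result is transferred to its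
  completion.\<close>

definition cube :: "nat \<Rightarrow> (nat \<Rightarrow> real) measure" where
  "cube d = PiM {..<d} (\<lambda>_. interval_measure01)"

lemma leb_eq: "leb d = completion (cube d)"
  by (simp add: leb_def cube_def)

lemma space_cube [simp]: "space (cube d) = \<Omega> d"
  by (simp add: cube_def \<Omega>_def space_PiM space_restrict_space)

interpretation I01: product_sigma_finite "\<lambda>_::nat. interval_measure01"
proof (rule product_sigma_finite.intro)
  show "sigma_finite_measure interval_measure01"
    by (rule sigma_finite_measure_restrict_space) (auto intro: lborel.sigma_finite_measure_axioms)
qed

lemma emeasure_cube: "emeasure (cube d) (\<Omega> d) = 1"
proof -
  have "emeasure (cube d) (Pi\<^sub>E {..<d} (\<lambda>_. {0<..<1})) = (\<Prod>i<d. emeasure interval_measure01 {0<..<1})"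
    unfolding cube_def
    by (rule I01.emeasure_PiM) (auto simp: sets_restrict_space_iff)
  also have "emeasure interval_measure01 {0<..<1} = 1"
    by (simp add: emeasure_restrict_space)
  finally show ?thesis by (simp add: \<Omega>_def)
qed

interpretation cube: finite_measure "cube d"
  by standard (simp add: emeasure_cube)

lemma emeasure_leb: "emeasure (leb d) (\<Omega> d) = 1"
proof -
  have "\<Omega> d \<in> sets (cube d)" using sets.top[of "cube d"] by simp
  then show ?thesis
    by (simp add: leb_eq emeasure_completion emeasure_cube sets_completionI_sets)
qed

interpretation leb: finite_measure "leb d"
  by standard (simp add: emeasure_leb)

lemma measure_leb: "measure (leb d) (\<Omega> d) = 1"
  by (simp add: measure_def emeasure_leb)

lemma cube_to_borel: "(\<lambda>x. x) \<in> measurable (cube d) (borel :: (nat \<Rightarrow> real) measure)"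
proof -
  have "(\<lambda>x. x) \<in> measurable (cube d) (PiM UNIV (\<lambda>_. borel :: real measure))"
  proof (rule measurable_PiM_single)
    fix A :: "real set" and i :: nat assume A: "A \<in> sets borel"
    show "{x \<in> space (cube d). x i \<in> A} \<in> sets (cube d)"
    proof (cases "i < d")
      case True
      have "(\<lambda>x. x i) \<in> measurable (cube d) interval_measure01"
        unfolding cube_def using True by (intro measurable_component_singleton) auto
      then have "(\<lambda>x. x i) \<in> measurable (cube d) borel"
        by (simp add: measurable_restrict_space2_iff)
      from measurable_sets[OF this A] show ?thesis by (simp add: vimage_def Int_def conj_commute)
    next
      case False
      then have "{x \<in> space (cube d). x i \<in> A} = (if undefined \<in> A then space (cube d) else {})"
        by (auto simp: \<Omega>_def PiE_def extensional_def)
      then show ?thesis by (metis sets.empty_sets sets.top)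
    qed
  qed auto
  then show ?thesis using measurable_cong_sets[OF refl sets_PiM_equal_borel] by blast
qed

lemma continuous_measurable_cube:
  assumes "continuous_on (\<Omega> d) (\<phi> :: _ \<Rightarrow> real)"
  shows "\<phi> \<in> borel_measurable (cube d)"
proof -
  have "(\<lambda>x. x) \<in> measurable (cube d) (restrict_space borel (\<Omega> d))"
    by (rule measurable_restrict_space2[OF _ cube_to_borel]) auto
  from measurable_compose[OF this borel_measurable_continuous_on_restrict[OF assms]] show ?thesis .
qed

lemma continuous_measurable:
  assumes "continuous_on (\<Omega> d) (\<phi> :: _ \<Rightarrow> real)"
  shows "\<phi> \<in> borel_measurable (leb d)"
  unfolding leb_eq by (rule measurable_completion[OF continuous_measurable_cube[OF assms]])

lemma integrable_bounded:
  assumes "\<phi> \<in> borel_measurable (leb d)" "\<And>x. x \<in> \<Omega> d \<Longrightarrow> \<bar>\<phi> x :: real\<bar> \<le> B"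
  shows "integrable (leb d) \<phi>"
  by (rule leb.integrable_const_bound[of _ B]) (use assms in \<open>auto simp: AE_space\<close>)

lemma L2_measurable: "u \<in> L2 d \<Longrightarrow> u \<in> borel_measurable (leb d)"
  by (simp add: L2_def)

lemma L2_bounded:
  assumes "\<phi> \<in> borel_measurable (leb d)" "\<And>x. x \<in> \<Omega> d \<Longrightarrow> \<bar>\<phi> x\<bar> \<le> B"
  shows "\<phi> \<in> L2 d"
proof -
  have "\<bar>(\<phi> x)\<^sup>2\<bar> \<le> B\<^sup>2" if "x \<in> \<Omega> d" for x
    using power_mono[OF assms(2)[OF that] abs_ge_zero, of 2] by simp
  then show ?thesis using assms(1) unfolding L2_def
    by (auto intro!: integrable_bounded[where B = "B\<^sup>2"])
qed

lemma L2_mult_integrable: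
  assumes "u \<in> L2 d" "v \<in> L2 d" shows "integrable (leb d) (\<lambda>x. u x * v x)"
proof (rule Bochner_Integration.integrable_bound)
  show "integrable (leb d) (\<lambda>x. (u x)\<^sup>2 + (v x)\<^sup>2)"
    using assms by (auto simp: L2_def)
  show "(\<lambda>x. u x * v x) \<in> borel_measurable (leb d)"
    by (rule borel_measurable_times[OF assms[THEN L2_measurable]])
  have "\<bar>a * b\<bar> \<le> a\<^sup>2 + b\<^sup>2" for a b :: real
  proof -
    have "2 * \<bar>a\<bar> * \<bar>b\<bar> \<le> a\<^sup>2 + b\<^sup>2"
      using sum_squares_bound[of "\<bar>a\<bar>" "\<bar>b\<bar>"] by simp
    moreover have "0 \<le> \<bar>a\<bar> * \<bar>b\<bar>" by simp
    ultimately show ?thesis unfolding abs_mult by linarith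
  qed
  then show "AE x in leb d. norm (u x * v x) \<le> norm ((u x)\<^sup>2 + (v x)\<^sup>2)"
    by auto
qed

lemma L2_add: assumes "u \<in> L2 d" "v \<in> L2 d" shows "(\<lambda>x. u x + v x) \<in> L2 d"
proof -
  have "(\<lambda>x. (u x + v x)\<^sup>2) = (\<lambda>x. (u x)\<^sup>2 + 2 * (u x * v x) + (v x)\<^sup>2)"
    by (auto simp: power2_sum fun_eq_iff)
  moreover have "integrable (leb d) (\<lambda>x. (u x)\<^sup>2 + 2 * (u x * v x) + (v x)\<^sup>2)"
    using assms L2_mult_integrable[OF assms]
    by (intro Bochner_Integration.integrable_add integrable_mult_right) (auto simp: L2_def)
  ultimately show ?thesis
    using borel_measurable_add[OF assms[THEN L2_measurable]] by (simp add: L2_def)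
qed

lemma L2_mult_bounded:
  assumes "u \<in> L2 d" "\<phi> \<in> borel_measurable (leb d)" "\<And>x. x \<in> \<Omega> d \<Longrightarrow> \<bar>\<phi> x\<bar> \<le> B"
  shows "(\<lambda>x. \<phi> x * u x) \<in> L2 d"
proof -
  have "integrable (leb d) (\<lambda>x. (\<phi> x * u x)\<^sup>2)"
  proof (rule Bochner_Integration.integrable_bound)
    show "integrable (leb d) (\<lambda>x. B\<^sup>2 * (u x)\<^sup>2)"
      using assms(1) by (auto simp: L2_def)
    show "(\<lambda>x. (\<phi> x * u x)\<^sup>2) \<in> borel_measurable (leb d)"
      by (rule borel_measurable_power[OF borel_measurable_times[OF assms(2) L2_measurable[OF assms(1)]]])
    have "(\<phi> x)\<^sup>2 \<le> B\<^sup>2" if "x \<in> \<Omega> d" for x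
      using power_mono[OF assms(3)[OF that] abs_ge_zero, of 2] by simp
    then show "AE x in leb d. norm ((\<phi> x * u x)\<^sup>2) \<le> norm (B\<^sup>2 * (u x)\<^sup>2)"
      by (auto simp: power_mult_distrib intro!: mult_right_mono AE_I2)
  qed
  then show ?thesis
    using borel_measurable_times[OF assms(2) L2_measurable[OF assms(1)]] by (simp add: L2_def)
qed

lemma L2_scale: "u \<in> L2 d \<Longrightarrow> (\<lambda>x. c * u x) \<in> L2 d"
  by (rule L2_mult_bounded[where B = "\<bar>c\<bar>"]) auto

lemma L2_integrable: "u \<in> L2 d \<Longrightarrow> integrable (leb d) u"
  using L2_mult_integrable[of u d "\<lambda>_. 1"] L2_bounded[of "\<lambda>_. 1" d 1] by simp


section \<open>Integration by parts against test functions\<close>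

definition C1_pair :: "nat \<Rightarrow> nat \<Rightarrow> ((nat \<Rightarrow> real) \<Rightarrow> real) \<Rightarrow> ((nat \<Rightarrow> real) \<Rightarrow> real) \<Rightarrow> bool" where
  "C1_pair d i \<psi> \<psi>' \<longleftrightarrow> continuous_on (\<Omega> d) \<psi> \<and> continuous_on (\<Omega> d) \<psi>' \<and>
     (\<exists>B. \<forall>x\<in>\<Omega> d. \<bar>\<psi> x\<bar> \<le> B \<and> \<bar>\<psi>' x\<bar> \<le> B) \<and>
     (\<forall>x\<in>\<Omega> d. ((\<lambda>t. \<psi> (x(i := t))) has_real_derivative \<psi>' x) (at (x i)))"

lemma continuous_upd: "continuous_on S (\<lambda>t. x(i := t :: real))"
proof (rule continuous_on_coordinatewise_then_product)
  show "continuous_on S (\<lambda>t. (x(i := t)) j)" for j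
    by (cases "j = i") (auto intro: continuous_on_id)
qed

lemma \<Omega>_upd: "x \<in> \<Omega> d \<Longrightarrow> i < d \<Longrightarrow> 0 < t \<Longrightarrow> t < 1 \<Longrightarrow> x(i := t) \<in> \<Omega> d"
  by (auto simp: \<Omega>_def PiE_iff extensional_def)

lemma \<Omega>_coord: "x \<in> \<Omega> d \<Longrightarrow> i < d \<Longrightarrow> 0 < x i \<and> x i < 1"
  unfolding \<Omega>_def using PiE_mem[of x "{..<d}" "\<lambda>_. {0<..<1}" i] by simp

text \<open>The complement of \<open>K\<close> is open, so the function vanishes on a piece of the line through \<open>x\<close> in direction \<open>i\<close>.\<close>

lemma deriv_zero_off_support:
  assumes K: "compact (K :: (nat \<Rightarrow> real) set)" and z: "\<And>x. x \<in> \<Omega> d - K \<Longrightarrow> \<eta> x = (0::real)"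
    and x: "x \<in> \<Omega> d - K" and i: "i < d"
  shows "((\<lambda>t. \<eta> (x(i := t))) has_real_derivative 0) (at (x i))"
proof -
  let ?U = "{0<..<1} \<inter> (\<lambda>t. x(i := t)) -` (- K)"
  have "open ((\<lambda>t. x(i := t)) -` (- K))"
    by (rule open_vimage[OF open_Compl[OF compact_imp_closed[OF K]] continuous_upd])
  then have U: "open ?U" by auto
  have xU: "x i \<in> ?U" using x \<Omega>_coord[of x d i] i by auto
  have "\<forall>\<^sub>F t in nhds (x i). \<eta> (x(i := t)) = 0"
    using eventually_nhds_in_open[OF U xU]
    by (rule eventually_mono) (use x i in \<open>auto intro!: z \<Omega>_upd\<close>)
  then have "((\<lambda>t. \<eta> (x(i := t))) has_real_derivative 0) (at (x i))
      \<longleftrightarrow> ((\<lambda>_. 0) has_real_derivative 0) (at (x i))"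
    by (intro DERIV_cong_ev) auto
  then show ?thesis by simp
qed

text \<open>On each line in direction \<open>i\<close> the fundamental theorem of calculus applies, and Fubini's theorem
  integrates over the lines.\<close>

lemma integral_partial_deriv_zero:
  assumes K: "compact K" "K \<subseteq> \<Omega> d" and z: "\<And>x. x \<in> \<Omega> d - K \<Longrightarrow> \<eta> x = (0::real)" and i: "i < d"
    and ch: "continuous_on (\<Omega> d) h"
    and D: "\<And>x. x \<in> \<Omega> d \<Longrightarrow> ((\<lambda>t. \<eta> (x(i := t))) has_real_derivative h x) (at (x i))"
  shows "(\<integral>x. h x \<partial>leb d) = 0"
proof -
  have hz: "h x = 0" if "x \<in> \<Omega> d - K" for x
    using DERIV_unique[OF D deriv_zero_off_support[OF K(1) z that i]] that by auto
  obtain B where B: "\<And>x. x \<in> K \<Longrightarrow> \<bar>h x\<bar> \<le> B"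
    using compact_imp_bounded[OF compact_continuous_image[OF continuous_on_subset[OF ch K(2)] K(1)]]
    by (auto simp: bounded_iff)
  have hB: "\<bar>h x\<bar> \<le> \<bar>B\<bar>" if "x \<in> \<Omega> d" for x
    using B[of x] hz[of x] that by (cases "x \<in> K") auto
  have meas: "h \<in> borel_measurable (cube d)" by (rule continuous_measurable_cube[OF ch])
  have int: "integrable (cube d) h"
    by (rule cube.integrable_const_bound[of _ "\<bar>B\<bar>"]) (use meas hB in auto)
  have "compact ((\<lambda>x. x i) ` K)"
    by (rule compact_continuous_image[OF continuous_on_subset[OF continuous_on_product_coordinates subset_UNIV] K(1)])
  moreover have "(\<lambda>x. x i) ` K \<subseteq> {0<..<1}" using K(2) \<Omega>_coord i by fastforce
  \<comment> \<open>The projection of \<open>K\<close> lies in \<open>[a, b]\<close>; integrating over the larger interval from \<open>a / 2\<close> to \<open>(1 + b) / 2\<close> puts both ends off \<open>K\<close>.\<close>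
  ultimately obtain a b where ab: "0 < a" "a \<le> b" "b < 1" "\<And>x. x \<in> K \<Longrightarrow> a \<le> x i \<and> x i \<le> b"
  proof (cases "K = {}")
    case True
    then show ?thesis using that[of "1/2" "1/2"] by auto
  next
    case False
    assume c: "compact ((\<lambda>x. x i) ` K)" and s: "(\<lambda>x. x i) ` K \<subseteq> {0<..<1}"
    from compact_attains_inf[OF c] False obtain p where p: "p \<in> K" "\<And>x. x \<in> K \<Longrightarrow> p i \<le> x i" by auto
    from compact_attains_sup[OF c] False obtain q where q: "q \<in> K" "\<And>x. x \<in> K \<Longrightarrow> x i \<le> q i" by auto
    have "p i \<in> {0<..<1}" "q i \<in> {0<..<1}" using s p(1) q(1) by blast+
    then show ?thesis using that[of "p i" "q i"] p q by auto
  qed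
  have ins: "insert i ({..<d} - {i}) = {..<d}" using i by auto
  have "(\<integral>x. h x \<partial>cube d) = (\<integral>x. (\<integral>y. h (x(i := y)) \<partial>interval_measure01) \<partial>PiM ({..<d} - {i}) (\<lambda>_. interval_measure01))"
    using I01.product_integral_insert[of "{..<d} - {i}" i h] int unfolding ins cube_def by simp
  also have "\<dots> = (\<integral>x. 0 \<partial>PiM ({..<d} - {i}) (\<lambda>_. interval_measure01))"
  proof (rule Bochner_Integration.integral_cong[OF refl])
    fix x assume "x \<in> space (PiM ({..<d} - {i}) (\<lambda>_. interval_measure01))"
    then have x: "x(i := t) \<in> \<Omega> d" if "0 < t" "t < 1" for t
      using that i by (auto simp: space_PiM \<Omega>_def PiE_iff space_restrict_space extensional_def)
    have off: "x(i := t) \<in> \<Omega> d - K" if "0 < t" "t < 1" "t \<notin> {a..b}" for t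
      using ab(4)[of "x(i := t)"] x[of t] that by auto
    have "(\<integral>y. h (x(i := y)) \<partial>interval_measure01) = (\<integral>y. indicator {0<..<1} y *\<^sub>R h (x(i := y)) \<partial>lborel)"
      by (rule integral_restrict_space) auto
    also have "\<dots> = (\<integral>y. h (x(i := y)) * indicator {a / 2..(1 + b) / 2} y \<partial>lborel)"
      using off hz ab(1-3) by (intro Bochner_Integration.integral_cong) (auto simp: indicator_def field_simps)
    also have "\<dots> = \<eta> (x(i := (1 + b) / 2)) - \<eta> (x(i := a / 2))"
    proof (rule integral_FTC_Icc_real)
      show "a / 2 \<le> (1 + b) / 2" using ab by simp
      fix y assume y: "a / 2 \<le> y" "y \<le> (1 + b) / 2"
      then have y01: "0 < y" "y < 1" using ab by auto
      show "((\<lambda>y. \<eta> (x(i := y))) has_real_derivative h (x(i := y))) (at y)"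
        using D[OF x[OF y01]] by simp
      have "continuous_on {0<..<1} (\<lambda>y. h (x(i := y)))"
        by (rule continuous_on_compose2[OF ch continuous_upd]) (use x in auto)
      then show "isCont (\<lambda>y. h (x(i := y))) y"
        using y01 by (simp add: continuous_on_eq_continuous_at)
    qed
    also have "\<dots> = 0"
      using z[OF off[of "(1 + b) / 2"]] z[OF off[of "a / 2"]] ab by auto
    finally show "(\<integral>y. h (x(i := y)) \<partial>interval_measure01) = 0" .
  qed
  finally show ?thesis
    using integral_completion[OF meas] by (simp add: leb_eq)
qed

lemma test_function_C1:
  assumes "\<phi> \<in> test_functions d" "i < d"
  shows "C1_pair d i \<phi> (partial_deriv i \<phi>)"
proof -
  have s: "smooth d \<phi>" using assms(1) by (simp add: test_functions_def)
  obtain K where K: "compact K" "K \<subseteq> \<Omega> d" "\<And>x. x \<in> \<Omega> d - K \<Longrightarrow> \<phi> x = 0"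
    using assms(1) by (auto simp: test_functions_def)
  have c: "continuous_on (\<Omega> d) \<phi>" using s[unfolded smooth_def, rule_format, of "[]"] by simp
  have c': "continuous_on (\<Omega> d) (partial_deriv i \<phi>)"
    using s[unfolded smooth_def, rule_format, of "[i]"] assms(2) by simp
  have D: "((\<lambda>t. \<phi> (x(i := t))) has_real_derivative partial_deriv i \<phi> x) (at (x i))" if "x \<in> \<Omega> d" for x
    using s[unfolded smooth_def, rule_format, of "[]"] assms(2) that
    by (simp add: partial_deriv_def field_differentiable_derivI)
  have z': "partial_deriv i \<phi> x = 0" if "x \<in> \<Omega> d - K" for x
    using DERIV_unique[OF D deriv_zero_off_support[OF K(1,3) that assms(2)]] that by auto
  have bd: "\<exists>B. \<forall>x\<in>K. \<bar>f x\<bar> \<le> B" if "continuous_on (\<Omega> d) f" for f :: "_ \<Rightarrow> real"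
    using compact_imp_bounded[OF compact_continuous_image[OF continuous_on_subset[OF that K(2)] K(1)]]
    by (auto simp: bounded_iff)
  obtain B B' where "\<forall>x\<in>K. \<bar>\<phi> x\<bar> \<le> B" "\<forall>x\<in>K. \<bar>partial_deriv i \<phi> x\<bar> \<le> B'"
    using bd[OF c] bd[OF c'] by blast
  then have "\<bar>\<phi> x\<bar> \<le> max \<bar>B\<bar> \<bar>B'\<bar> \<and> \<bar>partial_deriv i \<phi> x\<bar> \<le> max \<bar>B\<bar> \<bar>B'\<bar>" if "x \<in> \<Omega> d" for x
    using K(3)[of x] z'[of x] that by (cases "x \<in> K") fastforce+
  then show ?thesis unfolding C1_pair_def using c c' D by blast
qed

lemma C1_pair_L2:
  assumes "C1_pair d i \<psi> \<psi>'" shows "\<psi> \<in> L2 d" "\<psi>' \<in> L2 d"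
  using assms L2_bounded[OF continuous_measurable] unfolding C1_pair_def by blast+

text \<open>The product \<open>\<psi> \<phi>\<close> with a test function has compact support, so the integral of its derivative vanishes.\<close>

lemma C1_weak_deriv:
  assumes "C1_pair d i \<psi> \<psi>'" "i < d"
  shows "is_weak_deriv d i \<psi> \<psi>'"
  unfolding is_weak_deriv_def
proof (intro conjI ballI)
  show "\<psi>' \<in> L2 d" using C1_pair_L2[OF assms(1)] by simp
  fix \<phi> assume \<phi>: "\<phi> \<in> test_functions d"
  note P = assms(1)[unfolded C1_pair_def] and Q = test_function_C1[OF \<phi> assms(2), unfolded C1_pair_def]
  obtain K where K: "compact K" "K \<subseteq> \<Omega> d" "\<And>x. x \<in> \<Omega> d - K \<Longrightarrow> \<phi> x = 0"
    using \<phi> by (auto simp: test_functions_def)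
  have "(\<integral>x. \<psi> x * partial_deriv i \<phi> x + \<psi>' x * \<phi> x \<partial>leb d) = 0"
  proof (rule integral_partial_deriv_zero[OF K(1,2), where \<eta> = "\<lambda>x. \<psi> x * \<phi> x" and i = i])
    show "continuous_on (\<Omega> d) (\<lambda>x. \<psi> x * partial_deriv i \<phi> x + \<psi>' x * \<phi> x)"
      using P Q by (intro continuous_intros) auto
    fix x assume "x \<in> \<Omega> d"
    then have "((\<lambda>t. \<psi> (x(i := t))) has_real_derivative \<psi>' x) (at (x i))"
      "((\<lambda>t. \<phi> (x(i := t))) has_real_derivative partial_deriv i \<phi> x) (at (x i))" using P Q by auto
    from DERIV_mult[OF this] show "((\<lambda>t. \<psi> (x(i := t)) * \<phi> (x(i := t))) has_real_derivative
        \<psi> x * partial_deriv i \<phi> x + \<psi>' x * \<phi> x) (at (x i))"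
      by (simp add: algebra_simps)
  qed (use K(3) assms(2) in auto)
  moreover have "integrable (leb d) (\<lambda>x. \<psi> x * partial_deriv i \<phi> x)" "integrable (leb d) (\<lambda>x. \<psi>' x * \<phi> x)"
    using C1_pair_L2[OF assms(1)] C1_pair_L2[OF test_function_C1[OF \<phi> assms(2)]]
    by (auto intro: L2_mult_integrable)
  ultimately show "(\<integral>x. \<psi> x * partial_deriv i \<phi> x \<partial>leb d) = - (\<integral>x. \<psi>' x * \<phi> x \<partial>leb d)"
    by simp
qed

section \<open>Uniqueness of weak derivatives\<close>

text \<open>The sides may touch the faces of the cube, so that \<open>\<Omega> d\<close> is a box itself.\<close>

definition boxes :: "nat \<Rightarrow> (nat \<Rightarrow> real) set set" where
  "boxes d = {\<Pi>\<^sub>E m\<in>{..<d}. {a m<..<b m} | a b. \<forall>m. 0 \<le> a m \<and> b m \<le> 1}"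

lemma boxes_subset: "boxes d \<subseteq> Pow (\<Omega> d)"
proof
  fix X assume "X \<in> boxes d"
  then obtain a b where X: "X = (\<Pi>\<^sub>E m\<in>{..<d}. {a m<..<b m})" "\<forall>m. 0 \<le> a m \<and> b m \<le> 1"
    by (auto simp: boxes_def)
  have "X \<subseteq> \<Omega> d" unfolding X(1) \<Omega>_def
  proof (rule PiE_mono)
    show "{a m<..<b m} \<subseteq> {0<..<1}" for m
      using X(2)[rule_format, of m] by auto
  qed
  then show "X \<in> Pow (\<Omega> d)" by simp
qed

lemma boxes_Int_stable: "Int_stable (boxes d)"
proof (rule Int_stableI)
  fix X Y assume "X \<in> boxes d" "Y \<in> boxes d"
  then obtain a b a' b' where X: "X = (\<Pi>\<^sub>E m\<in>{..<d}. {a m<..<b m})" "\<forall>m. 0 \<le> a m \<and> b m \<le> 1"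
    and Y: "Y = (\<Pi>\<^sub>E m\<in>{..<d}. {a' m<..<b' m})" "\<forall>m. 0 \<le> a' m \<and> b' m \<le> 1"
    by (auto simp: boxes_def)
  have "X \<inter> Y = (\<Pi>\<^sub>E m\<in>{..<d}. {max (a m) (a' m)<..<min (b m) (b' m)})"
    unfolding X(1) Y(1) PiE_Int by (auto intro!: PiE_cong)
  moreover have "\<forall>m. 0 \<le> max (a m) (a' m) \<and> min (b m) (b' m) \<le> 1"
    using X(2) by (auto simp: le_max_iff_disj min_le_iff_disj)
  ultimately show "X \<inter> Y \<in> boxes d" unfolding boxes_def
    by (intro CollectI exI[of _ "\<lambda>m. max (a m) (a' m)"] exI[of _ "\<lambda>m. min (b m) (b' m)"] conjI refl) simp
qed

lemma \<Omega>_in_boxes: "\<Omega> d \<in> boxes d"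
  unfolding \<Omega>_def boxes_def by (intro CollectI exI[of _ "\<lambda>_. 0"] exI[of _ "\<lambda>_. 1"]) simp

lemma sets_cube: "sets (cube d) = sigma_sets (\<Omega> d) (boxes d)"
proof
  let ?N = "sigma (\<Omega> d) (boxes d)"
  have sN: "space ?N = \<Omega> d" and setsN: "sets ?N = sigma_sets (\<Omega> d) (boxes d)"
    using boxes_subset by (auto simp: space_measure_of sets_measure_of)
  have "sets (cube d) \<subseteq> sets ?N"
    unfolding cube_def
  proof (rule sets_PiM_in_sets)
    show "space ?N = (\<Pi>\<^sub>E i\<in>{..<d}. space interval_measure01)"
      using sN by (simp add: \<Omega>_def space_restrict_space)
    fix i A assume i: "i \<in> {..<d}" and "A \<in> sets interval_measure01"
    then obtain B where B: "B \<in> sets borel" "A = {0<..<1} \<inter> B" by (auto simp: sets_restrict_space)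
    have "(\<lambda>x. x i) \<in> borel_measurable ?N"
    proof (rule borel_measurableI_greater)
      fix y :: real
      have "{x \<in> \<Omega> d. y < x i} = (\<Pi>\<^sub>E m\<in>{..<d}. {(if m = i then max 0 y else 0)<..<1})"
      proof -
        have *: "x m \<in> {(if m = i then max 0 y else 0)<..<1} \<longleftrightarrow> x m \<in> {0<..<1} \<and> (m = i \<longrightarrow> y < x i)" for x m
          by (cases "m = i") auto
        show ?thesis
          by (rule set_eqI, unfold mem_Collect_eq \<Omega>_def PiE_iff *) (use i in fast)
      qed
      also have "\<dots> \<in> boxes d" unfolding boxes_def
        by (intro CollectI exI[of _ "\<lambda>m. if m = i then max 0 y else 0"] exI[of _ "\<lambda>_. 1"] conjI refl allI) simp_all
      finally show "{x \<in> space ?N. y < x i} \<in> sets ?N" unfolding sN setsN by (rule sigma_sets.Basic)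
    qed
    from measurable_sets[OF this B(1)] have "{x \<in> space ?N. x i \<in> B} \<in> sets ?N"
      by (simp add: vimage_def Int_def conj_commute)
    also have "{x \<in> space ?N. x i \<in> B} = {x \<in> space ?N. x i \<in> A}"
      unfolding sN B(2) using \<Omega>_coord[of _ d i] i by auto
    finally show "{x \<in> space ?N. x i \<in> A} \<in> sets ?N" .
  qed
  then show "sets (cube d) \<subseteq> sigma_sets (\<Omega> d) (boxes d)" by (simp only: setsN)
  have "boxes d \<subseteq> sets (cube d)"
  proof
    fix X assume "X \<in> boxes d"
    then obtain a b where X: "X = (\<Pi>\<^sub>E m\<in>{..<d}. {a m<..<b m})" "\<forall>m. 0 \<le> a m \<and> b m \<le> 1"
      by (auto simp: boxes_def)
    have "{a m<..<b m} \<in> sets interval_measure01" for m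
      using X(2)[rule_format, of m] by (auto simp: sets_restrict_space_iff)
    then show "X \<in> sets (cube d)" unfolding X(1) cube_def by (intro sets_PiM_I_finite) auto
  qed
  then show "sigma_sets (\<Omega> d) (boxes d) \<subseteq> sets (cube d)"
    by (metis sets.sigma_sets_subset space_cube)
qed

text \<open>Products of plateau functions are test functions that converge boundedly to the indicator of
  the box.\<close>

lemma box_integral_zero:
  assumes g: "g \<in> L2 d" and z: "\<And>\<phi>. \<phi> \<in> test_functions d \<Longrightarrow> (\<integral>x. g x * \<phi> x \<partial>leb d) = 0"
    and X: "X \<in> boxes d"
  shows "(\<integral>x. g x * indicator X x \<partial>leb d) = 0"
proof -
  obtain a b where X: "X = (\<Pi>\<^sub>E m\<in>{..<d}. {a m<..<b m})" and ab: "\<And>m. 0 \<le> a m \<and> b m \<le> 1"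
    using X by (auto simp: boxes_def)
  define cut where "cut n = tensor d (\<lambda>m. plateau (a m) (b m) (Suc n))" for n
  have test: "cut n \<in> test_functions d" for n
    unfolding cut_def
  proof (rule tensor_test_function[where a = "1 / real (Suc n)" and b = "1 - 1 / real (Suc n)"])
    fix m t assume "t \<notin> {1 / real (Suc n)..1 - 1 / real (Suc n)}"
    then have "t \<notin> {a m + 1 / real (Suc n)..b m - 1 / real (Suc n)}" using ab[of m] by auto
    then show "plateau (a m) (b m) (Suc n) t = 0" by (rule plateau_eq_0)
  qed (auto intro: plateau_smooth1)
  have bound: "\<bar>cut n x\<bar> \<le> 1" for n x
    unfolding cut_def tensor_def abs_prod using plateau_bounds by (intro prod_le_1) auto
  have lim: "(\<lambda>n. cut n x) \<longlonglongrightarrow> indicator X x" if x: "x \<in> \<Omega> d" for x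
  proof -
    have "(\<lambda>n. \<Prod>m<d. plateau (a m) (b m) (Suc n) (x m)) \<longlonglongrightarrow> (\<Prod>m<d. indicator {a m<..<b m} (x m))"
      by (intro tendsto_prod LIMSEQ_Suc[OF plateau_tendsto])
    also have "(\<Prod>m<d. indicator {a m<..<b m} (x m)) = (indicator X x :: real)"
    proof (cases "x \<in> X")
      case True
      then have "\<And>m. m < d \<Longrightarrow> x m \<in> {a m<..<b m}" unfolding X by (auto simp: PiE_iff)
      then show ?thesis using True by simp
    next
      case False
      then obtain m where "m < d" "x m \<notin> {a m<..<b m}"
        using x unfolding X \<Omega>_def by (auto simp: PiE_iff)
      then have "(\<Prod>m<d. indicator {a m<..<b m} (x m)) = (0::real)"
        by (intro prod_zero bexI[of _ m]) auto
      then show ?thesis using False by simp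
    qed
    finally show ?thesis by (simp add: cut_def tensor_def)
  qed
  have X_meas: "X \<in> sets (leb d)"
    using assms(3) sets_cube by (auto simp: leb_eq intro!: sets_completionI_sets sigma_sets.Basic)
  have "(\<lambda>n. \<integral>x. g x * cut n x \<partial>leb d) \<longlonglongrightarrow> (\<integral>x. g x * indicator X x \<partial>leb d)"
  proof (rule integral_dominated_convergence[where w = "\<lambda>x. \<bar>g x\<bar>"])
    show "(\<lambda>x. g x * indicator X x) \<in> borel_measurable (leb d)"
      using L2_measurable[OF g] X_meas by simp
    show "(\<lambda>x. g x * cut n x) \<in> borel_measurable (leb d)" for n
    proof (rule borel_measurable_times[OF L2_measurable[OF g]])
      show "cut n \<in> borel_measurable (leb d)" unfolding cut_def
        by (intro continuous_measurable continuous_on_tensor smooth1_continuous plateau_smooth1)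
    qed
    show "integrable (leb d) (\<lambda>x. \<bar>g x\<bar>)" using L2_integrable[OF g] by simp
    show "AE x in leb d. (\<lambda>n. g x * cut n x) \<longlonglongrightarrow> g x * indicator X x"
      using lim by (intro AE_I2 tendsto_mult tendsto_const) auto
    show "AE x in leb d. norm (g x * cut n x) \<le> \<bar>g x\<bar>" for n
      using bound[of n] by (intro AE_I2) (auto simp: abs_mult intro: mult_left_le)
  qed
  then show ?thesis using z[OF test] by (simp add: LIMSEQ_const_iff)
qed

text \<open>The two measures whose densities are the positive and the negative part of \<open>g\<close> agree on
  boxes, hence on all measurable sets.\<close>

lemma fundamental_lemma:
  assumes g: "g \<in> L2 d" and z: "\<And>\<phi>. \<phi> \<in> test_functions d \<Longrightarrow> (\<integral>x. g x * \<phi> x \<partial>leb d) = 0"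
  shows "AE x in leb d. g x = 0"
proof -
  have gm: "g \<in> borel_measurable (completion (cube d))"
    using L2_measurable[OF g] by (simp add: leb_eq)
  obtain h where hm: "h \<in> borel_measurable (cube d)" and ae: "AE x in cube d. g x = h x"
    using completion_ex_borel_measurable_real[OF gm] by blast
  have ae': "AE x in leb d. g x = h x" unfolding leb_eq by (rule AE_completion[OF ae])
  have hm': "h \<in> borel_measurable (leb d)" unfolding leb_eq by (rule measurable_completion[OF hm])
  have "integrable (leb d) h"
    using integrable_cong_AE[THEN iffD1, OF L2_measurable[OF g] hm' ae' L2_integrable[OF g]] .
  then have hi: "integrable (cube d) h" unfolding leb_eq by (simp add: integrable_completion[OF hm])
  have X0: "(\<integral>x. h x * indicator X x \<partial>cube d) = 0" if X: "X \<in> boxes d" for X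
  proof -
    have Xs: "X \<in> sets (cube d)" using X sets_cube by (auto intro: sigma_sets.Basic)
    have Xl: "X \<in> sets (leb d)" unfolding leb_eq by (rule sets_completionI_sets[OF Xs])
    have "(\<integral>x. h x * indicator X x \<partial>cube d) = (\<integral>x. h x * indicator X x \<partial>leb d)"
      unfolding leb_eq by (rule integral_completion[symmetric]) (use hm Xs in simp)
    also have "\<dots> = (\<integral>x. g x * indicator X x \<partial>leb d)"
      by (rule integral_cong_AE)
        (use hm' L2_measurable[OF g] Xl ae' in auto)
    also have "\<dots> = 0" by (rule box_integral_zero[OF g z X])
    finally show ?thesis .
  qed
  let ?P = "density (cube d) (\<lambda>x. ennreal (h x))" and ?Q = "density (cube d) (\<lambda>x. ennreal (- h x))"
  have em: "emeasure ?P X = (\<integral>\<^sup>+x. ennreal (h x * indicator X x) \<partial>cube d)"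
    "emeasure ?Q X = (\<integral>\<^sup>+x. ennreal (- (h x * indicator X x)) \<partial>cube d)" if "X \<in> sets (cube d)" for X
    using that hm by (auto simp: emeasure_density indicator_def intro!: nn_integral_cong)
  have fin: "(\<integral>\<^sup>+x. ennreal (h x * indicator X x) \<partial>cube d) < \<infinity> \<and>
      (\<integral>\<^sup>+x. ennreal (- (h x * indicator X x)) \<partial>cube d) < \<infinity>" if "X \<in> sets (cube d)" for X
    using integrable_real_mult_indicator[OF that hi] by (auto simp: real_integrable_def top.not_eq_extremum)
  have "?P = ?Q"
  proof (rule measure_eqI_generator_eq[OF boxes_Int_stable boxes_subset, where A = "\<lambda>_. \<Omega> d"])
    show "sets ?P = sigma_sets (\<Omega> d) (boxes d)" "sets ?Q = sigma_sets (\<Omega> d) (boxes d)"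
      by (simp_all add: sets_cube)
    show "range (\<lambda>_. \<Omega> d) \<subseteq> boxes d" "(\<Union>i. \<Omega> d) = \<Omega> d" using \<Omega>_in_boxes by auto
    show "emeasure ?P (\<Omega> d) \<noteq> \<infinity>"
      using em(1)[of "\<Omega> d"] fin[of "\<Omega> d"] sets.top[of "cube d"] by (simp add: less_top)
    fix X assume X: "X \<in> boxes d"
    have Xs: "X \<in> sets (cube d)" using X sets_cube by (auto intro: sigma_sets.Basic)
    let ?p = "\<integral>\<^sup>+x. ennreal (h x * indicator X x) \<partial>cube d" and ?q = "\<integral>\<^sup>+x. ennreal (- (h x * indicator X x)) \<partial>cube d"
    have "enn2real ?p = enn2real ?q"
      using X0[OF X] real_lebesgue_integral_def[OF integrable_real_mult_indicator[OF Xs hi]] by simp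
    then have "ennreal (enn2real ?p) = ennreal (enn2real ?q)" by (rule arg_cong)
    moreover have "ennreal (enn2real ?p) = ?p" "ennreal (enn2real ?q) = ?q"
      using fin[OF Xs] by (auto intro: ennreal_enn2real)
    ultimately have "?p = ?q" by argo
    then show "emeasure ?P X = emeasure ?Q X" using em[OF Xs] by simp
  qed
  then have "AE x in cube d. ennreal (h x) = ennreal (- h x)"
    using hm by (intro cube.density_unique) auto
  then have "AE x in cube d. h x = 0"
  proof eventually_elim
    case (elim x)
    then show ?case
      by (cases "0 \<le> h x") (auto simp: ennreal_neg ennreal_eq_0_iff)
  qed
  then have "AE x in leb d. h x = 0" unfolding leb_eq by (rule AE_completion)
  with ae' show ?thesis by eventually_elim simp
qed

lemma weak_deriv_unique:
  assumes "is_weak_deriv d i u g" "is_weak_deriv d i u h"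
  shows "AE x in leb d. g x = h x"
proof -
  have L: "g \<in> L2 d" "h \<in> L2 d" using assms by (auto simp: is_weak_deriv_def)
  have gh: "(\<lambda>x. g x + (-1) * h x) \<in> L2 d" using L2_add[OF L(1) L2_scale[OF L(2)]] .
  have "AE x in leb d. g x + (-1) * h x = 0"
  proof (rule fundamental_lemma[OF gh])
    fix \<phi> assume \<phi>: "\<phi> \<in> test_functions d"
    have \<phi>2: "\<phi> \<in> L2 d"
    proof (cases "d = 0")
      case True
      have "\<phi> x = \<phi> (\<lambda>_. undefined)" if "x \<in> \<Omega> d" for x using that True by (auto simp: \<Omega>_def)
      moreover have "continuous_on (\<Omega> d) \<phi>"
        using \<phi> by (auto simp: test_functions_def smooth_def dest: spec[of _ "[]"])
      ultimately show ?thesis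
        by (intro L2_bounded[where B = "\<bar>\<phi> (\<lambda>_. undefined)\<bar>"] continuous_measurable) auto
    next
      case False
      then show ?thesis using C1_pair_L2(1)[OF test_function_C1[OF \<phi>, of 0]] by simp
    qed
    have "(\<integral>x. g x * \<phi> x \<partial>leb d) = (\<integral>x. h x * \<phi> x \<partial>leb d)"
      using assms \<phi> by (auto simp: is_weak_deriv_def)
    then show "(\<integral>x. (g x + (-1) * h x) * \<phi> x \<partial>leb d) = 0"
      using L2_mult_integrable[OF L(1) \<phi>2] L2_mult_integrable[OF L(2) \<phi>2]
      by (simp add: left_diff_distrib)
  qed
  then show ?thesis by eventually_elim simp
qed

lemma wderiv_AE: "is_weak_deriv d i u g \<Longrightarrow> AE x in leb d. wderiv d i u x = g x"
  unfolding wderiv_def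
  by (rule weak_deriv_unique[OF someI[of "is_weak_deriv d i u"]])

lemma wderiv_weak: "u \<in> H1 d \<Longrightarrow> i < d \<Longrightarrow> is_weak_deriv d i u (wderiv d i u)"
  unfolding wderiv_def H1_def by (auto intro: someI_ex[of "is_weak_deriv d i u"])

lemma wderiv_L2: "u \<in> H1 d \<Longrightarrow> i < d \<Longrightarrow> wderiv d i u \<in> L2 d"
  using wderiv_weak by (auto simp: is_weak_deriv_def)

lemma H1_L2: "u \<in> H1 d \<Longrightarrow> u \<in> L2 d"
  by (simp add: H1_def)

lemma weak_deriv_lincomb:
  assumes "is_weak_deriv d i u g" "is_weak_deriv d i v h" "u \<in> L2 d" "v \<in> L2 d" "i < d"
  shows "is_weak_deriv d i (\<lambda>x. u x + c * v x) (\<lambda>x. g x + c * h x)"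
  unfolding is_weak_deriv_def
proof (intro conjI ballI)
  have L: "g \<in> L2 d" "h \<in> L2 d" using assms by (auto simp: is_weak_deriv_def)
  show "(\<lambda>x. g x + c * h x) \<in> L2 d" using L2_add[OF L(1) L2_scale[OF L(2)]] .
  fix \<phi> assume \<phi>: "\<phi> \<in> test_functions d"
  note p = C1_pair_L2[OF test_function_C1[OF \<phi> \<open>i < d\<close>]]
  note [simp] = L2_mult_integrable[OF L(1) p(1)] L2_mult_integrable[OF L(2) p(1)]
    L2_mult_integrable[OF assms(3) p(2)] L2_mult_integrable[OF assms(4) p(2)]
  have e: "(\<integral>x. u x * partial_deriv i \<phi> x \<partial>leb d) = - (\<integral>x. g x * \<phi> x \<partial>leb d)"
    "(\<integral>x. v x * partial_deriv i \<phi> x \<partial>leb d) = - (\<integral>x. h x * \<phi> x \<partial>leb d)"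
    using assms \<phi> by (auto simp: is_weak_deriv_def)
  show "(\<integral>x. (u x + c * v x) * partial_deriv i \<phi> x \<partial>leb d) = - (\<integral>x. (g x + c * h x) * \<phi> x \<partial>leb d)"
    by (simp add: distrib_right mult.assoc e)
qed

lemma H1_lincomb: 
  assumes "u \<in> H1 d" "v \<in> H1 d"
  shows "(\<lambda>x. u x + c * v x) \<in> H1 d"
proof -
  have "\<exists>g. is_weak_deriv d i (\<lambda>x. u x + c * v x) g" if "i < d" for i
    using weak_deriv_lincomb[OF wderiv_weak[OF assms(1) that] wderiv_weak[OF assms(2) that]
        H1_L2[OF assms(1)] H1_L2[OF assms(2)] that] by blast
  then show ?thesis
    using L2_add[OF H1_L2[OF assms(1)] L2_scale[OF H1_L2[OF assms(2)]]] by (simp add: H1_def)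
qed

lemma wderiv_lincomb:
  assumes "u \<in> H1 d" "v \<in> H1 d" "i < d"
  shows "AE x in leb d. wderiv d i (\<lambda>x. u x + c * v x) x = wderiv d i u x + c * wderiv d i v x"
  using weak_deriv_lincomb[OF wderiv_weak[OF assms(1,3)] wderiv_weak[OF assms(2,3)]
        H1_L2[OF assms(1)] H1_L2[OF assms(2)] assms(3)] by (rule wderiv_AE)

section \<open>The inner products of the Sobolev spaces\<close>

text \<open>Semi-inner products on a set of functions. Functions that vanish almost everywhere have norm \<open>0\<close>,
  so definiteness fails. The instances are \<open>L\<^sup>2\<close>, \<open>H\<^sup>1\<close> and the spaces of the two boundary
  conditions.\<close>

locale semi_inner =
  fixes V :: "('x \<Rightarrow> real) set" and ip :: "('x \<Rightarrow> real) \<Rightarrow> ('x \<Rightarrow> real) \<Rightarrow> real"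
  assumes lincomb: "u \<in> V \<Longrightarrow> v \<in> V \<Longrightarrow> (\<lambda>x. u x + c * v x) \<in> V"
    and sym: "u \<in> V \<Longrightarrow> v \<in> V \<Longrightarrow> ip u v = ip v u"
    and left: "u \<in> V \<Longrightarrow> v \<in> V \<Longrightarrow> w \<in> V \<Longrightarrow> ip (\<lambda>x. u x + c * v x) w = ip u w + c * ip v w"
    and nonneg: "u \<in> V \<Longrightarrow> 0 \<le> ip u u"
begin

definition nrm :: "('x \<Rightarrow> real) \<Rightarrow> real" where
  "nrm u = sqrt (ip u u)"

lemma nrm_nonneg: "u \<in> V \<Longrightarrow> 0 \<le> nrm u"
  by (simp add: nrm_def nonneg)

lemma nrm_sq: "u \<in> V \<Longrightarrow> (nrm u)\<^sup>2 = ip u u"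
  by (simp add: nrm_def nonneg)

lemma right:
  assumes "u \<in> V" "v \<in> V" "w \<in> V"
  shows "ip w (\<lambda>x. u x + c * v x) = ip w u + c * ip w v"
  by (simp only: sym[OF assms(3) lincomb[OF assms(1,2)]] left[OF assms] sym[OF assms(3,1)] sym[OF assms(3,2)])

lemma square_lincomb:
  assumes "u \<in> V" "v \<in> V"
  shows "ip (\<lambda>x. u x + c * v x) (\<lambda>x. u x + c * v x) = ip u u + 2 * c * ip u v + c\<^sup>2 * ip v v"
  by (simp only: left[OF assms lincomb[OF assms]] right[OF assms assms(1)] right[OF assms assms(2)]
      sym[OF assms(2,1)]) (simp add: algebra_simps power2_eq_square)

lemma cauchy_schwarz:
  assumes "u \<in> V" "v \<in> V"
  shows "\<bar>ip u v\<bar> \<le> nrm u * nrm v"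
proof -
  \<comment> \<open>The polynomial \<open>a + 2 t b + t\<^sup>2 e\<close> is nonnegative, so its discriminant is not positive.\<close>
  define a b e where "a = ip u u" and "b = ip u v" and "e = ip v v"
  have q: "0 \<le> a + 2 * t * b + t\<^sup>2 * e" for t
    using nonneg[OF lincomb[OF assms, of t]] unfolding square_lincomb[OF assms] a_def b_def e_def .
  have ae: "0 \<le> a" "0 \<le> e" using nonneg assms by (auto simp: a_def e_def)
  have "b\<^sup>2 \<le> a * e"
  proof (cases "e = 0")
    case True
    have "b = 0"
    proof (rule ccontr)
      assume "b \<noteq> 0"
      then have "a + 2 * (- (a + 1) / (2 * b)) * b = - 1" by (simp add: field_simps)
      with q[of "- (a + 1) / (2 * b)"] True show False by simp
    qed
    then show ?thesis using True by simp
  next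
    case False
    then have "a + 2 * (- b / e) * b + (- b / e)\<^sup>2 * e = a - b\<^sup>2 / e"
      by (simp add: field_simps power2_eq_square)
    with q[of "- b / e"] have "b\<^sup>2 / e \<le> a" by simp
    then show ?thesis using False ae by (simp add: divide_le_eq split: if_splits)
  qed
  then have "sqrt (b\<^sup>2) \<le> sqrt (a * e)" by (rule real_sqrt_le_mono)
  then show ?thesis by (simp add: nrm_def real_sqrt_mult a_def b_def e_def)
qed

lemma triangle:
  assumes "u \<in> V" "v \<in> V"
  shows "nrm (\<lambda>x. u x + c * v x) \<le> nrm u + \<bar>c\<bar> * nrm v"
proof (rule power2_le_imp_le)
  have "2 * c * ip u v \<le> 2 * \<bar>c\<bar> * \<bar>ip u v\<bar>"
    by (metis abs_ge_self abs_mult abs_numeral)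
  also have "\<dots> \<le> 2 * \<bar>c\<bar> * (nrm u * nrm v)"
    using cauchy_schwarz[OF assms] by (intro mult_left_mono) auto
  finally have "ip u u + 2 * c * ip u v + c\<^sup>2 * ip v v \<le> (nrm u)\<^sup>2 + 2 * \<bar>c\<bar> * (nrm u * nrm v) + c\<^sup>2 * (nrm v)\<^sup>2"
    by (simp add: nrm_sq assms)
  also have "\<dots> = (nrm u + \<bar>c\<bar> * nrm v)\<^sup>2"
    by (simp add: power2_sum power_mult_distrib algebra_simps)
  finally show "(nrm (\<lambda>x. u x + c * v x))\<^sup>2 \<le> (nrm u + \<bar>c\<bar> * nrm v)\<^sup>2"
    by (simp only: nrm_sq[OF lincomb[OF assms]] square_lincomb[OF assms])
qed (use assms nrm_nonneg in simp)

end

definition l2_inner :: "nat \<Rightarrow> ((nat \<Rightarrow> real) \<Rightarrow> real) \<Rightarrow> ((nat \<Rightarrow> real) \<Rightarrow> real) \<Rightarrow> real" where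
  "l2_inner d u v = (\<integral>x. u x * v x \<partial>leb d)"

lemma l2_left:
  assumes "u \<in> L2 d" "v \<in> L2 d" "w \<in> L2 d"
  shows "l2_inner d (\<lambda>x. u x + c * v x) w = l2_inner d u w + c * l2_inner d v w"
  using L2_mult_integrable[OF assms(1,3)] L2_mult_integrable[OF assms(2,3)]
  by (simp add: l2_inner_def distrib_right mult.assoc)

lemma l2_sym: "l2_inner d u v = l2_inner d v u"
  by (simp add: l2_inner_def mult.commute)

lemma l2_nonneg: "0 \<le> l2_inner d u u"
  by (simp add: l2_inner_def)

interpretation l2: semi_inner "L2 d" "l2_inner d"
  by standard (auto intro: L2_add L2_scale l2_left l2_sym l2_nonneg)

lemma l2_cong_AE:
  assumes "u \<in> L2 d" "u' \<in> L2 d" "v \<in> L2 d" "v' \<in> L2 d"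
    and "AE x in leb d. u x = u' x" "AE x in leb d. v x = v' x"
  shows "l2_inner d u v = l2_inner d u' v'"
  unfolding l2_inner_def
proof (rule integral_cong_AE)
  show "(\<lambda>x. u x * v x) \<in> borel_measurable (leb d)" "(\<lambda>x. u' x * v' x) \<in> borel_measurable (leb d)"
    using assms(1-4)[THEN L2_measurable] by (auto intro: borel_measurable_times)
  show "AE x in leb d. u x * v x = u' x * v' x"
    using assms(5,6) by eventually_elim simp
qed

lemma H1_inner_eq:
  assumes "u \<in> H1 d" "v \<in> H1 d"
  shows "H1_inner d u v = (\<Sum>i<d. l2_inner d (wderiv d i u) (wderiv d i v)) + l2_inner d u v"
proof -
  have [simp]: "integrable (leb d) (\<lambda>x. wderiv d i u x * wderiv d i v x)" if "i < d" for i
    using that by (intro L2_mult_integrable wderiv_L2 assms)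
  have [simp]: "integrable (leb d) (\<lambda>x. u x * v x)"
    by (intro L2_mult_integrable H1_L2 assms)
  have "H1_inner d u v = (\<integral>x. (\<Sum>i<d. wderiv d i u x * wderiv d i v x) \<partial>leb d) + (\<integral>x. u x * v x \<partial>leb d)"
    unfolding H1_inner_def by (rule Bochner_Integration.integral_add) auto
  also have "(\<integral>x. (\<Sum>i<d. wderiv d i u x * wderiv d i v x) \<partial>leb d)
      = (\<Sum>i<d. \<integral>x. wderiv d i u x * wderiv d i v x \<partial>leb d)"
    by (rule Bochner_Integration.integral_sum) auto
  finally show ?thesis by (simp add: l2_inner_def)
qed

lemma H1_left:
  assumes "u \<in> H1 d" "v \<in> H1 d" "w \<in> H1 d"
  shows "H1_inner d (\<lambda>x. u x + c * v x) w = H1_inner d u w + c * H1_inner d v w"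
proof -
  have "l2_inner d (wderiv d i (\<lambda>x. u x + c * v x)) (wderiv d i w)
      = l2_inner d (wderiv d i u) (wderiv d i w) + c * l2_inner d (wderiv d i v) (wderiv d i w)"
    if "i < d" for i
  proof -
    have "l2_inner d (wderiv d i (\<lambda>x. u x + c * v x)) (wderiv d i w)
        = l2_inner d (\<lambda>x. wderiv d i u x + c * wderiv d i v x) (wderiv d i w)"
      using that assms
      by (intro l2_cong_AE wderiv_lincomb) (auto intro!: wderiv_L2 H1_lincomb l2.lincomb)
    then show ?thesis using l2_left wderiv_L2 that assms by simp
  qed
  then show ?thesis
    using assms H1_lincomb
    by (simp add: H1_inner_eq l2_left H1_L2 sum.distrib algebra_simps flip: sum_distrib_left)
qed

lemma H1_sym: "H1_inner d u v = H1_inner d v u"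
  by (simp add: H1_inner_def mult.commute)

lemma H1_nonneg: "0 \<le> H1_inner d u u"
  unfolding H1_inner_def by (intro Bochner_Integration.integral_nonneg add_nonneg_nonneg sum_nonneg) auto

interpretation H1: semi_inner "H1 d" "H1_inner d"
  by standard (auto intro: H1_lincomb H1_left H1_sym H1_nonneg)

lemma H1_nrm: "H1.nrm d u = H1_norm d u"
  by (simp add: H1.nrm_def H1_norm_def)

lemma wderiv_norm_le:
  assumes "u \<in> H1 d" "i < d" shows "l2.nrm d (wderiv d i u) \<le> H1_norm d u"
proof -
  have "l2_inner d (wderiv d i u) (wderiv d i u) \<le> (\<Sum>i<d. l2_inner d (wderiv d i u) (wderiv d i u))"
    using assms(2) l2_nonneg by (intro member_le_sum) auto
  also have "\<dots> \<le> H1_inner d u u" using l2_nonneg[of d u] by (simp add: H1_inner_eq assms(1))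
  finally show ?thesis by (simp add: l2.nrm_def H1_norm_def)
qed

lemma l2_norm_le_H1: "u \<in> H1 d \<Longrightarrow> l2.nrm d u \<le> H1_norm d u"
  by (simp add: l2.nrm_def H1_norm_def H1_inner_eq sum_nonneg l2_nonneg)

lemma l2_nrm_bounded:
  assumes "u \<in> L2 d" "\<And>x. x \<in> \<Omega> d \<Longrightarrow> \<bar>u x\<bar> \<le> B"
  shows "l2.nrm d u \<le> \<bar>B\<bar>"
proof -
  have "(\<integral>x. u x * u x \<partial>leb d) \<le> (\<integral>x. B\<^sup>2 \<partial>leb d)"
  proof (rule integral_mono)
    show "integrable (leb d) (\<lambda>x. u x * u x)" by (rule L2_mult_integrable[OF assms(1,1)])
    fix x assume "x \<in> space (leb d)"
    then show "u x * u x \<le> B\<^sup>2"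
      using power_mono[OF assms(2)[of x] abs_ge_zero, of 2] by (simp add: power2_eq_square)
  qed simp
  also have "\<dots> = B\<^sup>2" by (simp add: measure_leb)
  finally have "l2_inner d u u \<le> B\<^sup>2" by (simp add: l2_inner_def)
  then have "sqrt (l2_inner d u u) \<le> sqrt (B\<^sup>2)" by (rule real_sqrt_le_mono)
  also have "\<dots> = \<bar>B\<bar>" by (rule real_sqrt_abs)
  finally show ?thesis unfolding l2.nrm_def .
qed

lemma C1_H1:
  assumes "0 < d" "\<And>i. i < d \<Longrightarrow> C1_pair d i \<psi> (\<psi>' i)"
  shows "\<psi> \<in> H1 d" and "\<And>i. i < d \<Longrightarrow> AE x in leb d. wderiv d i \<psi> x = \<psi>' i x"
proof -
  show "\<psi> \<in> H1 d"
    using C1_pair_L2(1)[OF assms(2)[OF assms(1)]] C1_weak_deriv[OF assms(2)] by (auto simp: H1_def)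
  show "AE x in leb d. wderiv d i \<psi> x = \<psi>' i x" if "i < d" for i
    by (rule wderiv_AE[OF C1_weak_deriv[OF assms(2)[OF that] that]])
qed

lemma C1_H1_inner:
  assumes "0 < d" "\<And>i. i < d \<Longrightarrow> C1_pair d i \<psi> (\<psi>' i)"
    and v: "v \<in> H1 d" 
  shows "H1_inner d \<psi> v = (\<Sum>i<d. l2_inner d (\<psi>' i) (wderiv d i v)) + l2_inner d \<psi> v"
proof -
  note 1 = C1_H1[where \<psi>' = \<psi>', OF assms(1,2)]
  have "l2_inner d (wderiv d i \<psi>) (wderiv d i v) = l2_inner d (\<psi>' i) (wderiv d i v)" if "i < d" for i
    using that C1_pair_L2[OF assms(2)[OF that]] v 1 by (intro l2_cong_AE) (auto intro: wderiv_L2)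
  then show ?thesis by (simp add: H1_inner_eq 1 v)
qed

lemma C1_H1_inner_self:
  assumes "0 < d" "\<And>i. i < d \<Longrightarrow> C1_pair d i \<psi> (\<psi>' i)"
  shows "H1_inner d \<psi> \<psi> = (\<Sum>i<d. l2_inner d (\<psi>' i) (\<psi>' i)) + l2_inner d \<psi> \<psi>"
proof -
  note 1 = C1_H1[where \<psi>' = \<psi>', OF assms]
  have "l2_inner d (\<psi>' i) (wderiv d i \<psi>) = l2_inner d (\<psi>' i) (\<psi>' i)" if "i < d" for i
    using that C1_pair_L2[OF assms(2)[OF that]] 1 by (intro l2_cong_AE) (auto intro: wderiv_L2)
  then show ?thesis by (simp add: C1_H1_inner[where \<psi>' = \<psi>', OF assms 1(1)])
qed

lemma C1_pair_lincomb:
  assumes "C1_pair d i \<psi> \<psi>'" "C1_pair d i \<phi> \<phi>'"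
  shows "C1_pair d i (\<lambda>x. \<psi> x + c * \<phi> x) (\<lambda>x. \<psi>' x + c * \<phi>' x)"
proof -
  note P = assms(1)[unfolded C1_pair_def] and Q = assms(2)[unfolded C1_pair_def]
  obtain B B' where B: "\<forall>x\<in>\<Omega> d. \<bar>\<psi> x\<bar> \<le> B \<and> \<bar>\<psi>' x\<bar> \<le> B" "\<forall>x\<in>\<Omega> d. \<bar>\<phi> x\<bar> \<le> B' \<and> \<bar>\<phi>' x\<bar> \<le> B'"
    using P Q by blast
  have t: "\<bar>a + c * b\<bar> \<le> B + \<bar>c\<bar> * B'" if "\<bar>a\<bar> \<le> B" "\<bar>b\<bar> \<le> B'" for a b
  proof -
    have "\<bar>c * b\<bar> \<le> \<bar>c\<bar> * B'" unfolding abs_mult using that(2) by (intro mult_left_mono) auto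
    then show ?thesis using that(1) by linarith
  qed
  show ?thesis
    unfolding C1_pair_def
  proof (intro conjI ballI)
    show "continuous_on (\<Omega> d) (\<lambda>x. \<psi> x + c * \<phi> x)" "continuous_on (\<Omega> d) (\<lambda>x. \<psi>' x + c * \<phi>' x)"
      using P Q by (auto intro!: continuous_intros)
    show "\<exists>B. \<forall>x\<in>\<Omega> d. \<bar>\<psi> x + c * \<phi> x\<bar> \<le> B \<and> \<bar>\<psi>' x + c * \<phi>' x\<bar> \<le> B"
      using B t by (intro exI[of _ "B + \<bar>c\<bar> * B'"]) auto
    fix x assume "x \<in> \<Omega> d"
    then show "((\<lambda>t. \<psi> (x(i := t)) + c * \<phi> (x(i := t))) has_real_derivative \<psi>' x + c * \<phi>' x) (at (x i))"
      using P Q by (intro DERIV_add DERIV_cmult) auto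
  qed
qed

lemma test_function_H1: "0 < d \<Longrightarrow> \<phi> \<in> test_functions d \<Longrightarrow> \<phi> \<in> H1 d"
  using C1_H1(1)[where \<psi> = \<phi> and \<psi>' = "\<lambda>i. partial_deriv i \<phi>"] test_function_C1 by blast

text \<open>The derivative of a sum is the sum of the derivatives only where both exist, which is inside
  \<open>\<Omega> d\<close>; near \<open>x\<close> a line through \<open>x\<close> stays inside.\<close>

lemma foldr_partial_deriv_lincomb:
  assumes "smooth d \<phi>" "smooth d \<psi>" "set is \<subseteq> {..<d}" "x \<in> \<Omega> d"
  shows "foldr partial_deriv is (\<lambda>x. \<phi> x + c * \<psi> x) x
    = foldr partial_deriv is \<phi> x + c * foldr partial_deriv is \<psi> x"
  using assms(3,4)
proof (induction "is" arbitrary: x)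
  case (Cons i "is")
  let ?F = "foldr partial_deriv is"
  have i: "i < d" "set is \<subseteq> {..<d}" using Cons.prems by auto
  have xi: "x i \<in> {0<..<1}" using \<Omega>_coord[OF Cons.prems(2) i(1)] by simp
  have "((\<lambda>t. ?F \<phi> (x(i := t)) + c * ?F \<psi> (x(i := t))) has_real_derivative
      partial_deriv i (?F \<phi>) x + c * partial_deriv i (?F \<psi>) x) (at (x i))"
    unfolding partial_deriv_def[of i "?F \<phi>" x] partial_deriv_def[of i "?F \<psi>" x]
    using assms(1,2)[unfolded smooth_def, rule_format, OF i(2)] i(1) Cons.prems(2)
    by (intro DERIV_add DERIV_cmult field_differentiable_derivI) auto
  moreover have "\<forall>\<^sub>F t in nhds (x i). ?F (\<lambda>x. \<phi> x + c * \<psi> x) (x(i := t)) = ?F \<phi> (x(i := t)) + c * ?F \<psi> (x(i := t))"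
    using eventually_nhds_in_open[OF open_greaterThanLessThan xi]
    by (rule eventually_mono) (use Cons.prems(2) i in \<open>auto intro!: Cons.IH \<Omega>_upd\<close>)
  ultimately have "((\<lambda>t. ?F (\<lambda>x. \<phi> x + c * \<psi> x) (x(i := t))) has_real_derivative
      partial_deriv i (?F \<phi>) x + c * partial_deriv i (?F \<psi>) x) (at (x i))"
    by (subst DERIV_cong_ev[OF refl _ refl])
  then have "partial_deriv i (?F (\<lambda>x. \<phi> x + c * \<psi> x)) x
      = partial_deriv i (?F \<phi>) x + c * partial_deriv i (?F \<psi>) x"
    unfolding partial_deriv_def[of i "?F (\<lambda>x. \<phi> x + c * \<psi> x)" x] by (rule DERIV_imp_deriv)
  then show ?case by simp
qed simp

lemma smooth_lincomb:
  assumes "smooth d \<phi>" "smooth d \<psi>"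
  shows "smooth d (\<lambda>x. \<phi> x + c * \<psi> x)"
  unfolding smooth_def
proof (intro allI impI conjI ballI)
  fix "is" :: "nat list" assume s: "set is \<subseteq> {..<d}"
  let ?F = "foldr partial_deriv is"
  note P = assms(1)[unfolded smooth_def, rule_format, OF s] and Q = assms(2)[unfolded smooth_def, rule_format, OF s]
  have "continuous_on (\<Omega> d) (\<lambda>x. ?F \<phi> x + c * ?F \<psi> x)"
    using P Q by (intro continuous_intros) auto
  then show "continuous_on (\<Omega> d) (?F (\<lambda>x. \<phi> x + c * \<psi> x))"
    by (rule continuous_on_eq) (simp add: foldr_partial_deriv_lincomb[OF assms s])
  fix i x assume i: "i < d" and x: "x \<in> \<Omega> d"
  have xi: "x i \<in> {0<..<1}" using \<Omega>_coord[OF x i] by simp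
  have "((\<lambda>t. ?F \<phi> (x(i := t)) + c * ?F \<psi> (x(i := t))) has_real_derivative
      deriv (\<lambda>t. ?F \<phi> (x(i := t))) (x i) + c * deriv (\<lambda>t. ?F \<psi> (x(i := t))) (x i)) (at (x i))"
    using P Q i x by (intro DERIV_add DERIV_cmult field_differentiable_derivI) auto
  moreover have "\<forall>\<^sub>F t in nhds (x i). ?F (\<lambda>x. \<phi> x + c * \<psi> x) (x(i := t)) = ?F \<phi> (x(i := t)) + c * ?F \<psi> (x(i := t))"
    using eventually_nhds_in_open[OF open_greaterThanLessThan xi]
    by (rule eventually_mono) (use x i in \<open>auto intro!: foldr_partial_deriv_lincomb[OF assms s] \<Omega>_upd\<close>)
  ultimately have "((\<lambda>t. ?F (\<lambda>x. \<phi> x + c * \<psi> x) (x(i := t))) has_real_derivative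
      deriv (\<lambda>t. ?F \<phi> (x(i := t))) (x i) + c * deriv (\<lambda>t. ?F \<psi> (x(i := t))) (x i)) (at (x i))"
    by (subst DERIV_cong_ev[OF refl _ refl])
  then show "(\<lambda>t. ?F (\<lambda>x. \<phi> x + c * \<psi> x) (x(i := t))) field_differentiable at (x i)"
    by (auto simp: field_differentiable_def)
qed

lemma test_function_lincomb:
  assumes "\<phi> \<in> test_functions d" "\<psi> \<in> test_functions d"
  shows "(\<lambda>x. \<phi> x + c * \<psi> x) \<in> test_functions d"
proof -
  obtain K L where "compact K" "K \<subseteq> \<Omega> d" "\<And>x. x \<in> \<Omega> d - K \<Longrightarrow> \<phi> x = 0"
    "compact L" "L \<subseteq> \<Omega> d" "\<And>x. x \<in> \<Omega> d - L \<Longrightarrow> \<psi> x = 0"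
    using assms by (auto simp: test_functions_def)
  then have "compact (K \<union> L)" "K \<union> L \<subseteq> \<Omega> d" "\<forall>x\<in>\<Omega> d - (K \<union> L). \<phi> x + c * \<psi> x = 0"
    by (auto intro: compact_Un)
  then show ?thesis using smooth_lincomb assms unfolding test_functions_def by blast
qed

lemma H10_H1: "u \<in> H10 d \<Longrightarrow> u \<in> H1 d"
  by (simp add: H10_def)

lemma H10_lincomb:
  assumes d: "0 < d" and u: "u \<in> H10 d" and v: "v \<in> H10 d"
  shows "(\<lambda>x. u x + c * v x) \<in> H10 d"
  unfolding H10_def
proof (intro CollectI conjI allI impI)
  note uv = u[THEN H10_H1] v[THEN H10_H1]
  show "(\<lambda>x. u x + c * v x) \<in> H1 d" by (rule H1_lincomb[OF uv])
  fix \<delta> :: real assume \<delta>: "\<delta> > 0"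
  then have "\<delta> / 2 > 0" "\<delta> / (2 * (\<bar>c\<bar> + 1)) > 0" by (auto intro!: divide_pos_pos)
  then obtain \<phi> \<psi> where \<phi>: "\<phi> \<in> test_functions d" "H1_norm d (\<lambda>x. u x - \<phi> x) < \<delta> / 2"
    and \<psi>: "\<psi> \<in> test_functions d" "H1_norm d (\<lambda>x. v x - \<psi> x) < \<delta> / (2 * (\<bar>c\<bar> + 1))"
    using u v unfolding H10_def by blast
  have H: "(\<lambda>x. u x + (-1) * \<phi> x) \<in> H1 d" "(\<lambda>x. v x + (-1) * \<psi> x) \<in> H1 d"
    by (rule H1_lincomb[OF uv(1) test_function_H1[OF d \<phi>(1)]], rule H1_lincomb[OF uv(2) test_function_H1[OF d \<psi>(1)]])
  have "H1_norm d (\<lambda>x. (u x + (-1) * \<phi> x) + c * (v x + (-1) * \<psi> x))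
      \<le> H1_norm d (\<lambda>x. u x + (-1) * \<phi> x) + \<bar>c\<bar> * H1_norm d (\<lambda>x. v x + (-1) * \<psi> x)"
    using H1.triangle[OF H] by (simp add: H1_nrm)
  also have "\<dots> < \<delta> / 2 + \<bar>c\<bar> * (\<delta> / (2 * (\<bar>c\<bar> + 1))) + 0"
  proof -
    have "\<bar>c\<bar> * H1_norm d (\<lambda>x. v x + (-1) * \<psi> x) \<le> \<bar>c\<bar> * (\<delta> / (2 * (\<bar>c\<bar> + 1)))"
      using \<psi>(2) by (intro mult_left_mono) auto
    then show ?thesis using \<phi>(2) by simp
  qed
  also have "\<dots> \<le> \<delta>"
  proof -
    have "\<bar>c\<bar> * (\<delta> / (2 * (\<bar>c\<bar> + 1))) = (\<bar>c\<bar> / (\<bar>c\<bar> + 1)) * (\<delta> / 2)" by (simp add: field_simps)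
    also have "\<dots> \<le> 1 * (\<delta> / 2)" using \<delta> by (intro mult_right_mono) auto
    finally show ?thesis by linarith
  qed
  finally have "H1_norm d (\<lambda>x. (u x + c * v x) - (\<phi> x + c * \<psi> x)) < \<delta>"
    by (simp add: algebra_simps)
  then show "\<exists>\<phi>\<in>test_functions d. H1_norm d (\<lambda>x. u x + c * v x - \<phi> x) < \<delta>"
    using test_function_lincomb[OF \<phi>(1) \<psi>(1), of c] by (intro bexI)
qed

section \<open>Trigonometric products\<close>

text \<open>The set \<open>J\<close> says which factors are sines. Frequencies are integers, so that sums and differences
  of frequencies need no normalisation of signs.\<close>

definition tfac :: "nat set \<Rightarrow> (nat \<Rightarrow> int) \<Rightarrow> nat \<Rightarrow> real \<Rightarrow> real" where
  "tfac J k m = (if m \<in> J then (\<lambda>t. sin (pi * real_of_int (k m) * t)) else (\<lambda>t. cos (pi * real_of_int (k m) * t)))"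

definition trig :: "nat \<Rightarrow> nat set \<Rightarrow> (nat \<Rightarrow> int) \<Rightarrow> (nat \<Rightarrow> real) \<Rightarrow> real" where
  "trig d J k = tensor d (tfac J k)"

text \<open>The derivative in direction \<open>i\<close>: it exchanges sine and cosine in the factor \<open>i\<close>, which is the
  symmetric difference of \<open>J\<close> with \<open>{i}\<close>.\<close>

definition dtrig :: "nat \<Rightarrow> nat set \<Rightarrow> (nat \<Rightarrow> int) \<Rightarrow> nat \<Rightarrow> (nat \<Rightarrow> real) \<Rightarrow> real" where
  "dtrig d J k i x = (if i \<in> J then 1 else -1) * (pi * real_of_int (k i)) * trig d (sym_diff J {i}) k x"

definition tfac' :: "nat set \<Rightarrow> (nat \<Rightarrow> int) \<Rightarrow> nat \<Rightarrow> real \<Rightarrow> real" where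
  "tfac' J k m t = (if m \<in> J then 1 else -1) * (pi * real_of_int (k m)) * tfac (sym_diff J {m}) k m t"

lemma tfac_smooth1: "smooth1 (tfac J k m)"
  by (simp add: tfac_def smooth1_sin smooth1_cos)

lemma tfac_abs_le: "\<bar>tfac J k m t\<bar> \<le> 1"
  by (simp add: tfac_def)

lemma tfac_has_deriv: "(tfac J k m has_real_derivative tfac' J k m t) (at t)"
  by (cases "m \<in> J") (auto simp: tfac_def tfac'_def intro!: derivative_eq_intros)

lemma trig_abs_le: "\<bar>trig d J k x\<bar> \<le> 1"
  unfolding trig_def tensor_def abs_prod using tfac_abs_le by (intro prod_le_1) auto

lemma trig_upd_tfac': "i < d \<Longrightarrow> tensor d ((tfac J k)(i := tfac' J k i)) x = dtrig d J k i x"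
proof -
  assume i: "i < d"
  have "tfac (sym_diff J {i}) k m = tfac J k m" if "m \<noteq> i" for m
    using that by (simp add: tfac_def)
  then have "(\<Prod>m\<in>{..<d} - {i}. tfac (sym_diff J {i}) k m (x m)) = (\<Prod>m\<in>{..<d} - {i}. tfac J k m (x m))"
    by (intro prod.cong) auto
  then show ?thesis
    using i by (simp add: tensor_upd dtrig_def trig_def tensor_split[of i d "tfac (sym_diff J {i}) k"] tfac'_def)
qed

lemma trig_has_deriv: "i < d \<Longrightarrow> ((\<lambda>t. trig d J k (x(i := t))) has_real_derivative dtrig d J k i x) (at (x i))"
  using tensor_has_deriv[of i d "tfac J k" "tfac' J k i" x] tfac_has_deriv trig_upd_tfac'[of i d J k x]
  by (simp add: trig_def)

lemma trig_continuous: "continuous_on S (trig d J k)"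
  unfolding trig_def by (intro continuous_on_tensor smooth1_continuous tfac_smooth1)

lemma dtrig_continuous: "continuous_on S (dtrig d J k i)"
  unfolding dtrig_def[abs_def] by (intro continuous_intros trig_continuous)

lemma dtrig_abs_le: "\<bar>dtrig d J k i x\<bar> \<le> pi * \<bar>real_of_int (k i)\<bar>"
proof -
  have "\<bar>dtrig d J k i x\<bar> = (pi * \<bar>real_of_int (k i)\<bar>) * \<bar>trig d (sym_diff J {i}) k x\<bar>"
    by (simp add: dtrig_def abs_mult)
  also have "\<dots> \<le> (pi * \<bar>real_of_int (k i)\<bar>) * 1"
    by (intro mult_left_mono trig_abs_le) auto
  finally show ?thesis by simp
qed

lemma trig_C1: "i < d \<Longrightarrow> C1_pair d i (trig d J k) (dtrig d J k i)"
  unfolding C1_pair_def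
proof (intro conjI exI[of _ "1 + pi * \<bar>real_of_int (k i)\<bar>"] ballI)
  fix x show "\<bar>trig d J k x\<bar> \<le> 1 + pi * \<bar>real_of_int (k i)\<bar>"
    by (rule order_trans[OF trig_abs_le]) simp
  show "\<bar>dtrig d J k i x\<bar> \<le> 1 + pi * \<bar>real_of_int (k i)\<bar>"
    using dtrig_abs_le[of d J k i x] by linarith
qed (auto intro: trig_continuous dtrig_continuous trig_has_deriv)

lemma trig_L2: "trig d J k \<in> L2 d"
  by (rule L2_bounded[OF continuous_measurable[OF trig_continuous] trig_abs_le])

lemma dtrig_L2: "dtrig d J k i \<in> L2 d"
  by (rule L2_bounded[OF continuous_measurable[OF dtrig_continuous] dtrig_abs_le])

lemma trig_H1: "0 < d \<Longrightarrow> trig d J k \<in> H1 d"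
  by (rule C1_H1(1)[where \<psi>' = "dtrig d J k"]) (auto intro: trig_C1)

text \<open>Cut-off of a trigonometric product. Its partial derivative in a direction in which the
  product has a sine factor stays bounded.\<close>

definition trig_cut :: "nat \<Rightarrow> nat set \<Rightarrow> (nat \<Rightarrow> int) \<Rightarrow> nat \<Rightarrow> (nat \<Rightarrow> real) \<Rightarrow> real" where
  "trig_cut d J k n = tensor d (\<lambda>m t. tfac J k m t * plateau 0 1 (Suc n) t)"

lemma trig_cut_test: "trig_cut d J k n \<in> test_functions d"
  unfolding trig_cut_def
proof (rule tensor_test_function[where a = "1 / real (Suc n)" and b = "1 - 1 / real (Suc n)"])
  fix m t assume "t \<notin> {1 / real (Suc n)..1 - 1 / real (Suc n)}"
  then have "plateau 0 1 (Suc n) t = 0" by (intro plateau_eq_0) simp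
  then show "tfac J k m t * plateau 0 1 (Suc n) t = 0" by simp
qed (auto intro: smooth1_mult tfac_smooth1 plateau_smooth1)

lemma trig_cut_fac_le: "\<bar>tfac J k m t * plateau 0 1 n t\<bar> \<le> 1"
  unfolding abs_mult using plateau_bounds[of 0 1 n t] tfac_abs_le[of J k m t]
  by (intro mult_le_one) auto

lemma trig_cut_abs_le: "\<bar>trig_cut d J k n x\<bar> \<le> 1"
  unfolding trig_cut_def tensor_def abs_prod using trig_cut_fac_le by (intro prod_le_1) auto

lemma trig_cut_fac_tendsto:
  assumes "x \<in> \<Omega> d" "m < d"
  shows "(\<lambda>n. tfac J k m (x m) * plateau 0 1 (Suc n) (x m)) \<longlonglongrightarrow> tfac J k m (x m)"
proof -
  have "(\<lambda>n. tfac J k m (x m) * plateau 0 1 (Suc n) (x m)) \<longlonglongrightarrow> tfac J k m (x m) * indicator {0<..<1} (x m)"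
    by (intro tendsto_mult tendsto_const LIMSEQ_Suc[OF plateau_tendsto])
  then show ?thesis using \<Omega>_coord[OF assms] by simp
qed

lemma trig_cut_tendsto:
  assumes "x \<in> \<Omega> d"
  shows "(\<lambda>n. trig_cut d J k n x) \<longlonglongrightarrow> trig d J k x"
  unfolding trig_cut_def trig_def tensor_def
  by (intro tendsto_prod trig_cut_fac_tendsto[OF assms]) auto

text \<open>The sine vanishes at both endpoints; the second estimate is the first one reflected at \<open>1/2\<close>.\<close>

lemma abs_sin_integer_pi:
  assumes "0 < t" "t < 1"
  shows "\<bar>sin (pi * real_of_int k * t)\<bar> \<le> pi * \<bar>real_of_int k\<bar> * t"
    and "\<bar>sin (pi * real_of_int k * t)\<bar> \<le> pi * \<bar>real_of_int k\<bar> * (1 - t)"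
proof -
  show "\<bar>sin (pi * real_of_int k * t)\<bar> \<le> pi * \<bar>real_of_int k\<bar> * t"
    using abs_sin_x_le_abs_x[of "pi * real_of_int k * t"] assms by (simp add: abs_mult)
  have s0: "sin (pi * real_of_int k) = 0" using sin_zero_iff_int2 by (auto simp: mult.commute)
  then have "(cos (pi * real_of_int k))\<^sup>2 = 1" using sin_cos_squared_add[of "pi * real_of_int k"] by simp
  then have c1: "\<bar>cos (pi * real_of_int k)\<bar> = 1" by (simp add: abs_square_eq_1)
  have "sin (pi * real_of_int k * t) = sin (pi * real_of_int k - pi * real_of_int k * (1 - t))"
    by (simp add: algebra_simps)
  also have "\<dots> = - (cos (pi * real_of_int k) * sin (pi * real_of_int k * (1 - t)))"
    by (simp add: sin_diff s0)
  finally have "\<bar>sin (pi * real_of_int k * t)\<bar> = \<bar>sin (pi * real_of_int k * (1 - t))\<bar>"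
    by (simp add: abs_mult c1)
  also have "\<dots> \<le> pi * \<bar>real_of_int k\<bar> * (1 - t)"
    using abs_sin_x_le_abs_x[of "pi * real_of_int k * (1 - t)"] assms by (simp add: abs_mult)
  finally show "\<bar>sin (pi * real_of_int k * t)\<bar> \<le> pi * \<bar>real_of_int k\<bar> * (1 - t)" .
qed

lemma trig_cut_deriv:
  assumes j: "j < d" "j \<in> J" and x: "x \<in> \<Omega> d"
  shows "\<bar>partial_deriv j (trig_cut d J k n) x\<bar> \<le> 5 * (pi * \<bar>real_of_int (k j)\<bar>)"
    and "(\<lambda>n. partial_deriv j (trig_cut d J k n) x) \<longlonglongrightarrow> dtrig d J k j x"
proof -
  let ?t = "x j" and ?c = "pi * \<bar>real_of_int (k j)\<bar>"
  define R where "R n = (\<Prod>m\<in>{..<d} - {j}. tfac J k m (x m) * plateau 0 1 (Suc n) (x m))" for n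
  define h where "h n t = tfac J k j t * plateau' 0 1 (Suc n) t + tfac' J k j t * plateau 0 1 (Suc n) t" for n t
  have t: "0 < ?t" "?t < 1" using \<Omega>_coord[OF x j(1)] by auto
  have dh: "((\<lambda>t. tfac J k j t * plateau 0 1 (Suc n) t) has_real_derivative h n t) (at t)" for n t
    using DERIV_mult[OF tfac_has_deriv[of J k j t] has_deriv_plateau[of 0 1 "Suc n" t]]
    by (simp add: h_def add.commute mult.commute)
  have eq: "partial_deriv j (trig_cut d J k n) x = h n ?t * R n" for n
    unfolding trig_cut_def R_def
    by (subst partial_deriv_tensor[where i = j and h = "h n" and g = "\<lambda>m t. tfac J k m t * plateau 0 1 (Suc n) t"])
      (simp_all add: tensor_upd[OF j(1)] j(1) dh)
  have R1: "\<bar>R n\<bar> \<le> 1" for n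
    unfolding R_def abs_prod using trig_cut_fac_le by (intro prod_le_1) auto
  have sb: "\<bar>tfac J k j ?t\<bar> \<le> ?c * ?t" "\<bar>tfac J k j ?t\<bar> \<le> ?c * (1 - ?t)"
    using abs_sin_integer_pi[OF t] j(2) by (auto simp: tfac_def)
  note p = plateau'_mult[OF t sb]
  have "\<bar>tfac' J k j ?t * plateau 0 1 (Suc n) ?t\<bar> \<le> ?c * 1"
    unfolding abs_mult[of "tfac' J k j ?t"]
  proof (rule mult_mono)
    have "\<bar>tfac' J k j ?t\<bar> = ?c * \<bar>tfac (sym_diff J {j}) k j ?t\<bar>"
      by (simp add: tfac'_def abs_mult)
    also have "\<dots> \<le> ?c * 1" by (intro mult_left_mono tfac_abs_le) auto
    finally show "\<bar>tfac' J k j ?t\<bar> \<le> ?c" by simp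
    show "\<bar>plateau 0 1 (Suc n) ?t\<bar> \<le> 1" using plateau_bounds[of 0 1 "Suc n" ?t] by simp
  qed auto
  with p(1)[of "Suc n"] have "\<bar>h n ?t\<bar> \<le> 5 * ?c" unfolding h_def by linarith
  then have "\<bar>h n ?t\<bar> * \<bar>R n\<bar> \<le> (5 * ?c) * 1" using R1[of n] by (intro mult_mono) auto
  then show "\<bar>partial_deriv j (trig_cut d J k n) x\<bar> \<le> 5 * ?c" by (simp add: eq abs_mult)
  have "(\<lambda>n. tfac' J k j ?t * plateau 0 1 (Suc n) ?t) \<longlonglongrightarrow> tfac' J k j ?t * indicator {0<..<1} ?t"
    by (intro tendsto_mult tendsto_const LIMSEQ_Suc[OF plateau_tendsto])
  then have "(\<lambda>n. tfac' J k j ?t * plateau 0 1 (Suc n) ?t) \<longlonglongrightarrow> tfac' J k j ?t"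
    using t by simp
  from tendsto_add[OF LIMSEQ_Suc[OF p(2)] this] have h: "(\<lambda>n. h n ?t) \<longlonglongrightarrow> tfac' J k j ?t"
    by (simp add: h_def)
  have "R \<longlonglongrightarrow> (\<Prod>m\<in>{..<d} - {j}. tfac J k m (x m))"
    unfolding R_def by (intro tendsto_prod trig_cut_fac_tendsto[OF x]) auto
  from tendsto_mult[OF h this] show "(\<lambda>n. partial_deriv j (trig_cut d J k n) x) \<longlonglongrightarrow> dtrig d J k j x"
    unfolding eq using trig_upd_tfac'[OF j(1), of J k x] by (simp add: tensor_upd[OF j(1)])
qed

lemma l2_inner_tendsto:
  assumes "\<And>n. f n \<in> borel_measurable (leb d)" "g \<in> borel_measurable (leb d)" "v \<in> L2 d"
    and "\<And>n x. x \<in> \<Omega> d \<Longrightarrow> \<bar>f n x\<bar> \<le> C" "\<And>x. x \<in> \<Omega> d \<Longrightarrow> (\<lambda>n. f n x) \<longlonglongrightarrow> g x"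
  shows "(\<lambda>n. l2_inner d (f n) v) \<longlonglongrightarrow> l2_inner d g v"
  unfolding l2_inner_def
proof (rule integral_dominated_convergence[where w = "\<lambda>x. C * \<bar>v x\<bar>"])
  note v = L2_measurable[OF assms(3)]
  show "(\<lambda>x. g x * v x) \<in> borel_measurable (leb d)" "(\<lambda>x. f n x * v x) \<in> borel_measurable (leb d)" for n
    by (rule borel_measurable_times[OF assms(2) v], rule borel_measurable_times[OF assms(1) v])
  show "integrable (leb d) (\<lambda>x. C * \<bar>v x\<bar>)" using L2_integrable[OF assms(3)] by simp
  show "AE x in leb d. (\<lambda>n. f n x * v x) \<longlonglongrightarrow> g x * v x"
    using assms(5) by (intro AE_I2 tendsto_mult tendsto_const) auto
  show "AE x in leb d. norm (f n x * v x) \<le> C * \<bar>v x\<bar>" for n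
    using assms(4) by (intro AE_I2) (auto simp: abs_mult intro!: mult_right_mono)
qed

lemma l2_square_tendsto_0:
  fixes f :: "nat \<Rightarrow> (nat \<Rightarrow> real) \<Rightarrow> real"
  assumes "\<And>n. f n \<in> borel_measurable (leb d)" 
    and "\<And>n x. x \<in> \<Omega> d \<Longrightarrow> \<bar>f n x\<bar> \<le> C" "\<And>x. x \<in> \<Omega> d \<Longrightarrow> (\<lambda>n. f n x) \<longlonglongrightarrow> 0"
  shows "(\<lambda>n. l2_inner d (f n) (f n)) \<longlonglongrightarrow> 0"
proof -
  have "(\<lambda>n. \<integral>x. f n x * f n x \<partial>leb d) \<longlonglongrightarrow> (\<integral>x. 0 \<partial>leb d)"
  proof (rule integral_dominated_convergence[where w = "\<lambda>x. C * C"])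
    show "(\<lambda>x. f n x * f n x) \<in> borel_measurable (leb d)" for n
      by (rule borel_measurable_times[OF assms(1) assms(1)])
    show "AE x in leb d. (\<lambda>n. f n x * f n x) \<longlonglongrightarrow> 0"
      using tendsto_mult[OF assms(3) assms(3)] by (intro AE_I2) auto
    show "AE x in leb d. norm (f n x * f n x) \<le> C * C" for n
    proof (rule AE_I2)
      fix x assume "x \<in> space (leb d)"
      then have "\<bar>f n x\<bar> \<le> C" using assms(2) by simp
      then show "norm (f n x * f n x) \<le> C * C"
        unfolding real_norm_def abs_mult by (intro mult_mono) auto
    qed
  qed auto
  then show ?thesis by (simp add: l2_inner_def)
qed

text \<open>Integration by parts: a boundary term can only survive where the trigonometric product
  does not vanish on the faces orthogonal to the direction \<open>j\<close> and the other factor does not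
  have zero boundary values.\<close>

lemma trig_by_parts_H1:
  assumes v: "v \<in> H1 d" and j: "j < d" "j \<in> J"
  shows "l2_inner d (trig d J k) (wderiv d j v) = - l2_inner d (dtrig d J k j) v"
proof -
  note C = test_function_C1[OF trig_cut_test j(1), unfolded C1_pair_def]
  have m: "trig_cut d J k n \<in> borel_measurable (leb d)"
    "partial_deriv j (trig_cut d J k n) \<in> borel_measurable (leb d)" for n
    using C by (auto intro: continuous_measurable)
  have 1: "(\<lambda>n. l2_inner d (trig_cut d J k n) (wderiv d j v)) \<longlonglongrightarrow> l2_inner d (trig d J k) (wderiv d j v)"
    by (rule l2_inner_tendsto[OF m(1) continuous_measurable[OF trig_continuous] wderiv_L2[OF v j(1)]
          trig_cut_abs_le trig_cut_tendsto])
  have 2: "(\<lambda>n. l2_inner d (partial_deriv j (trig_cut d J k n)) v) \<longlonglongrightarrow> l2_inner d (dtrig d J k j) v"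
    by (rule l2_inner_tendsto[OF m(2) continuous_measurable[OF dtrig_continuous] H1_L2[OF v]
          trig_cut_deriv[OF j]])
  \<comment> \<open>The weak derivative of \<open>v\<close> is tested with the cut-off product.\<close>
  have "l2_inner d (partial_deriv j (trig_cut d J k n)) v = - l2_inner d (trig_cut d J k n) (wderiv d j v)" for n
    using wderiv_weak[OF v j(1)] trig_cut_test[of d J k n]
    by (simp add: is_weak_deriv_def l2_inner_def mult.commute)
  with 2 have "(\<lambda>n. - l2_inner d (trig_cut d J k n) (wderiv d j v)) \<longlonglongrightarrow> l2_inner d (dtrig d J k j) v"
    by simp
  with tendsto_minus[OF 1] have "- l2_inner d (trig d J k) (wderiv d j v) = l2_inner d (dtrig d J k j) v"
    by (rule LIMSEQ_unique)
  then show ?thesis by simp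
qed

text \<open>For a test function \<open>\<phi>\<close> in place of \<open>v\<close> this is the definition of the weak derivative of the
  trigonometric product, and both sides are continuous in the \<open>H\<^sup>1\<close> norm.\<close>

lemma trig_by_parts_H10:
  assumes v: "v \<in> H10 d" and j: "j < d"
  shows "l2_inner d (trig d J k) (wderiv d j v) = - l2_inner d (dtrig d J k j) v"
proof -
  let ?E = "\<lambda>v. l2_inner d (trig d J k) (wderiv d j v) + l2_inner d (dtrig d J k j) v"
  have d: "0 < d" using j by simp
  have vH: "v \<in> H1 d" by (rule H10_H1[OF v])
  define C where "C = 1 + pi * \<bar>real_of_int (k j)\<bar>"
  have C: "C > 0" unfolding C_def by (intro add_pos_nonneg) auto
  have "\<bar>?E v\<bar> \<le> 0 + e" if e: "e > 0" for e
  proof -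
    obtain \<phi> where \<phi>: "\<phi> \<in> test_functions d" and less: "H1_norm d (\<lambda>x. v x - \<phi> x) < e / C"
      using v divide_pos_pos[OF e C] unfolding H10_def by blast
    define w where "w x = v x + (-1) * \<phi> x" for x
    have \<phi>H: "\<phi> \<in> H1 d" by (rule test_function_H1[OF d \<phi>])
    have wH: "w \<in> H1 d" unfolding w_def[abs_def] by (rule H1_lincomb[OF vH \<phi>H])
    have "AE x in leb d. wderiv d j \<phi> x = partial_deriv j \<phi> x"
      by (rule wderiv_AE[OF C1_weak_deriv[OF test_function_C1[OF \<phi> j] j]])
    then have "l2_inner d (trig d J k) (wderiv d j \<phi>) = l2_inner d (trig d J k) (partial_deriv j \<phi>)"
      using C1_pair_L2[OF test_function_C1[OF \<phi> j]]
      by (intro l2_cong_AE trig_L2 wderiv_L2[OF \<phi>H j]) auto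
    also have "\<dots> = - l2_inner d (dtrig d J k j) \<phi>"
      using C1_weak_deriv[OF trig_C1[OF j] j] \<phi> by (simp add: is_weak_deriv_def l2_inner_def)
    finally have E\<phi>: "?E \<phi> = 0" by simp
    have "l2_inner d (trig d J k) (wderiv d j w)
        = l2_inner d (trig d J k) (\<lambda>x. wderiv d j v x + (-1) * wderiv d j \<phi> x)"
      unfolding w_def[abs_def]
      by (intro l2_cong_AE trig_L2 wderiv_lincomb vH \<phi>H j wderiv_L2 H1_lincomb l2.lincomb) auto
    also have "\<dots> = l2_inner d (trig d J k) (wderiv d j v) + (-1) * l2_inner d (trig d J k) (wderiv d j \<phi>)"
      by (intro l2.right trig_L2 wderiv_L2 vH \<phi>H j)
    finally have "?E w = ?E v - ?E \<phi>"
      using l2.right[OF H1_L2[OF vH] H1_L2[OF \<phi>H] dtrig_L2[of d J k j], of "-1"]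
      by (simp add: w_def[abs_def])
    then have Ev: "?E v = ?E w" using E\<phi> by simp
    have "\<bar>l2_inner d (trig d J k) (wderiv d j w)\<bar> \<le> l2.nrm d (trig d J k) * l2.nrm d (wderiv d j w)"
      by (intro l2.cauchy_schwarz trig_L2 wderiv_L2 wH j)
    also have "\<dots> \<le> 1 * H1_norm d w"
      using l2_nrm_bounded[OF trig_L2[of d J k] trig_abs_le]
      by (intro mult_mono wderiv_norm_le wH j l2.nrm_nonneg wderiv_L2) auto
    finally have a: "\<bar>l2_inner d (trig d J k) (wderiv d j w)\<bar> \<le> H1_norm d w" by simp
    have "\<bar>l2_inner d (dtrig d J k j) w\<bar> \<le> l2.nrm d (dtrig d J k j) * l2.nrm d w"
      by (intro l2.cauchy_schwarz dtrig_L2 H1_L2 wH)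
    also have "\<dots> \<le> (pi * \<bar>real_of_int (k j)\<bar>) * H1_norm d w"
      using l2_nrm_bounded[OF dtrig_L2[of d J k j] dtrig_abs_le]
      by (intro mult_mono l2_norm_le_H1 wH l2.nrm_nonneg H1_L2) (auto simp: abs_mult)
    finally have "\<bar>?E w\<bar> \<le> C * H1_norm d w" using a unfolding C_def by (simp add: algebra_simps)
    also have "\<dots> \<le> C * (e / C)"
      using less C by (intro mult_left_mono) (auto simp: w_def[abs_def])
    finally show ?thesis using Ev C by simp
  qed
  then have "\<bar>?E v\<bar> \<le> 0" by (rule field_le_epsilon)
  then show ?thesis by linarith
qed

text \<open>All factors are sines, so all partial derivatives of the cut-off products converge boundedly.\<close>

lemma sine_product_H10:
  assumes d: "0 < d"
  shows "trig d UNIV k \<in> H10 d"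
  unfolding H10_def
proof (intro CollectI conjI allI impI)
  show "trig d UNIV k \<in> H1 d" by (rule trig_H1[OF d])
  fix \<delta> :: real assume \<delta>: "\<delta> > 0"
  define w where "w n x = trig d UNIV k x + (-1) * trig_cut d UNIV k n x" for n x
  define w' where "w' n i x = dtrig d UNIV k i x + (-1) * partial_deriv i (trig_cut d UNIV k n) x" for n i x
  have C: "C1_pair d i (w n) (w' n i)" if "i < d" for n i
    unfolding w_def[abs_def] w'_def[abs_def]
    by (rule C1_pair_lincomb[OF trig_C1[OF that] test_function_C1[OF trig_cut_test that]])
  have eq: "H1_inner d (w n) (w n) = (\<Sum>i<d. l2_inner d (w' n i) (w' n i)) + l2_inner d (w n) (w n)" for n
    by (rule C1_H1_inner_self[OF d C])
  have meas: "w n \<in> borel_measurable (leb d)" for n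
    using C[of 0 n] d by (auto simp: C1_pair_def intro: continuous_measurable)
  have 0: "(\<lambda>n. l2_inner d (w n) (w n)) \<longlonglongrightarrow> 0"
  proof (rule l2_square_tendsto_0[OF meas, where C = 2])
    show "\<bar>w n x\<bar> \<le> 2" for n x
      using trig_abs_le[of d UNIV k x] trig_cut_abs_le[of d UNIV k n x] unfolding w_def by linarith
    fix x assume "x \<in> \<Omega> d"
    from tendsto_diff[OF tendsto_const trig_cut_tendsto[OF this], of "trig d UNIV k x" UNIV k]
    show "(\<lambda>n. w n x) \<longlonglongrightarrow> 0" unfolding w_def by simp
  qed
  have i: "(\<lambda>n. l2_inner d (w' n i) (w' n i)) \<longlonglongrightarrow> 0" if i: "i < d" for i
  proof (rule l2_square_tendsto_0[where C = "6 * (pi * \<bar>real_of_int (k i)\<bar>)"])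
    show "w' n i \<in> borel_measurable (leb d)" for n
      using C[OF i, of n] by (auto simp: C1_pair_def intro: continuous_measurable)
    fix x assume x: "x \<in> \<Omega> d"
    show "\<bar>w' n i x\<bar> \<le> 6 * (pi * \<bar>real_of_int (k i)\<bar>)" for n
      using dtrig_abs_le[of d UNIV k i x] trig_cut_deriv(1)[OF i UNIV_I x, of k n] unfolding w'_def by linarith
    from tendsto_diff[OF tendsto_const trig_cut_deriv(2)[OF i UNIV_I x], of "dtrig d UNIV k i x" k]
    show "(\<lambda>n. w' n i x) \<longlonglongrightarrow> 0" unfolding w'_def by simp
  qed
  have "(\<lambda>n. (\<Sum>i<d. l2_inner d (w' n i) (w' n i)) + l2_inner d (w n) (w n)) \<longlonglongrightarrow> (\<Sum>i<d. 0) + 0"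
    by (intro tendsto_add tendsto_sum i 0) auto
  then have "(\<lambda>n. H1_inner d (w n) (w n)) \<longlonglongrightarrow> 0" unfolding eq by simp
  then have "(\<lambda>n. H1_norm d (w n)) \<longlonglongrightarrow> sqrt 0"
    unfolding H1_norm_def by (rule tendsto_real_sqrt)
  then have "(\<lambda>n. H1_norm d (w n)) \<longlonglongrightarrow> 0" by simp
  then obtain n where "H1_norm d (w n) < \<delta>"
    using order_tendstoD(2)[OF _ \<delta>] by (metis eventually_sequentially order_refl)
  then show "\<exists>\<phi>\<in>test_functions d. H1_norm d (\<lambda>x. trig d UNIV k x - \<phi> x) < \<delta>"
    using trig_cut_test by (intro bexI[of _ "trig_cut d UNIV k n"]) (simp_all add: w_def[abs_def])
qed

section \<open>Finite combinations with controlled mass\<close>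

text \<open>\<open>combo \<phi> w X u\<close>: the function \<open>u\<close> has some representation as a finite combination of the atoms
  \<open>\<phi> i\<close> in which the absolute coefficients, weighted by \<open>w\<close>, sum up to at most \<open>X\<close>. The atoms may
  repeat.\<close>

inductive combo :: "('i \<Rightarrow> 'x \<Rightarrow> real) \<Rightarrow> ('i \<Rightarrow> real) \<Rightarrow> real \<Rightarrow> ('x \<Rightarrow> real) \<Rightarrow> bool"
  for \<phi> :: "'i \<Rightarrow> 'x \<Rightarrow> real" and w :: "'i \<Rightarrow> real" where
  combo_zero: "0 \<le> X \<Longrightarrow> combo \<phi> w X (\<lambda>x. 0)"
| combo_add: "combo \<phi> w X u \<Longrightarrow> X + \<bar>c\<bar> * w i \<le> Y \<Longrightarrow> combo \<phi> w Y (\<lambda>x. u x + c * \<phi> i x)"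

lemma combo_nonneg:
  assumes "combo \<phi> w X u" "\<And>i. 0 \<le> w i" shows "0 \<le> X"
  using assms(1)
proof (induction rule: combo.induct)
  case (combo_add X u c i Y)
  then show ?case using mult_nonneg_nonneg[OF abs_ge_zero[of c] assms(2)[of i]] by linarith
qed

lemma combo_mono: "combo \<phi> w X u \<Longrightarrow> X \<le> Y \<Longrightarrow> combo \<phi> w Y u"
  by (erule combo.cases) (auto intro: combo.intros)

lemma combo_sum2:
  assumes "combo \<phi> w Y v" "combo \<phi> w X u"
  shows "combo \<phi> w (X + Y) (\<lambda>x. u x + v x)"
  using assms(1)
proof (induction rule: combo.induct)
  case (combo_zero Y)
  then show ?case using combo_mono[OF assms(2)] by simp
next
  case (combo_add Y v c i Z)
  have "combo \<phi> w (X + Z) (\<lambda>x. (u x + v x) + c * \<phi> i x)"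
    by (rule combo.combo_add[OF combo_add.IH]) (use combo_add.hyps in linarith)
  then show ?case by (simp add: add.assoc)
qed

lemma combo_scale:
  assumes "combo \<phi> w X u"
  shows "combo \<phi> w (\<bar>a\<bar> * X) (\<lambda>x. a * u x)"
  using assms
proof (induction rule: combo.induct)
  case (combo_zero X)
  then show ?case using combo.combo_zero[of "\<bar>a\<bar> * X"] by simp
next
  case (combo_add X u c i Y)
  have "\<bar>a\<bar> * X + \<bar>a * c\<bar> * w i \<le> \<bar>a\<bar> * Y"
    using mult_left_mono[OF combo_add.hyps(2), of "\<bar>a\<bar>"] by (simp add: abs_mult distrib_left mult.assoc)
  from combo.combo_add[OF combo_add.IH this] show ?case by (simp add: distrib_left mult.assoc)
qed

lemma combo_atom: "combo \<phi> w (w i) (\<phi> i)"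
  using combo_add[OF combo_zero[OF order_refl, of \<phi> w], of 1 i "w i"] by simp

lemma combo_sum:
  assumes "finite I" "\<And>i. i \<in> I \<Longrightarrow> combo \<phi> w (X i) (u i)"
  shows "combo \<phi> w (\<Sum>i\<in>I. X i) (\<lambda>x. \<Sum>i\<in>I. u i x)"
  using assms
proof (induction I rule: finite_induct)
  case empty
  then show ?case by (simp add: combo_zero)
next
  case (insert i I)
  then show ?case using combo_sum2[OF insert.IH, of "X i" "u i"] by simp
qed

lemma combo_trans:
  assumes "combo \<phi> w X u" "\<And>i. combo \<phi>' w' (w i) (\<phi> i)"
  shows "combo \<phi>' w' X u"
  using assms(1)
proof (induction rule: combo.induct)
  case (combo_zero X)
  then show ?case by (rule combo.combo_zero)
next
  case (combo_add X u c i Y)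
  show ?case
    by (rule combo_mono[OF combo_sum2[OF combo_scale[OF assms(2)] combo_add.IH] combo_add.hyps(2)])
qed

context semi_inner
begin

lemma zero_in: "u \<in> V \<Longrightarrow> (\<lambda>x. 0) \<in> V"
  using lincomb[of u u "-1"] by simp

lemma scale_in: "u \<in> V \<Longrightarrow> (\<lambda>x. c * u x) \<in> V"
  using lincomb[OF zero_in, of u u c] by simp

lemma scale_right: "u \<in> V \<Longrightarrow> v \<in> V \<Longrightarrow> ip v (\<lambda>x. c * u x) = c * ip v u"
  using right[OF zero_in, of u u v c] right[OF zero_in zero_in, of u u v 1] by simp

lemma combo_in:
  assumes "combo \<phi> w X u" "\<And>i. \<phi> i \<in> V"
  shows "u \<in> V"
  using assms(1) by (induction rule: combo.induct) (auto intro: lincomb zero_in[OF assms(2)] assms(2))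

text \<open>A strict bound on the atoms is inherited by the combination, unless the functional vanishes
  there, as it does for mass \<open>0\<close>.\<close>

lemma combo_functional:
  assumes "combo \<phi> w X u" and V: "\<And>i. \<phi> i \<in> V" "p \<in> V"
    and K: "0 \<le> K" "\<And>i. \<bar>ip p (\<phi> i)\<bar> < K * w i" and w: "\<And>i. 0 < w i"
  shows "\<bar>ip p u\<bar> \<le> K * X \<and> (ip p u = 0 \<or> \<bar>ip p u\<bar> < K * X)"
  using assms(1)
proof (induction rule: combo.induct)
  case (combo_zero X)
  have "ip p (\<lambda>x. 0) = 0" using scale_right[OF V(2) V(2), of 0] by simp
  then show ?case using combo_zero K(1) by simp
next
  case (combo_add X u c i Y)
  have eq: "ip p (\<lambda>x. u x + c * \<phi> i x) = ip p u + c * ip p (\<phi> i)"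
    using right[OF combo_in[OF combo_add.hyps(1) V(1)] V(1,2)] .
  have le: "K * X + K * (\<bar>c\<bar> * w i) \<le> K * Y"
    using mult_left_mono[OF combo_add.hyps(2) K(1)] by (simp add: distrib_left)
  show ?case
  proof (cases "c = 0")
    case True
    then show ?thesis using combo_add.IH le unfolding eq by auto
  next
    case False
    then have "\<bar>c * ip p (\<phi> i)\<bar> < K * (\<bar>c\<bar> * w i)"
      using mult_strict_left_mono[OF K(2)[of i], of "\<bar>c\<bar>"] by (simp add: abs_mult mult_ac)
    with combo_add.IH le have "\<bar>ip p u + c * ip p (\<phi> i)\<bar> < K * Y" by linarith
    then show ?thesis unfolding eq by simp
  qed
qed

lemma combo_mass_0:
  assumes "combo \<phi> w X u" "X \<le> 0" and w: "\<And>i. 0 < w i"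
  shows "u = (\<lambda>x. 0)"
  using assms(1,2)
proof (induction rule: combo.induct)
  case (combo_add X u c i Y)
  have "0 \<le> X" by (rule combo_nonneg[OF combo_add.hyps(1) less_imp_le[OF w]])
  with combo_add.hyps combo_add.prems have "\<bar>c\<bar> * w i \<le> 0" "X \<le> 0"
    using mult_nonneg_nonneg[OF abs_ge_zero[of c] less_imp_le[OF w[of i]]] by linarith+
  then have "c = 0" using w[of i] by (simp add: mult_le_0_iff)
  then show ?case using combo_add.IH \<open>X \<le> 0\<close> by simp
qed simp

text \<open>If a linear functional exceeded its value at \<open>u\<close> on all atoms scaled to mass \<open>\<plusminus>M\<close>, then it would be
  smaller than \<open>|ip p u|\<close> in absolute value on the whole hull, which contains \<open>u\<close>.\<close>

lemma combo_minimizer: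
  assumes u: "combo \<phi> w M u" and V: "\<And>i. \<phi> i \<in> V" "p \<in> V" and w: "\<And>i. 0 < w i"
  shows "\<exists>i s. \<bar>s\<bar> * w i \<le> M \<and> s * ip p (\<phi> i) \<le> ip p u"
proof (rule ccontr)
  assume "\<not> ?thesis"
  then have neg: "ip p u < s * ip p (\<phi> i)" if "\<bar>s\<bar> * w i \<le> M" for i s using that by force
  have M: "0 \<le> M" by (rule combo_nonneg[OF u less_imp_le[OF w]])
  have lt: "ip p u < 0" using neg[of 0] M by simp
  have "M \<noteq> 0"
  proof
    assume "M = 0"
    then have "u = (\<lambda>x. 0)" using combo_mass_0[OF u] w by simp
    then show False using lt scale_right[OF V(2) V(2), of 0] by simp
  qed
  then have M: "0 < M" using M by simp
  have K: "\<bar>ip p (\<phi> i)\<bar> < (- ip p u / M) * w i" for i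
  proof -
    have "ip p u < (M / w i) * ip p (\<phi> i)" "ip p u < (- M / w i) * ip p (\<phi> i)"
      using M w[of i] by (intro neg; simp)+
    then have "(M / w i) * \<bar>ip p (\<phi> i)\<bar> < - ip p u" by (auto simp: abs_if)
    then show ?thesis using M w[of i] by (simp add: field_simps)
  qed
  have "0 \<le> - ip p u / M" by (rule divide_nonneg_pos) (use lt M in auto)
  from combo_functional[OF u V this K w] have "ip p u = 0 \<or> \<bar>ip p u\<bar> < (- ip p u / M) * M" by simp
  then show False using lt M by simp
qed

text \<open>Maurey's sampling argument. The random choice is replaced by a greedy one: in each
  step some admissible atom does not exceed the average of the linear functional that matters.\<close>

lemma maurey:
  assumes u: "combo \<phi> w M u" and V: "\<And>i. \<phi> i \<in> V" and w: "\<And>i. 0 < w i"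
    and le: "\<And>i. ip (\<phi> i) (\<phi> i) \<le> (w i)\<^sup>2"
  shows "\<exists>i s. (\<forall>n<k. \<bar>s n\<bar> * w (i n) \<le> M) \<and> (\<lambda>x. (\<Sum>n<k. s n * \<phi> (i n) x) - real k * u x) \<in> V \<and>
    ip (\<lambda>x. (\<Sum>n<k. s n * \<phi> (i n) x) - real k * u x) (\<lambda>x. (\<Sum>n<k. s n * \<phi> (i n) x) - real k * u x)
      \<le> real k * M\<^sup>2"
proof (induction k)
  case 0
  have "ip (\<lambda>x. 0) (\<lambda>x. 0) = 0" using scale_right[OF V zero_in[OF V], of 0] by simp
  then show ?case using zero_in[OF V] by auto
next
  case (Suc k)
  then obtain i s where adm: "\<And>n. n < k \<Longrightarrow> \<bar>s n\<bar> * w (i n) \<le> M"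
    and SV: "(\<lambda>x. (\<Sum>n<k. s n * \<phi> (i n) x) - real k * u x) \<in> V"
    and S: "ip (\<lambda>x. (\<Sum>n<k. s n * \<phi> (i n) x) - real k * u x)
        (\<lambda>x. (\<Sum>n<k. s n * \<phi> (i n) x) - real k * u x) \<le> real k * M\<^sup>2" by blast
  let ?S = "\<lambda>x. (\<Sum>n<k. s n * \<phi> (i n) x) - real k * u x"
  have uV: "u \<in> V" by (rule combo_in[OF u V])
  have pV: "(\<lambda>x. ?S x + (-1) * u x) \<in> V" by (rule lincomb[OF SV uV])
  obtain i' s' where s': "\<bar>s'\<bar> * w i' \<le> M"
    and l: "s' * ip (\<lambda>x. ?S x + (-1) * u x) (\<phi> i') \<le> ip (\<lambda>x. ?S x + (-1) * u x) u"
    using combo_minimizer[OF u V pV w] by blast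
  define r where "r x = s' * \<phi> i' x" for x
  have rV: "r \<in> V" unfolding r_def[abs_def] by (rule scale_in[OF V])
  have "ip (\<lambda>x. ?S x + (-1) * u x) r \<le> ip (\<lambda>x. ?S x + (-1) * u x) u"
    using l scale_right[OF V pV] by (simp add: r_def[abs_def])
  \<comment> \<open>The cross terms of the squared norm, linear in \<open>r\<close>, do not exceed their value at the mean \<open>u\<close>.\<close>
  then have l': "ip ?S r - ip u r \<le> ip ?S u - ip u u"
    using left[OF SV uV rV, of "-1"] left[OF SV uV uV, of "-1"] by simp
  have "ip r r = s'\<^sup>2 * ip (\<phi> i') (\<phi> i')"
    using scale_right[where c = s', OF V rV, of i'] scale_right[where c = s', OF V V, of i' i'] sym[OF rV V, of i']
    by (simp add: r_def[abs_def] power2_eq_square)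
  also have "\<dots> \<le> s'\<^sup>2 * (w i')\<^sup>2" by (intro mult_left_mono le) simp
  also have "\<dots> = (\<bar>s'\<bar> * w i')\<^sup>2" by (simp add: power_mult_distrib)
  also have "\<dots> \<le> M\<^sup>2" using s' w[of i'] by (intro power_mono) auto
  finally have rr: "ip r r \<le> M\<^sup>2" .
  define q where "q x = r x + (-1) * u x" for x
  have qV: "q \<in> V" unfolding q_def[abs_def] by (rule lincomb[OF rV uV])
  have arith: "a + 2 * (b - c) + (r - 2 * e + f) \<le> A + B - f"
    if "a \<le> A" "r \<le> B" "b - e \<le> c - f" for a b c e f r A B :: real
  proof -
    have "2 * (b - c) \<le> 2 * (e - f)" using that(3) by simp
    then show ?thesis using that(1,2) by (simp add: algebra_simps)
  qed
  have "ip (\<lambda>x. ?S x + 1 * q x) (\<lambda>x. ?S x + 1 * q x) = ip ?S ?S + 2 * ip ?S q + ip q q"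
    using square_lincomb[OF SV qV, of 1] by simp
  also have "ip ?S q = ip ?S r - ip ?S u"
    using right[OF rV uV SV, of "-1"] by (simp add: q_def[abs_def])
  also have "ip q q = ip r r - 2 * ip u r + ip u u"
    using square_lincomb[OF rV uV, of "-1"] sym[OF rV uV] by (simp add: q_def[abs_def])
  finally have "ip (\<lambda>x. ?S x + 1 * q x) (\<lambda>x. ?S x + 1 * q x) \<le> real k * M\<^sup>2 + M\<^sup>2 - ip u u"
    using arith[OF S rr l'] by simp
  then have fin: "ip (\<lambda>x. ?S x + 1 * q x) (\<lambda>x. ?S x + 1 * q x) \<le> real (Suc k) * M\<^sup>2"
    using nonneg[OF uV] by (simp add: algebra_simps)
  have eq: "(\<lambda>x. (\<Sum>n<Suc k. (s(k := s')) n * \<phi> ((i(k := i')) n) x) - real (Suc k) * u x) = (\<lambda>x. ?S x + 1 * q x)"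
    by (simp add: fun_eq_iff q_def r_def algebra_simps)
  have "\<forall>n<Suc k. \<bar>(s(k := s')) n\<bar> * w ((i(k := i')) n) \<le> M"
    using adm s' by (auto simp: less_Suc_eq)
  with fin lincomb[OF SV qV, of 1] show ?case
    by (intro exI[of _ "i(k := i')"] exI[of _ "s(k := s')"] conjI) (simp_all only: eq)
qed

end


section \<open>Products of trigonometric products\<close>

lemma tfac_mult:
  "tfac J k m t * tfac J' l m t =
    (if m \<in> J \<and> m \<in> J' then - 1 / 2 else 1 / 2) * tfac (sym_diff J J') (\<lambda>m. k m + l m) m t +
    (if m \<notin> J \<and> m \<in> J' then - 1 / 2 else 1 / 2) * tfac (sym_diff J J') (\<lambda>m. k m - l m) m t"
  by (cases "m \<in> J"; cases "m \<in> J'")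
    (simp_all add: tfac_def distrib_left left_diff_distrib right_diff_distrib distrib_right
      cos_add cos_diff sin_add sin_diff)

text \<open>Each factor is a half-sum of two trigonometric functions with the sum and the difference of the
  frequencies; multiplying out gives \<open>2\<^sup>d\<close> terms with coefficients \<open>\<plusminus>1 / 2\<^sup>d\<close>.\<close>

lemma trig_mult:
  obtains s :: "nat set \<Rightarrow> real" and n :: "nat set \<Rightarrow> nat \<Rightarrow> int" where
    "\<And>x. trig d J k x * trig d J' l x = (\<Sum>B\<in>Pow {..<d}. s B * trig d (sym_diff J J') (n B) x)"
    "(\<Sum>B\<in>Pow {..<d}. \<bar>s B\<bar>) = 1" "\<And>B m. \<bar>n B m\<bar> \<le> \<bar>k m\<bar> + \<bar>l m\<bar>"
proof
  define a b :: "nat \<Rightarrow> real" where "a m = (if m \<in> J \<and> m \<in> J' then - 1 / 2 else 1 / 2)"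
    and "b m = (if m \<notin> J \<and> m \<in> J' then - 1 / 2 else 1 / 2)" for m
  define s where "s B = (\<Prod>m\<in>B. a m) * (\<Prod>m\<in>{..<d} - B. b m)" for B
  define n where "n B m = (if m \<in> B then k m + l m else k m - l m)" for B m
  let ?J = "sym_diff J J'"
  show "\<bar>n B m\<bar> \<le> \<bar>k m\<bar> + \<bar>l m\<bar>" for B m by (auto simp: n_def)
  show "trig d J k x * trig d J' l x = (\<Sum>B\<in>Pow {..<d}. s B * trig d ?J (n B) x)" for x
  proof -
    have "trig d J k x * trig d J' l x =
        (\<Prod>m<d. a m * tfac ?J (\<lambda>m. k m + l m) m (x m) + b m * tfac ?J (\<lambda>m. k m - l m) m (x m))"
      unfolding trig_def tensor_def prod.distrib[symmetric] a_def b_def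
      by (intro prod.cong refl tfac_mult)
    also have "\<dots> = (\<Sum>B\<in>Pow {..<d}. (\<Prod>m\<in>B. a m * tfac ?J (\<lambda>m. k m + l m) m (x m)) *
        (\<Prod>m\<in>{..<d} - B. b m * tfac ?J (\<lambda>m. k m - l m) m (x m)))"
      by (rule prod_add) simp
    also have "\<dots> = (\<Sum>B\<in>Pow {..<d}. s B * trig d ?J (n B) x)"
    proof (rule sum.cong[OF refl])
      fix B assume "B \<in> Pow {..<d}"
      then have B: "B \<subseteq> {..<d}" by simp
      have "(\<Prod>m\<in>B. tfac ?J (\<lambda>m. k m + l m) m (x m)) = (\<Prod>m\<in>B. tfac ?J (n B) m (x m))"
        "(\<Prod>m\<in>{..<d} - B. tfac ?J (\<lambda>m. k m - l m) m (x m)) = (\<Prod>m\<in>{..<d} - B. tfac ?J (n B) m (x m))"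
        by (auto intro!: prod.cong simp: tfac_def n_def)
      moreover have "trig d ?J (n B) x = (\<Prod>m\<in>{..<d} - B. tfac ?J (n B) m (x m)) * (\<Prod>m\<in>B. tfac ?J (n B) m (x m))"
        unfolding trig_def tensor_def by (rule prod.subset_diff[OF B]) simp
      ultimately show "(\<Prod>m\<in>B. a m * tfac ?J (\<lambda>m. k m + l m) m (x m)) *
        (\<Prod>m\<in>{..<d} - B. b m * tfac ?J (\<lambda>m. k m - l m) m (x m)) = s B * trig d ?J (n B) x"
        by (simp only: prod.distrib s_def mult_ac)
    qed
    finally show ?thesis .
  qed
  have "(\<Sum>B\<in>Pow {..<d}. \<bar>s B\<bar>) = (\<Sum>B\<in>Pow {..<d}. (\<Prod>m\<in>B. 1/2) * (\<Prod>m\<in>{..<d} - B. 1/2))"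
    unfolding s_def abs_mult abs_prod by (intro sum.cong refl arg_cong2[where f = times] prod.cong) (auto simp: a_def b_def)
  also have "\<dots> = (\<Prod>m<d. 1/2 + 1/2)" by (rule prod_add[symmetric]) simp
  finally show "(\<Sum>B\<in>Pow {..<d}. \<bar>s B\<bar>) = 1" by simp
qed

section \<open>The Riesz representative of the residual\<close>

text \<open>The eigenvalue of \<open>I - \<Delta>\<close> for frequency \<open>k\<close>, which is the weight of the Barron norm of order \<open>2\<close>.\<close>

definition wt :: "nat \<Rightarrow> (nat \<Rightarrow> int) \<Rightarrow> real" where
  "wt d k = 1 + pi\<^sup>2 * (\<Sum>m<d. (real_of_int (k m))\<^sup>2)"

lemma wt_ge_1: "1 \<le> wt d k"
  by (simp add: wt_def sum_nonneg)

lemma wt_pos: "0 < wt d k"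
  using wt_ge_1[of d k] by linarith

lemma l2_sum_left:
  assumes "finite F" "\<And>k. k \<in> F \<Longrightarrow> u k \<in> L2 d" "v \<in> L2 d"
  shows "(\<lambda>x. \<Sum>k\<in>F. a k * u k x) \<in> L2 d"
    and "l2_inner d (\<lambda>x. \<Sum>k\<in>F. a k * u k x) v = (\<Sum>k\<in>F. a k * l2_inner d (u k) v)"
proof -
  have "(\<lambda>x. \<Sum>k\<in>F. a k * u k x) \<in> L2 d \<and>
      l2_inner d (\<lambda>x. \<Sum>k\<in>F. a k * u k x) v = (\<Sum>k\<in>F. a k * l2_inner d (u k) v)"
    using assms(1,2)
  proof (induction F rule: finite_induct)
    case empty
    then show ?case using l2.zero_in[OF assms(3)] by (simp add: l2_inner_def)
  next
    case (insert k F)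
    then have I: "(\<lambda>x. \<Sum>k\<in>F. a k * u k x) \<in> L2 d" "u k \<in> L2 d" by auto
    from insert l2_left[OF I assms(3), of "a k"] l2.lincomb[OF I, of "a k"] show ?case
      by (simp add: add.commute)
  qed
  then show "(\<lambda>x. \<Sum>k\<in>F. a k * u k x) \<in> L2 d"
    "l2_inner d (\<lambda>x. \<Sum>k\<in>F. a k * u k x) v = (\<Sum>k\<in>F. a k * l2_inner d (u k) v)" by auto
qed

lemma l2_cong_meas:
  assumes "u \<in> borel_measurable (leb d)" "u' \<in> borel_measurable (leb d)" "v \<in> borel_measurable (leb d)"
    and "AE x in leb d. u x = u' x"
  shows "l2_inner d u v = l2_inner d u' v"
  unfolding l2_inner_def
proof (rule integral_cong_AE)
  show "(\<lambda>x. u x * v x) \<in> borel_measurable (leb d)" "(\<lambda>x. u' x * v x) \<in> borel_measurable (leb d)"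
    using assms(1-3) by (auto intro: borel_measurable_times)
  show "AE x in leb d. u x * v x = u' x * v x"
    using assms(4) by eventually_elim simp
qed

lemma combo_trig_C1:
  assumes "combo (trig d D) w X u"
  shows "\<exists>du. \<forall>i<d. C1_pair d i u (du i)"
  using assms
proof (induction rule: combo.induct)
  case (combo_zero X)
  show ?case by (intro exI[of _ "\<lambda>_ _. 0"]) (auto simp: C1_pair_def)
next
  case (combo_add X u c k Y)
  then obtain du where "\<forall>i<d. C1_pair d i u (du i)" by blast
  then show ?case
    by (intro exI[of _ "\<lambda>i x. du i x + c * dtrig d D k i x"]) (auto intro: C1_pair_lincomb trig_C1)
qed

text \<open>Frequencies of coefficient functions are indexed by \<open>\<nat>\<^sup>d\<close>.\<close>

abbreviation nfreq :: "(nat \<Rightarrow> nat) \<Rightarrow> nat \<Rightarrow> int" where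
  "nfreq k \<equiv> (\<lambda>m. int (k m))"

abbreviation nlen :: "nat \<Rightarrow> (nat \<Rightarrow> nat) \<Rightarrow> real" where
  "nlen d k \<equiv> L2_set (\<lambda>m. real (k m)) {..<d}"

text \<open>What the iteration uses of a Barron norm: the bound \<open>l\<close> for finite sums that come arbitrarily
  close in \<open>L\<^sup>2\<close>.\<close>

definition approximable :: "nat \<Rightarrow> nat set \<Rightarrow> nat \<Rightarrow> real \<Rightarrow> ((nat \<Rightarrow> real) \<Rightarrow> real) \<Rightarrow> bool" where
  "approximable d J n l g \<longleftrightarrow> g \<in> L2 d \<and>
     (\<forall>\<delta>>0. \<exists>F a. finite F \<and> (\<Sum>k\<in>F. \<bar>a k\<bar> * (1 + pi ^ n * nlen d k ^ n)) \<le> l \<and>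
        l2.nrm d (\<lambda>x. g x - (\<Sum>k\<in>F. a k * trig d J (nfreq k) x)) \<le> \<delta>)"

text \<open>Two derivatives fall on the product of a term of \<open>A\<^sub>i\<^sub>j\<close> and a term of the iterate. The term of \<open>A\<^sub>i\<^sub>j\<close>
  receives at most one of them; the powers of \<open>l\<close> are absorbed in the weight of the iterate, because
  \<open>|l\<^sub>i| \<le> l\<^sub>i\<^sup>2\<close> for integers.\<close>

lemma frequency_bound:
  assumes "i < d" "j < d"
  shows "pi\<^sup>2 * \<bar>real_of_int (l i)\<bar> * (real (k j) + \<bar>real_of_int (l j)\<bar>)
    \<le> (1 + pi ^ 1 * nlen d k ^ 1) * wt d l"
proof -
  define S where "S = (\<Sum>m<d. (real_of_int (l m))\<^sup>2)"
  have S0: "0 \<le> S" unfolding S_def by (intro sum_nonneg) auto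
  have sq: "(real_of_int (l m))\<^sup>2 \<le> S" if "m < d" for m
    unfolding S_def using that by (intro member_le_sum) auto
  have "\<bar>real_of_int (l i)\<bar> \<le> (real_of_int (l i))\<^sup>2"
  proof -
    have "1 * \<bar>l i\<bar> \<le> \<bar>l i\<bar> * \<bar>l i\<bar>"
    proof (cases "l i = 0")
      case False
      then have "1 \<le> \<bar>l i\<bar>" by simp
      then show ?thesis by (rule mult_right_mono) simp
    qed simp
    then have "\<bar>l i\<bar> \<le> (l i)\<^sup>2" by (simp add: power2_eq_square)
    then have "real_of_int \<bar>l i\<bar> \<le> real_of_int ((l i)\<^sup>2)" by (simp only: of_int_le_iff)
    then show ?thesis by simp
  qed
  then have li: "\<bar>real_of_int (l i)\<bar> \<le> S" using sq[OF assms(1)] by linarith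
  have kj: "real (k j) \<le> nlen d k" using member_le_L2_set[of "{..<d}" j "\<lambda>m. real (k m)"] assms(2) by simp
  have n0: "0 \<le> nlen d k" by (rule L2_set_nonneg)
  have "pi * (pi * (\<bar>real_of_int (l i)\<bar> * real (k j))) \<le> pi * (pi * (S * nlen d k))"
    using li kj S0 by (intro mult_left_mono mult_mono) auto
  also have "\<dots> \<le> pi * nlen d k * (pi\<^sup>2 * S)"
  proof -
    have "1 * (pi * (pi * (S * nlen d k))) \<le> pi * (pi * (pi * (S * nlen d k)))"
      using S0 n0 pi_gt3 by (intro mult_right_mono mult_nonneg_nonneg) auto
    then show ?thesis by (simp add: power2_eq_square mult_ac)
  qed
  finally have 1: "pi\<^sup>2 * \<bar>real_of_int (l i)\<bar> * real (k j) \<le> pi * nlen d k * (pi\<^sup>2 * S)"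
    by (simp add: power2_eq_square mult_ac)
  have "\<bar>real_of_int (l i)\<bar> * \<bar>real_of_int (l j)\<bar> \<le> ((real_of_int (l i))\<^sup>2 + (real_of_int (l j))\<^sup>2) / 2"
    using sum_squares_bound[of "\<bar>real_of_int (l i)\<bar>" "\<bar>real_of_int (l j)\<bar>"] by simp
  also have "\<dots> \<le> S" using sq[OF assms(1)] sq[OF assms(2)] by simp
  finally have 2: "pi\<^sup>2 * (\<bar>real_of_int (l i)\<bar> * \<bar>real_of_int (l j)\<bar>) \<le> pi\<^sup>2 * S"
    by (intro mult_left_mono) auto
  have "pi\<^sup>2 * \<bar>real_of_int (l i)\<bar> * (real (k j) + \<bar>real_of_int (l j)\<bar>) =
      pi\<^sup>2 * \<bar>real_of_int (l i)\<bar> * real (k j) + pi\<^sup>2 * (\<bar>real_of_int (l i)\<bar> * \<bar>real_of_int (l j)\<bar>)"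
    by (simp only: distrib_left mult.assoc)
  also have "\<dots> \<le> pi * nlen d k * (pi\<^sup>2 * S) + pi\<^sup>2 * S" by (rule add_mono[OF 1 2])
  also have "\<dots> = (1 + pi * nlen d k) * (pi\<^sup>2 * S)"
    by (simp only: distrib_right mult_1_left add.commute)
  also have "\<dots> \<le> (1 + pi * nlen d k) * wt d l"
    using n0 by (intro mult_left_mono add_nonneg_nonneg) (auto simp: wt_def S_def)
  finally show ?thesis by simp
qed

definition bform :: "nat \<Rightarrow> (nat \<Rightarrow> nat \<Rightarrow> (nat \<Rightarrow> real) \<Rightarrow> real) \<Rightarrow> ((nat \<Rightarrow> real) \<Rightarrow> real) \<Rightarrow>
    ((nat \<Rightarrow> real) \<Rightarrow> real) \<Rightarrow> ((nat \<Rightarrow> real) \<Rightarrow> real) \<Rightarrow> real" where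
  "bform d A c u v = (\<Sum>i<d. \<Sum>j<d. l2_inner d (\<lambda>x. A i j x * wderiv d i u x) (wderiv d j v))
     + l2_inner d (\<lambda>x. c x * u x) v"

text \<open>The common features of the two boundary conditions. The set \<open>D\<close> says which factors of the
  trigonometric products in the ansatz space are sines.\<close>

locale boundary_condition =
  fixes d :: nat and D :: "nat set" and V :: "((nat \<Rightarrow> real) \<Rightarrow> real) set"
  assumes d_pos: "0 < d" and V_H1: "v \<in> V \<Longrightarrow> v \<in> H1 d"
    and V_lincomb: "u \<in> V \<Longrightarrow> v \<in> V \<Longrightarrow> (\<lambda>x. u x + c * v x) \<in> V"
    and trig_V: "trig d D k \<in> V"
    and by_parts: "v \<in> V \<Longrightarrow> j < d \<Longrightarrow>
      l2_inner d (trig d (sym_diff D {j}) k) (wderiv d j v) = - l2_inner d (dtrig d (sym_diff D {j}) k j) v"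
begin

sublocale semi_inner V "H1_inner d"
  by standard (auto intro: V_lincomb H1_left H1_sym H1_nonneg V_H1)

lemma nrm_H1: "nrm u = H1_norm d u"
  by (simp add: nrm_def H1_norm_def)

lemma V_L2: "v \<in> V \<Longrightarrow> v \<in> L2 d"
  by (rule H1_L2[OF V_H1])

lemma V_wderiv_L2: "v \<in> V \<Longrightarrow> i < d \<Longrightarrow> wderiv d i v \<in> L2 d"
  by (rule wderiv_L2[OF V_H1])

lemma by_parts':
  assumes "v \<in> V" "j < d"
  shows "l2_inner d (trig d (sym_diff D {j}) k) (wderiv d j v)
    = (if j \<in> D then 1 else -1) * (pi * real_of_int (k j)) * l2_inner d (trig d D k) v"
proof -
  have e: "sym_diff (sym_diff D {j}) {j} = D" by auto
  have "dtrig d (sym_diff D {j}) k j = (\<lambda>x. (- (if j \<in> D then 1 else -1) * (pi * real_of_int (k j))) * trig d D k x)"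
    unfolding dtrig_def[abs_def] e by (cases "j \<in> D") auto
  then have "l2_inner d (dtrig d (sym_diff D {j}) k j) v
      = (- (if j \<in> D then 1 else -1) * (pi * real_of_int (k j))) * l2_inner d (trig d D k) v"
    by (simp add: l2_inner_def mult.assoc del: mult_minus_left)
  then show ?thesis by (simp add: by_parts[OF assms])
qed

lemma dtrig_scale: "l2_inner d (dtrig d D k i) v
    = (if i \<in> D then 1 else -1) * (pi * real_of_int (k i)) * l2_inner d (trig d (sym_diff D {i}) k) v"
  unfolding dtrig_def[abs_def] l2_inner_def mult.assoc by (simp only: integral_mult_right_zero)

lemma H1_inner_trig:
  assumes v: "v \<in> V"
  shows "H1_inner d (trig d D k) v = wt d k * l2_inner d (trig d D k) v"
proof -
  have "H1_inner d (trig d D k) v = (\<Sum>i<d. l2_inner d (dtrig d D k i) (wderiv d i v)) + l2_inner d (trig d D k) v"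
    by (rule C1_H1_inner[OF d_pos trig_C1 V_H1[OF v]])
  also have "(\<Sum>i<d. l2_inner d (dtrig d D k i) (wderiv d i v))
      = (\<Sum>i<d. (pi\<^sup>2 * (real_of_int (k i))\<^sup>2) * l2_inner d (trig d D k) v)"
  proof (rule sum.cong[OF refl])
    fix i assume "i \<in> {..<d}"
    then have i: "i < d" by simp
    show "l2_inner d (dtrig d D k i) (wderiv d i v) = (pi\<^sup>2 * (real_of_int (k i))\<^sup>2) * l2_inner d (trig d D k) v"
      unfolding dtrig_scale by_parts'[OF v i] by (simp add: power2_eq_square)
  qed
  finally show ?thesis
    by (simp add: wt_def distrib_right flip: sum_distrib_right sum_distrib_left)
qed

text \<open>The functional \<open>L\<close> has a Riesz representative of mass at most \<open>X\<close>.\<close>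

definition represented :: "real \<Rightarrow> (((nat \<Rightarrow> real) \<Rightarrow> real) \<Rightarrow> real) \<Rightarrow> bool" where
  "represented X L \<longleftrightarrow> (\<exists>w. combo (trig d D) (wt d) X w \<and> (\<forall>v\<in>V. H1_inner d w v = L v))"

lemma combo_in_V: "combo (trig d D) (wt d) X w \<Longrightarrow> w \<in> V"
  by (rule combo_in[OF _ trig_V])

lemma represented_mono:
  "represented X L \<Longrightarrow> X \<le> Y \<Longrightarrow> (\<And>v. v \<in> V \<Longrightarrow> L v = L' v) \<Longrightarrow> represented Y L'"
  unfolding represented_def using combo_mono by metis

lemma represented_zero: "0 \<le> X \<Longrightarrow> (\<And>v. v \<in> V \<Longrightarrow> L v = 0) \<Longrightarrow> represented X L"
  unfolding represented_def
proof (intro exI conjI ballI)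
  fix v assume v: "v \<in> V"
  have "H1_inner d (\<lambda>x. 0) v = 0" using scale_right[OF v v, of 0] H1_sym by simp
  moreover assume "\<And>v. v \<in> V \<Longrightarrow> L v = 0"
  ultimately show "H1_inner d (\<lambda>x. 0) v = L v" using v by simp
qed (rule combo_zero)

lemma represented_add:
  assumes "represented X L" "represented Y L'"
  shows "represented (X + \<bar>c\<bar> * Y) (\<lambda>v. L v + c * L' v)"
proof -
  obtain w w' where w: "combo (trig d D) (wt d) X w" "\<And>v. v \<in> V \<Longrightarrow> H1_inner d w v = L v"
    and w': "combo (trig d D) (wt d) Y w'" "\<And>v. v \<in> V \<Longrightarrow> H1_inner d w' v = L' v"
    using assms unfolding represented_def by blast
  have "combo (trig d D) (wt d) (X + \<bar>c\<bar> * Y) (\<lambda>x. w x + c * w' x)"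
    by (rule combo_sum2[OF combo_scale[OF w'(1)] w(1)])
  moreover have "H1_inner d (\<lambda>x. w x + c * w' x) v = L v + c * L' v" if "v \<in> V" for v
    using left[OF combo_in_V[OF w(1)] combo_in_V[OF w'(1)] that] w(2) w'(2) that by simp
  ultimately show ?thesis unfolding represented_def by blast
qed

lemma represented_sum:
  assumes "finite I" "\<And>i. i \<in> I \<Longrightarrow> represented (X i) (L i)"
  shows "represented (\<Sum>i\<in>I. \<bar>c i\<bar> * X i) (\<lambda>v. \<Sum>i\<in>I. c i * L i v)"
  using assms
proof (induction I rule: finite_induct)
  case empty
  then show ?case by (auto intro: represented_zero)
next
  case (insert i I)
  have "represented ((\<Sum>i\<in>I. \<bar>c i\<bar> * X i) + \<bar>c i\<bar> * X i) (\<lambda>v. (\<Sum>i\<in>I. c i * L i v) + c i * L i v)"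
    by (rule represented_add) (use insert in auto)
  then show ?case using insert.hyps by (simp add: add.commute)
qed

lemma represented_trig: "represented 1 (l2_inner d (trig d D k))"
  unfolding represented_def
proof (intro exI conjI ballI)
  show "combo (trig d D) (wt d) 1 (\<lambda>x. (1 / wt d k) * trig d D k x)"
    using combo_scale[where a = "1 / wt d k", OF combo_atom[of "trig d D" "wt d" k]] wt_pos[of d k] by simp
  fix v assume v: "v \<in> V"
  have "H1_inner d (\<lambda>x. (1 / wt d k) * trig d D k x) v = (1 / wt d k) * H1_inner d (trig d D k) v"
    using scale_right[where c = "1 / wt d k", OF trig_V v, of k] H1_sym by simp
  then show "H1_inner d (\<lambda>x. (1 / wt d k) * trig d D k x) v = l2_inner d (trig d D k) v"
    using wt_pos[of d k] by (simp add: H1_inner_trig[OF v])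
qed

text \<open>Parities add up: \<open>{i, j}\<close> from the coefficient and \<open>D\<close> with \<open>i\<close> flipped from the derivative of the
  iterate give \<open>D\<close> with \<open>j\<close> flipped, and integration by parts in direction \<open>j\<close> flips \<open>j\<close> back.\<close>

lemma represented_flux:
  assumes "i < d" "j < d"
  shows "represented (pi\<^sup>2 * \<bar>real_of_int (l i)\<bar> * (\<bar>real_of_int (k j)\<bar> + \<bar>real_of_int (l j)\<bar>))
    (\<lambda>v. l2_inner d (\<lambda>x. trig d (sym_diff {i} {j}) k x * dtrig d D l i x) (wderiv d j v))"
proof -
  obtain s n where
    eq: "\<And>x. trig d (sym_diff {i} {j}) k x * trig d (sym_diff D {i}) l x =
      (\<Sum>B\<in>Pow {..<d}. s B * trig d (sym_diff (sym_diff {i} {j}) (sym_diff D {i})) (n B) x)"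
    and s: "(\<Sum>B\<in>Pow {..<d}. \<bar>s B\<bar>) = (1::real)" and n: "\<And>B m. \<bar>n B m\<bar> \<le> \<bar>k m\<bar> + \<bar>l m\<bar>"
    by (rule trig_mult[of d "sym_diff {i} {j}" k "sym_diff D {i}" l]) (rule that; assumption)
  define \<sigma> where "\<sigma> m = (if m \<in> D then 1 else -1 :: real)" for m
  define e where "e = \<sigma> i * (pi * real_of_int (l i))"
  have D: "sym_diff (sym_diff {i} {j}) (sym_diff D {i}) = sym_diff D {j}" by blast
  have prod: "(\<lambda>x. trig d (sym_diff {i} {j}) k x * dtrig d D l i x) =
      (\<lambda>x. \<Sum>B\<in>Pow {..<d}. (e * s B) * trig d (sym_diff D {j}) (n B) x)"
  proof
    fix x
    have "trig d (sym_diff {i} {j}) k x * dtrig d D l i x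
        = e * (trig d (sym_diff {i} {j}) k x * trig d (sym_diff D {i}) l x)"
      by (simp only: dtrig_def e_def \<sigma>_def mult_ac)
    then show "trig d (sym_diff {i} {j}) k x * dtrig d D l i x =
      (\<Sum>B\<in>Pow {..<d}. (e * s B) * trig d (sym_diff D {j}) (n B) x)"
      unfolding eq D by (simp only: sum_distrib_left mult.assoc)
  qed
  let ?c = "\<lambda>B. (e * s B) * (\<sigma> j * (pi * real_of_int (n B j)))"
  have "represented (\<Sum>B\<in>Pow {..<d}. \<bar>?c B\<bar> * 1) (\<lambda>v. \<Sum>B\<in>Pow {..<d}. ?c B * l2_inner d (trig d D (n B)) v)"
    by (rule represented_sum) (auto intro: represented_trig)
  then show ?thesis
  proof (rule represented_mono)
    fix v assume v: "v \<in> V"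
    have "l2_inner d (\<lambda>x. \<Sum>B\<in>Pow {..<d}. (e * s B) * trig d (sym_diff D {j}) (n B) x) (wderiv d j v)
        = (\<Sum>B\<in>Pow {..<d}. (e * s B) * l2_inner d (trig d (sym_diff D {j}) (n B)) (wderiv d j v))"
      by (rule l2_sum_left) (auto intro: trig_L2 V_wderiv_L2[OF v assms(2)])
    also have "\<dots> = (\<Sum>B\<in>Pow {..<d}. ?c B * l2_inner d (trig d D (n B)) v)"
      by (intro sum.cong refl) (simp only: by_parts'[OF v assms(2)] \<sigma>_def mult.assoc)
    finally show "(\<Sum>B\<in>Pow {..<d}. ?c B * l2_inner d (trig d D (n B)) v) =
       l2_inner d (\<lambda>x. trig d (sym_diff {i} {j}) k x * dtrig d D l i x) (wderiv d j v)"
      unfolding prod by simp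
  next
    have \<sigma>: "\<bar>\<sigma> m\<bar> = 1" for m by (simp add: \<sigma>_def)
    have n': "\<bar>real_of_int (n B j)\<bar> \<le> \<bar>real_of_int (k j)\<bar> + \<bar>real_of_int (l j)\<bar>" for B
      using n[of B j] by linarith
    have "(\<Sum>B\<in>Pow {..<d}. \<bar>?c B\<bar> * 1) = (\<Sum>B\<in>Pow {..<d}. \<bar>s B\<bar> * (pi\<^sup>2 * \<bar>real_of_int (l i)\<bar> * \<bar>real_of_int (n B j)\<bar>))"
      by (intro sum.cong refl) (simp add: abs_mult \<sigma> e_def power2_eq_square mult_ac)
    also have "\<dots> \<le> (\<Sum>B\<in>Pow {..<d}. \<bar>s B\<bar> * (pi\<^sup>2 * \<bar>real_of_int (l i)\<bar> * (\<bar>real_of_int (k j)\<bar> + \<bar>real_of_int (l j)\<bar>)))"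
      by (intro sum_mono mult_left_mono n') auto
    also have "\<dots> = pi\<^sup>2 * \<bar>real_of_int (l i)\<bar> * (\<bar>real_of_int (k j)\<bar> + \<bar>real_of_int (l j)\<bar>)"
      using s by (simp flip: sum_distrib_right)
    finally show "(\<Sum>B\<in>Pow {..<d}. \<bar>?c B\<bar> * 1)
      \<le> pi\<^sup>2 * \<bar>real_of_int (l i)\<bar> * (\<bar>real_of_int (k j)\<bar> + \<bar>real_of_int (l j)\<bar>)" .
  qed
qed

lemma represented_product:
  "represented 1 (\<lambda>v. l2_inner d (\<lambda>x. trig d {} k x * trig d D l x) v)"
proof -
  obtain s n where
    eq: "\<And>x. trig d {} k x * trig d D l x = (\<Sum>B\<in>Pow {..<d}. s B * trig d (sym_diff {} D) (n B) x)"
    and s: "(\<Sum>B\<in>Pow {..<d}. \<bar>s B\<bar>) = (1::real)"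
    by (rule trig_mult[of d "{}" k D l]) (rule that; assumption)
  have D: "sym_diff {} D = D" by auto
  have "represented (\<Sum>B\<in>Pow {..<d}. \<bar>s B\<bar> * 1) (\<lambda>v. \<Sum>B\<in>Pow {..<d}. s B * l2_inner d (trig d D (n B)) v)"
    by (rule represented_sum) (auto intro: represented_trig)
  then show ?thesis
  proof (rule represented_mono)
    fix v assume v: "v \<in> V"
    show "(\<Sum>B\<in>Pow {..<d}. s B * l2_inner d (trig d D (n B)) v) = l2_inner d (\<lambda>x. trig d {} k x * trig d D l x) v"
      unfolding eq D by (rule l2_sum_left(2)[symmetric]) (auto intro: trig_L2 V_L2[OF v])
  qed (use s in simp)
qed

end

context boundary_condition
begin

lemma represented_diffusion:
  assumes ij: "i < d" "j < d" and F: "finite F"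
    and Y: "(\<Sum>k\<in>F. \<bar>a k\<bar> * (1 + pi ^ 1 * nlen d k ^ 1)) \<le> Y"
    and u: "combo (trig d D) (wt d) X u"
  shows "represented (Y * X)
    (\<lambda>v. l2_inner d (\<lambda>x. (\<Sum>k\<in>F. a k * trig d (sym_diff {i} {j}) (nfreq k) x) * wderiv d i u x) (wderiv d j v))"
proof -
  define B where "B x = (\<Sum>k\<in>F. a k * trig d (sym_diff {i} {j}) (nfreq k) x)" for x
  have B_cont: "continuous_on (\<Omega> d) B"
    unfolding B_def[abs_def] by (intro continuous_intros trig_continuous)
  have B_meas: "B \<in> borel_measurable (leb d)" by (rule continuous_measurable[OF B_cont])
  have B_bd: "\<bar>B x\<bar> \<le> (\<Sum>k\<in>F. \<bar>a k\<bar>)" for x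
  proof -
    have "\<bar>B x\<bar> \<le> (\<Sum>k\<in>F. \<bar>a k * trig d (sym_diff {i} {j}) (nfreq k) x\<bar>)" unfolding B_def by (rule sum_abs)
    also have "\<dots> \<le> (\<Sum>k\<in>F. \<bar>a k\<bar> * 1)"
      unfolding abs_mult by (intro sum_mono mult_left_mono trig_abs_le) auto
    finally show ?thesis by simp
  qed
  have Y0: "0 \<le> Y"
    by (rule order_trans[OF sum_nonneg Y]) (auto intro!: mult_nonneg_nonneg add_nonneg_nonneg L2_set_nonneg)
  have BL: "(\<lambda>x. B x * h x) \<in> L2 d" if "h \<in> L2 d" for h
    by (rule L2_mult_bounded[OF that B_meas B_bd])
  have atom: "represented (Y * wt d l) (\<lambda>v. l2_inner d (\<lambda>x. B x * dtrig d D l i x) (wderiv d j v))" for l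
  proof -
    have "represented (\<Sum>k\<in>F. \<bar>a k\<bar> * (pi\<^sup>2 * \<bar>real_of_int (l i)\<bar> * (\<bar>real_of_int (nfreq k j)\<bar> + \<bar>real_of_int (l j)\<bar>)))
      (\<lambda>v. \<Sum>k\<in>F. a k * l2_inner d (\<lambda>x. trig d (sym_diff {i} {j}) (nfreq k) x * dtrig d D l i x) (wderiv d j v))"
      by (rule represented_sum[OF F represented_flux[OF ij]])
    then show ?thesis
    proof (rule represented_mono)
      have "(\<Sum>k\<in>F. \<bar>a k\<bar> * (pi\<^sup>2 * \<bar>real_of_int (l i)\<bar> * (\<bar>real_of_int (nfreq k j)\<bar> + \<bar>real_of_int (l j)\<bar>)))
          \<le> (\<Sum>k\<in>F. \<bar>a k\<bar> * ((1 + pi ^ 1 * nlen d k ^ 1) * wt d l))"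
        using frequency_bound[OF ij] by (intro sum_mono mult_left_mono) auto
      also have "\<dots> = (\<Sum>k\<in>F. \<bar>a k\<bar> * (1 + pi ^ 1 * nlen d k ^ 1)) * wt d l"
        by (simp only: sum_distrib_right mult.assoc)
      also have "\<dots> \<le> Y * wt d l" using wt_pos[of d l] by (intro mult_right_mono Y) auto
      finally show "(\<Sum>k\<in>F. \<bar>a k\<bar> * (pi\<^sup>2 * \<bar>real_of_int (l i)\<bar> * (\<bar>real_of_int (nfreq k j)\<bar> + \<bar>real_of_int (l j)\<bar>)))
        \<le> Y * wt d l" .
      fix v assume v: "v \<in> V"
      have "(\<lambda>x. B x * dtrig d D l i x) =
          (\<lambda>x. \<Sum>k\<in>F. a k * (trig d (sym_diff {i} {j}) (nfreq k) x * dtrig d D l i x))"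
        by (simp only: B_def sum_distrib_right mult.assoc)
      moreover have "l2_inner d (\<lambda>x. \<Sum>k\<in>F. a k * (trig d (sym_diff {i} {j}) (nfreq k) x * dtrig d D l i x)) (wderiv d j v)
        = (\<Sum>k\<in>F. a k * l2_inner d (\<lambda>x. trig d (sym_diff {i} {j}) (nfreq k) x * dtrig d D l i x) (wderiv d j v))"
        by (rule l2_sum_left(2)[OF F _ V_wderiv_L2[OF v ij(2)]])
          (rule L2_mult_bounded[OF dtrig_L2 continuous_measurable[OF trig_continuous] trig_abs_le])
      ultimately show "(\<Sum>k\<in>F. a k * l2_inner d (\<lambda>x. trig d (sym_diff {i} {j}) (nfreq k) x * dtrig d D l i x) (wderiv d j v)) =
        l2_inner d (\<lambda>x. B x * dtrig d D l i x) (wderiv d j v)" by simp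
    qed
  qed
  have "represented (Y * X) (\<lambda>v. l2_inner d (\<lambda>x. B x * wderiv d i u x) (wderiv d j v))"
    using u
  proof (induction rule: combo.induct)
    case (combo_zero X)
    have w0: "AE x in leb d. wderiv d i (\<lambda>x. 0) x = 0"
      by (rule C1_H1(2)[OF d_pos _ ij(1), where \<psi>' = "\<lambda>_ _. 0"]) (auto simp: C1_pair_def)
    have z: "(\<lambda>x. 0) \<in> V" by (rule zero_in[OF trig_V])
    have "l2_inner d (\<lambda>x. B x * wderiv d i (\<lambda>x. 0) x) (wderiv d j v) = 0" if v: "v \<in> V" for v
    proof -
      have "l2_inner d (\<lambda>x. B x * wderiv d i (\<lambda>x. 0) x) (wderiv d j v) = l2_inner d (\<lambda>x. 0) (wderiv d j v)"
        using w0 by (intro l2_cong_meas L2_measurable BL V_wderiv_L2 V_L2[OF z] z v ij) (auto elim: eventually_mono)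
      then show ?thesis by (simp add: l2_inner_def)
    qed
    then show ?case using Y0 combo_zero by (intro represented_zero) auto
  next
    case (combo_add X u c l Z)
    have uV: "u \<in> V" by (rule combo_in_V[OF combo_add.hyps(1)])
    have "represented (Y * X + \<bar>c\<bar> * (Y * wt d l)) (\<lambda>v. l2_inner d (\<lambda>x. B x * wderiv d i u x) (wderiv d j v)
        + c * l2_inner d (\<lambda>x. B x * dtrig d D l i x) (wderiv d j v))"
      by (rule represented_add[OF combo_add.IH atom])
    then show ?case
    proof (rule represented_mono)
      show "Y * X + \<bar>c\<bar> * (Y * wt d l) \<le> Y * Z"
        using mult_left_mono[OF combo_add.hyps(2) Y0] by (simp add: distrib_left mult_ac)
      fix v assume v: "v \<in> V"
      note wv = V_wderiv_L2[OF v ij(2)] and wu = V_wderiv_L2[OF uV ij(1)]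
      have "AE x in leb d. wderiv d i (\<lambda>x. u x + c * trig d D l x) x = wderiv d i u x + c * wderiv d i (trig d D l) x"
        by (rule wderiv_lincomb[OF V_H1[OF uV] V_H1[OF trig_V] ij(1)])
      moreover have "AE x in leb d. wderiv d i (trig d D l) x = dtrig d D l i x"
        by (rule C1_H1(2)[OF d_pos trig_C1 ij(1)])
      ultimately have "AE x in leb d. B x * wderiv d i (\<lambda>x. u x + c * trig d D l x) x
          = B x * wderiv d i u x + c * (B x * dtrig d D l i x)"
        by eventually_elim (simp add: distrib_left mult_ac)
      then have "l2_inner d (\<lambda>x. B x * wderiv d i (\<lambda>x. u x + c * trig d D l x) x) (wderiv d j v)
        = l2_inner d (\<lambda>x. B x * wderiv d i u x + c * (B x * dtrig d D l i x)) (wderiv d j v)"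
        by (intro l2_cong_meas L2_measurable BL l2.lincomb wu wv dtrig_L2 V_wderiv_L2 V_lincomb uV trig_V ij)
      also have "\<dots> = l2_inner d (\<lambda>x. B x * wderiv d i u x) (wderiv d j v)
          + c * l2_inner d (\<lambda>x. B x * dtrig d D l i x) (wderiv d j v)"
        by (intro l2_left BL wu wv dtrig_L2)
      finally show "l2_inner d (\<lambda>x. B x * wderiv d i u x) (wderiv d j v)
          + c * l2_inner d (\<lambda>x. B x * dtrig d D l i x) (wderiv d j v)
        = l2_inner d (\<lambda>x. B x * wderiv d i (\<lambda>x. u x + c * trig d D l x) x) (wderiv d j v)" by simp
    qed
  qed
  then show ?thesis unfolding B_def .
qed

lemma represented_reaction:
  assumes F: "finite F"
    and Y: "(\<Sum>k\<in>F. \<bar>a k\<bar> * (1 + pi ^ n * nlen d k ^ n)) \<le> Y"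
    and u: "combo (trig d D) (wt d) X u"
  shows "represented (Y * X) (\<lambda>v. l2_inner d (\<lambda>x. (\<Sum>k\<in>F. a k * trig d {} (nfreq k) x) * u x) v)"
proof -
  have "(\<Sum>k\<in>F. \<bar>a k\<bar> * 1) \<le> (\<Sum>k\<in>F. \<bar>a k\<bar> * (1 + pi ^ n * nlen d k ^ n))"
    by (intro sum_mono mult_left_mono) (auto intro!: mult_nonneg_nonneg L2_set_nonneg zero_le_power)
  then have Y': "(\<Sum>k\<in>F. \<bar>a k\<bar>) \<le> Y" using Y by simp
  then have Y0: "0 \<le> Y" by (rule order_trans[OF sum_nonneg[OF abs_ge_zero]])
  have P: "(\<lambda>x. trig d {} (nfreq k) x * h x) \<in> L2 d" if "h \<in> L2 d" for k h
    by (rule L2_mult_bounded[OF that continuous_measurable[OF trig_continuous] trig_abs_le])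
  have eq: "l2_inner d (\<lambda>x. (\<Sum>k\<in>F. a k * trig d {} (nfreq k) x) * h x) v
      = (\<Sum>k\<in>F. a k * l2_inner d (\<lambda>x. trig d {} (nfreq k) x * h x) v)"
    and inL: "(\<lambda>x. (\<Sum>k\<in>F. a k * trig d {} (nfreq k) x) * h x) \<in> L2 d"
    if "h \<in> L2 d" "v \<in> L2 d" for h v
    using l2_sum_left[where u = "\<lambda>k x. trig d {} (nfreq k) x * h x" and a = a, OF F P[OF that(1)] that(2)]
    by (simp_all only: sum_distrib_right mult.assoc)
  show ?thesis using u
  proof (induction rule: combo.induct)
    case (combo_zero X)
    then show ?case using Y0 by (intro represented_zero) (auto simp: l2_inner_def)
  next
    case (combo_add X u c l Z)
    have uV: "u \<in> V" by (rule combo_in_V[OF combo_add.hyps(1)])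
    have "represented (\<Sum>k\<in>F. \<bar>a k\<bar> * 1) (\<lambda>v. \<Sum>k\<in>F. a k * l2_inner d (\<lambda>x. trig d {} (nfreq k) x * trig d D l x) v)"
      by (rule represented_sum[OF F represented_product])
    then have "represented (Y * X + \<bar>c\<bar> * (\<Sum>k\<in>F. \<bar>a k\<bar> * 1))
        (\<lambda>v. l2_inner d (\<lambda>x. (\<Sum>k\<in>F. a k * trig d {} (nfreq k) x) * u x) v
          + c * (\<Sum>k\<in>F. a k * l2_inner d (\<lambda>x. trig d {} (nfreq k) x * trig d D l x) v))"
      by (rule represented_add[OF combo_add.IH])
    then show ?case
    proof (rule represented_mono)
      have "\<bar>c\<bar> * (\<Sum>k\<in>F. \<bar>a k\<bar> * 1) \<le> \<bar>c\<bar> * (Y * wt d l)"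
        using mult_mono[OF Y' wt_ge_1[of d l] Y0] by (intro mult_left_mono) auto
      then show "Y * X + \<bar>c\<bar> * (\<Sum>k\<in>F. \<bar>a k\<bar> * 1) \<le> Y * Z"
        using mult_left_mono[OF combo_add.hyps(2) Y0] by (simp add: distrib_left mult_ac)
      fix v assume v: "v \<in> V"
      note vL = V_L2[OF v] and uL = V_L2[OF uV]
      have "(\<lambda>x. (\<Sum>k\<in>F. a k * trig d {} (nfreq k) x) * (u x + c * trig d D l x))
        = (\<lambda>x. (\<Sum>k\<in>F. a k * trig d {} (nfreq k) x) * u x + c * ((\<Sum>k\<in>F. a k * trig d {} (nfreq k) x) * trig d D l x))"
        by (simp only: distrib_left mult.left_commute)
      then show "l2_inner d (\<lambda>x. (\<Sum>k\<in>F. a k * trig d {} (nfreq k) x) * u x) v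
          + c * (\<Sum>k\<in>F. a k * l2_inner d (\<lambda>x. trig d {} (nfreq k) x * trig d D l x) v)
        = l2_inner d (\<lambda>x. (\<Sum>k\<in>F. a k * trig d {} (nfreq k) x) * (u x + c * trig d D l x)) v"
        using l2_left[where c = c, OF inL[OF uL vL] inL[OF trig_L2[of d D l] vL] vL] eq[OF trig_L2[of d D l] vL]
        by simp
    qed
  qed
qed

text \<open>The weight of the Barron norm of order \<open>0\<close> is \<open>2\<close>, whence the factor \<open>1 / 2\<close>.\<close>

lemma represented_source:
  assumes F: "finite F" and Y: "(\<Sum>k\<in>F. \<bar>a k\<bar> * (1 + pi ^ 0 * nlen d k ^ 0)) \<le> Y"
  shows "represented (Y / 2) (\<lambda>v. l2_inner d (\<lambda>x. \<Sum>k\<in>F. a k * trig d D (nfreq k) x) v)"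
proof -
  have "represented (\<Sum>k\<in>F. \<bar>a k\<bar> * 1) (\<lambda>v. \<Sum>k\<in>F. a k * l2_inner d (trig d D (nfreq k)) v)"
    by (rule represented_sum[OF F represented_trig])
  then show ?thesis
  proof (rule represented_mono)
    show "(\<Sum>k\<in>F. \<bar>a k\<bar> * 1) \<le> Y / 2" using Y by (simp flip: sum_distrib_right)
    fix v assume v: "v \<in> V"
    show "(\<Sum>k\<in>F. a k * l2_inner d (trig d D (nfreq k)) v) = l2_inner d (\<lambda>x. \<Sum>k\<in>F. a k * trig d D (nfreq k) x) v"
      by (rule l2_sum_left(2)[OF F trig_L2 V_L2[OF v], symmetric])
  qed
qed

lemma l2_perturbation:
  assumes g: "g \<in> L2 d" and h: "h \<in> L2 d" and q: "q \<in> borel_measurable (leb d)"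
    and bd: "\<And>x. x \<in> \<Omega> d \<Longrightarrow> \<bar>q x\<bar> \<le> B" and v: "v \<in> L2 d" and B: "0 \<le> B"
  shows "\<bar>l2_inner d (\<lambda>x. g x * q x) v - l2_inner d (\<lambda>x. h x * q x) v\<bar>
    \<le> B * l2.nrm d (\<lambda>x. g x - h x) * l2.nrm d v"
proof -
  have L: "(\<lambda>x. g x * q x) \<in> L2 d" "(\<lambda>x. h x * q x) \<in> L2 d"
    using L2_mult_bounded[OF g q bd] L2_mult_bounded[OF h q bd] by (simp_all add: mult.commute)
  have w: "(\<lambda>x. g x - h x) \<in> L2 d" using l2.lincomb[OF g h, of "-1"] by simp
  have wq: "(\<lambda>x. q x * (g x - h x)) \<in> L2 d" by (rule L2_mult_bounded[OF w q bd])
  have "l2_inner d (\<lambda>x. g x * q x) v - l2_inner d (\<lambda>x. h x * q x) v = l2_inner d (\<lambda>x. q x * (g x - h x)) v"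
    using l2_left[OF L v, of "-1"] by (simp add: algebra_simps)
  also have "\<bar>\<dots>\<bar> \<le> l2.nrm d (\<lambda>x. q x * (g x - h x)) * l2.nrm d v"
    by (rule l2.cauchy_schwarz[OF wq v])
  also have "\<dots> \<le> (B * l2.nrm d (\<lambda>x. g x - h x)) * l2.nrm d v"
  proof (rule mult_right_mono[OF _ l2.nrm_nonneg[OF v]])
    have "l2_inner d (\<lambda>x. q x * (g x - h x)) (\<lambda>x. q x * (g x - h x)) \<le> (\<integral>x. B\<^sup>2 * ((g x - h x) * (g x - h x)) \<partial>leb d)"
      unfolding l2_inner_def
    proof (rule integral_mono)
      show "integrable (leb d) (\<lambda>x. q x * (g x - h x) * (q x * (g x - h x)))" by (rule L2_mult_integrable[OF wq wq])
      show "integrable (leb d) (\<lambda>x. B\<^sup>2 * ((g x - h x) * (g x - h x)))"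
        using L2_mult_integrable[OF w w] by simp
      fix x assume "x \<in> space (leb d)"
      then have "(q x)\<^sup>2 \<le> B\<^sup>2" using power_mono[OF bd[of x] abs_ge_zero, of 2] by simp
      then have "(q x)\<^sup>2 * ((g x - h x) * (g x - h x)) \<le> B\<^sup>2 * ((g x - h x) * (g x - h x))"
        by (intro mult_right_mono) auto
      then show "q x * (g x - h x) * (q x * (g x - h x)) \<le> B\<^sup>2 * ((g x - h x) * (g x - h x))"
        by (simp add: power2_eq_square mult_ac)
    qed
    also have "\<dots> = (B * l2.nrm d (\<lambda>x. g x - h x))\<^sup>2"
      by (simp add: power_mult_distrib l2.nrm_sq[OF w] l2_inner_def)
    finally have "l2.nrm d (\<lambda>x. q x * (g x - h x)) \<le> sqrt ((B * l2.nrm d (\<lambda>x. g x - h x))\<^sup>2)"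
      unfolding l2.nrm_def[of d "\<lambda>x. q x * (g x - h x)"] by (rule real_sqrt_le_mono)
    then show "l2.nrm d (\<lambda>x. q x * (g x - h x)) \<le> B * l2.nrm d (\<lambda>x. g x - h x)"
      using B l2.nrm_nonneg[OF w] by (simp add: real_sqrt_abs abs_mult)
  qed
  finally show ?thesis .
qed

end

context boundary_condition
begin

text \<open>Truncation keeps the bounds on the coefficient sums, and its error is controlled because the iterate and its derivatives are bounded functions.\<close>

lemma represented_residual:
  assumes A: "\<And>i j. i < d \<Longrightarrow> j < d \<Longrightarrow> approximable d (sym_diff {i} {j}) 1 lA (A i j)"
    and c: "approximable d {} 2 lc c" and f: "approximable d D 0 lf f"
    and u: "combo (trig d D) (wt d) X u" and \<delta>: "0 < \<delta>"
  shows "\<exists>w. combo (trig d D) (wt d) (X * (lA * (real d)\<^sup>2 + lc) + lf / 2) w \<and>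
    (\<forall>v\<in>V. \<bar>H1_inner d w v - (bform d A c u v - l2_inner d f v)\<bar> \<le> \<delta> * nrm v)"
proof -
  obtain du where du: "\<And>i. i < d \<Longrightarrow> C1_pair d i u (du i)" using combo_trig_C1[OF u] by blast
  have "\<exists>b. \<forall>x\<in>\<Omega> d. \<bar>u x\<bar> \<le> b \<and> \<bar>du i x\<bar> \<le> b" if "i < d" for i
    using du[OF that] by (simp add: C1_pair_def)
  then obtain b where b: "\<And>i x. i < d \<Longrightarrow> x \<in> \<Omega> d \<Longrightarrow> \<bar>u x\<bar> \<le> b i \<and> \<bar>du i x\<bar> \<le> b i" by metis
  define B where "B = (\<Sum>i<d. \<bar>b i\<bar>)"
  have bB: "b i \<le> B" if "i < d" for i
  proof -
    have "\<bar>b i\<bar> \<le> B" unfolding B_def using that by (intro member_le_sum) auto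
    then show ?thesis by linarith
  qed
  have B0: "0 \<le> B" unfolding B_def by (intro sum_nonneg) auto
  have uB: "\<bar>u x\<bar> \<le> B" if "x \<in> \<Omega> d" for x using b[OF d_pos that] bB[OF d_pos] by linarith
  have duB: "\<bar>du i x\<bar> \<le> B" if "i < d" "x \<in> \<Omega> d" for i x using b[OF that] bB[OF that(1)] by linarith
  have uV: "u \<in> V" by (rule combo_in_V[OF u])
  \<comment> \<open>The error consists of \<open>d\<^sup>2\<close> terms from \<open>A\<close>, one from \<open>c\<close> and one from \<open>f\<close>, each at most \<open>(B + 1) \<eta>\<close>.\<close>
  define \<eta> where "\<eta> = \<delta> / ((B + 1) * ((real d)\<^sup>2 + 2))"
  have den: "0 < (B + 1) * ((real d)\<^sup>2 + 2)" using B0 by (intro mult_pos_pos add_nonneg_pos) auto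
  have \<eta>: "0 < \<eta>" unfolding \<eta>_def using \<delta> den by (rule divide_pos_pos)
  define Q where "Q i j F a \<longleftrightarrow> finite F \<and> (\<Sum>k\<in>F. \<bar>a k\<bar> * (1 + pi ^ 1 * nlen d k ^ 1)) \<le> lA \<and>
      l2.nrm d (\<lambda>x. A i j x - (\<Sum>k\<in>F. a k * trig d (sym_diff {i} {j}) (nfreq k) x)) \<le> \<eta>"
    for i j F a
  have "\<exists>F a. Q i j F a" if "i < d \<and> j < d" for i j
    using A[of i j] that \<eta> unfolding approximable_def Q_def by blast
  then obtain FA aA where "\<And>i j. i < d \<and> j < d \<Longrightarrow> Q i j (FA i j) (aA i j)" by metis
  note FA = this[unfolded Q_def]
  obtain Fc ac where Fc: "finite Fc" "(\<Sum>k\<in>Fc. \<bar>ac k\<bar> * (1 + pi ^ 2 * nlen d k ^ 2)) \<le> lc"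
      "l2.nrm d (\<lambda>x. c x - (\<Sum>k\<in>Fc. ac k * trig d {} (nfreq k) x)) \<le> \<eta>"
    using c \<eta> unfolding approximable_def by blast
  obtain Ff af where Ff: "finite Ff" "(\<Sum>k\<in>Ff. \<bar>af k\<bar> * (1 + pi ^ 0 * nlen d k ^ 0)) \<le> lf"
      "l2.nrm d (\<lambda>x. f x - (\<Sum>k\<in>Ff. af k * trig d D (nfreq k) x)) \<le> \<eta>"
    using f \<eta> unfolding approximable_def by blast
  define A' where "A' i j x = (\<Sum>k\<in>FA i j. aA i j k * trig d (sym_diff {i} {j}) (nfreq k) x)" for i j x
  define c' where "c' x = (\<Sum>k\<in>Fc. ac k * trig d {} (nfreq k) x)" for x
  define f' where "f' x = (\<Sum>k\<in>Ff. af k * trig d D (nfreq k) x)" for x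
  have L': "A' i j \<in> L2 d" if "i < d" "j < d" for i j
    unfolding A'_def[abs_def] using FA that by (intro l2_sum_left(1)[OF _ trig_L2 V_L2[OF uV]]) auto
  have L'': "c' \<in> L2 d" "f' \<in> L2 d" unfolding c'_def[abs_def] f'_def[abs_def]
    by (intro l2_sum_left(1)[OF _ trig_L2 V_L2[OF uV]] Fc(1) Ff(1))+
  let ?I = "{..<d} \<times> {..<d}"
  let ?T = "\<lambda>p v. l2_inner d (\<lambda>x. A' (fst p) (snd p) x * wderiv d (fst p) u x) (wderiv d (snd p) v)"
  have rA: "represented (\<Sum>p\<in>?I. \<bar>1\<bar> * (lA * X)) (\<lambda>v. \<Sum>p\<in>?I. 1 * ?T p v)"
  proof (rule represented_sum)
    fix p assume "p \<in> ?I"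
    then have p: "fst p < d" "snd p < d" by auto
    show "represented (lA * X) (?T p)" unfolding A'_def
      using FA[of "fst p" "snd p"] p by (intro represented_diffusion[OF p _ _ u]) auto
  qed simp
  have rc: "represented (lc * X) (\<lambda>v. l2_inner d (\<lambda>x. c' x * u x) v)"
    unfolding c'_def by (rule represented_reaction[OF Fc(1,2) u])
  have rf: "represented (lf / 2) (\<lambda>v. l2_inner d f' v)"
    unfolding f'_def[abs_def] by (rule represented_source[OF Ff(1,2)])
  let ?L = "\<lambda>v. ((\<Sum>p\<in>?I. 1 * ?T p v) + 1 * l2_inner d (\<lambda>x. c' x * u x) v) + (-1) * l2_inner d f' v"
  have "represented (((\<Sum>p\<in>?I. \<bar>1\<bar> * (lA * X)) + \<bar>1\<bar> * (lc * X)) + \<bar>-1\<bar> * (lf / 2)) ?L"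
    by (rule represented_add[OF represented_add[OF rA rc] rf])
  then have "represented (X * (lA * (real d)\<^sup>2 + lc) + lf / 2) ?L"
    by (rule represented_mono) (simp_all add: algebra_simps power2_eq_square)
  then obtain w where w: "combo (trig d D) (wt d) (X * (lA * (real d)\<^sup>2 + lc) + lf / 2) w"
    and wL: "\<And>v. v \<in> V \<Longrightarrow> H1_inner d w v = ?L v" unfolding represented_def by blast
  have "\<bar>H1_inner d w v - (bform d A c u v - l2_inner d f v)\<bar> \<le> \<delta> * nrm v" if v: "v \<in> V" for v
  proof -
    have n0: "0 \<le> nrm v" by (rule nrm_nonneg[OF v])
    let ?S = "\<lambda>p. l2_inner d (\<lambda>x. A (fst p) (snd p) x * wderiv d (fst p) u x) (wderiv d (snd p) v)"
    have eA: "\<bar>?T p v - ?S p\<bar> \<le> B * \<eta> * nrm v" if pI: "p \<in> ?I" for p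
    proof -
      obtain i j where p: "p = (i, j)" "i < d" "j < d" using pI by auto
      have AL: "A i j \<in> L2 d" using A[OF p(2,3)] by (simp add: approximable_def)
      have dm: "du i \<in> borel_measurable (leb d)"
        using du[OF p(2)] by (auto simp: C1_pair_def intro: continuous_measurable)
      have ae: "AE x in leb d. wderiv d i u x = du i x" by (rule C1_H1(2)[OF d_pos du p(2)])
      have cg: "l2_inner d (\<lambda>x. g x * wderiv d i u x) (wderiv d j v) = l2_inner d (\<lambda>x. g x * du i x) (wderiv d j v)"
        if "g \<in> L2 d" for g
        using ae by (intro l2_cong_meas borel_measurable_times L2_measurable[OF that] dm
            L2_measurable[OF V_wderiv_L2] uV v p) (auto elim: eventually_mono)
      have "\<bar>?T p v - ?S p\<bar> = \<bar>?S p - ?T p v\<bar>" by (rule abs_minus_commute)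
      also have "\<dots> = \<bar>l2_inner d (\<lambda>x. A i j x * du i x) (wderiv d j v) - l2_inner d (\<lambda>x. A' i j x * du i x) (wderiv d j v)\<bar>"
        using cg[OF AL] cg[OF L'[OF p(2,3)]] by (simp add: p(1))
      also have "\<dots> \<le> B * l2.nrm d (\<lambda>x. A i j x - A' i j x) * l2.nrm d (wderiv d j v)"
        by (rule l2_perturbation[OF AL L'[OF p(2,3)] dm duB[OF p(2)] V_wderiv_L2[OF v p(3)] B0])
      also have "\<dots> \<le> B * \<eta> * nrm v"
        unfolding nrm_H1 using FA[of i j] p B0 \<eta> wderiv_norm_le[OF V_H1[OF v] p(3)]
        by (intro mult_mono mult_left_mono) (auto simp: A'_def intro: l2.nrm_nonneg V_wderiv_L2[OF v])
      finally show ?thesis .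
    qed
    have l2v: "l2.nrm d v \<le> nrm v" unfolding nrm_H1 by (rule l2_norm_le_H1[OF V_H1[OF v]])
    have cL: "c \<in> L2 d" and fL: "f \<in> L2 d" using c f by (auto simp: approximable_def)
    have "\<bar>l2_inner d (\<lambda>x. c' x * u x) v - l2_inner d (\<lambda>x. c x * u x) v\<bar>
        = \<bar>l2_inner d (\<lambda>x. c x * u x) v - l2_inner d (\<lambda>x. c' x * u x) v\<bar>" by (rule abs_minus_commute)
    also have "\<dots> \<le> B * l2.nrm d (\<lambda>x. c x - c' x) * l2.nrm d v"
      by (rule l2_perturbation[OF cL L''(1) L2_measurable[OF V_L2[OF uV]] uB V_L2[OF v] B0])
    also have "\<dots> \<le> B * \<eta> * nrm v"
      using Fc(3) B0 \<eta> l2v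
      by (intro mult_mono mult_left_mono) (auto simp: c'_def intro: l2.nrm_nonneg V_L2[OF v])
    finally have ec: "\<bar>l2_inner d (\<lambda>x. c' x * u x) v - l2_inner d (\<lambda>x. c x * u x) v\<bar> \<le> B * \<eta> * nrm v" .
    have "\<bar>l2_inner d f v - l2_inner d f' v\<bar> = \<bar>l2_inner d (\<lambda>x. f x * 1) v - l2_inner d (\<lambda>x. f' x * 1) v\<bar>" by simp
    also have "\<dots> \<le> 1 * l2.nrm d (\<lambda>x. f x - f' x) * l2.nrm d v"
      by (rule l2_perturbation[OF fL L''(2) _ _ V_L2[OF v]]) auto
    also have "\<dots> \<le> 1 * \<eta> * nrm v"
      using Ff(3) \<eta> l2v
      by (intro mult_mono mult_left_mono) (auto simp: f'_def intro: l2.nrm_nonneg V_L2[OF v])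
    finally have ef: "\<bar>l2_inner d f v - l2_inner d f' v\<bar> \<le> 1 * \<eta> * nrm v" .
    have bf: "bform d A c u v = (\<Sum>p\<in>?I. ?S p) + l2_inner d (\<lambda>x. c x * u x) v"
      unfolding bform_def by (simp add: sum.cartesian_product case_prod_unfold)
    have "\<bar>(\<Sum>p\<in>?I. 1 * ?T p v) - (\<Sum>p\<in>?I. ?S p)\<bar> = \<bar>\<Sum>p\<in>?I. ?T p v - ?S p\<bar>" by (simp add: sum_subtractf)
    also have "\<dots> \<le> (\<Sum>p\<in>?I. \<bar>?T p v - ?S p\<bar>)" by (rule sum_abs)
    also have "\<dots> \<le> (\<Sum>p\<in>?I. B * \<eta> * nrm v)" by (rule sum_mono[OF eA])
    also have "\<dots> = (real d)\<^sup>2 * (B * \<eta> * nrm v)" by (simp add: power2_eq_square)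
    finally have eS: "\<bar>(\<Sum>p\<in>?I. 1 * ?T p v) - (\<Sum>p\<in>?I. ?S p)\<bar> \<le> (real d)\<^sup>2 * (B * \<eta> * nrm v)" .
    have "\<bar>H1_inner d w v - (bform d A c u v - l2_inner d f v)\<bar>
        \<le> (real d)\<^sup>2 * (B * \<eta> * nrm v) + B * \<eta> * nrm v + 1 * \<eta> * nrm v"
      unfolding wL[OF v] bf using eS ec ef by linarith
    also have "\<dots> = ((real d)\<^sup>2 * B + B + 1) * (\<eta> * nrm v)" by (simp add: algebra_simps)
    also have "\<dots> \<le> ((B + 1) * ((real d)\<^sup>2 + 2)) * (\<eta> * nrm v)"
      using B0 \<eta> n0 by (intro mult_right_mono) (auto simp: algebra_simps)
    also have "\<dots> = \<delta> * nrm v"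
    proof -
      have "((B + 1) * ((real d)\<^sup>2 + 2)) * \<eta> = \<delta>"
        unfolding \<eta>_def times_divide_eq_right
        by (rule nonzero_mult_div_cancel_left) (use den in linarith)
      then show ?thesis by (simp only: mult.assoc[symmetric])
    qed
    finally show ?thesis .
  qed
  with w show ?thesis by blast
qed

end

context semi_inner
begin

text \<open>For \<open>\<delta> = 0\<close> this is \<open>|e - \<alpha> w|\<^sup>2 = |e|\<^sup>2 - 2 \<alpha> a(e) + \<alpha>\<^sup>2 |w|\<^sup>2\<close> with \<open>|w| \<le> \<Lambda> |e|\<close>, and \<open>\<alpha> = \<mu> / \<Lambda>\<^sup>2\<close> minimises
  \<open>1 - 2 \<alpha> \<mu> + \<alpha>\<^sup>2 \<Lambda>\<^sup>2\<close>. The perturbation adds at most \<open>\<delta> K\<close>.\<close>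

lemma contraction_step:
  assumes e: "e \<in> V" and bd: "\<And>v. v \<in> V \<Longrightarrow> \<bar>a v\<bar> \<le> \<Lambda> * nrm e * nrm v"
    and co: "\<mu> * (nrm e)\<^sup>2 \<le> a e" and l: "0 < \<mu>" "\<mu> \<le> \<Lambda>" and \<eta>: "0 < \<eta>"
  shows "\<exists>\<delta>>0. \<forall>w\<in>V. (\<forall>v\<in>V. \<bar>ip w v - a v\<bar> \<le> \<delta> * nrm v) \<longrightarrow>
    nrm (\<lambda>x. e x + (- (\<mu> / \<Lambda>\<^sup>2)) * w x) \<le> sqrt (1 - \<mu>\<^sup>2 / \<Lambda>\<^sup>2) * nrm e + \<eta>"
proof -
  define E where "E = nrm e"
  define \<alpha> where "\<alpha> = \<mu> / \<Lambda>\<^sup>2"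
  define \<beta> where "\<beta> = sqrt (1 - \<mu>\<^sup>2 / \<Lambda>\<^sup>2)"
  define K where "K = 2 * \<alpha> * E + 2 * \<alpha>\<^sup>2 * \<Lambda> * E + \<alpha>\<^sup>2"
  define \<delta> where "\<delta> = min 1 (\<eta>\<^sup>2 / (K + 1))"
  have \<Lambda>: "0 < \<Lambda>" using l by linarith
  have E0: "0 \<le> E" unfolding E_def by (rule nrm_nonneg[OF e])
  have \<alpha>0: "0 \<le> \<alpha>" unfolding \<alpha>_def using l \<Lambda> by simp
  have "\<mu>\<^sup>2 \<le> \<Lambda>\<^sup>2" using l by (intro power_mono) auto
  then have "0 \<le> 1 - \<mu>\<^sup>2 / \<Lambda>\<^sup>2" using \<Lambda> by (simp add: divide_le_eq)
  then have \<beta>2: "\<beta>\<^sup>2 = 1 - \<mu>\<^sup>2 / \<Lambda>\<^sup>2" and \<beta>0: "0 \<le> \<beta>" unfolding \<beta>_def by auto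
  have K0: "0 \<le> K" unfolding K_def using E0 \<alpha>0 \<Lambda> by simp
  have \<delta>0: "0 < \<delta>" and \<delta>1: "\<delta> \<le> 1" and \<delta>K: "\<delta> * K \<le> \<eta>\<^sup>2"
  proof -
    show "0 < \<delta>" "\<delta> \<le> 1" unfolding \<delta>_def using \<eta> K0 by auto
    have "\<delta> * K \<le> \<eta>\<^sup>2 / (K + 1) * K" unfolding \<delta>_def using K0 by (intro mult_right_mono) auto
    also have "\<dots> = \<eta>\<^sup>2 * (K / (K + 1))" by simp
    also have "\<dots> \<le> \<eta>\<^sup>2 * 1" using K0 by (intro mult_left_mono) auto
    finally show "\<delta> * K \<le> \<eta>\<^sup>2" by simp
  qed
  show ?thesis
  proof (intro exI[of _ \<delta>] conjI ballI impI \<delta>0)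
    fix w assume w: "w \<in> V" and "\<forall>v\<in>V. \<bar>ip w v - a v\<bar> \<le> \<delta> * nrm v"
    then have R: "\<bar>ip w v - a v\<bar> \<le> \<delta> * nrm v" if "v \<in> V" for v using that by blast
    define W where "W = nrm w"
    have W0: "0 \<le> W" unfolding W_def by (rule nrm_nonneg[OF w])
    have "W\<^sup>2 \<le> (\<Lambda> * E + \<delta>) * W"
      using R[OF w] bd[OF w] nrm_sq[OF w] unfolding W_def E_def distrib_right by linarith
    then have WE: "W \<le> \<Lambda> * E + \<delta>"
      using W0 by (cases "W = 0") (auto simp: power2_eq_square E0 \<delta>0 \<Lambda> less_imp_le intro!: add_nonneg_nonneg mult_nonneg_nonneg)
    have we: "\<mu> * E\<^sup>2 - \<delta> * E \<le> ip e w"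
      using R[OF e] co sym[OF e w] unfolding E_def by linarith
    have "ip (\<lambda>x. e x + (- \<alpha>) * w x) (\<lambda>x. e x + (- \<alpha>) * w x) = E\<^sup>2 - 2 * \<alpha> * ip e w + \<alpha>\<^sup>2 * W\<^sup>2"
      using square_lincomb[OF e w, of "- \<alpha>"] by (simp add: E_def W_def nrm_sq e w)
    also have "\<dots> \<le> E\<^sup>2 - 2 * \<alpha> * (\<mu> * E\<^sup>2 - \<delta> * E) + \<alpha>\<^sup>2 * (\<Lambda> * E + \<delta>)\<^sup>2"
    proof -
      have "2 * \<alpha> * (\<mu> * E\<^sup>2 - \<delta> * E) \<le> 2 * \<alpha> * ip e w" using we \<alpha>0 by (intro mult_left_mono) auto
      moreover have "\<alpha>\<^sup>2 * W\<^sup>2 \<le> \<alpha>\<^sup>2 * (\<Lambda> * E + \<delta>)\<^sup>2" using WE W0 by (intro mult_left_mono power_mono) auto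
      ultimately show ?thesis by linarith
    qed
    also have "\<dots> = (1 - 2 * \<alpha> * \<mu> + \<alpha>\<^sup>2 * \<Lambda>\<^sup>2) * E\<^sup>2 + \<delta> * (2 * \<alpha> * E + 2 * \<alpha>\<^sup>2 * \<Lambda> * E + \<alpha>\<^sup>2 * \<delta>)"
      by (simp add: algebra_simps power2_eq_square)
    also have "1 - 2 * \<alpha> * \<mu> + \<alpha>\<^sup>2 * \<Lambda>\<^sup>2 = \<beta>\<^sup>2"
      unfolding \<beta>2 \<alpha>_def using \<Lambda> by (simp add: field_simps power2_eq_square)
    also have "\<beta>\<^sup>2 * E\<^sup>2 + \<delta> * (2 * \<alpha> * E + 2 * \<alpha>\<^sup>2 * \<Lambda> * E + \<alpha>\<^sup>2 * \<delta>) \<le> \<beta>\<^sup>2 * E\<^sup>2 + \<eta>\<^sup>2"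
    proof -
      have "\<alpha>\<^sup>2 * \<delta> \<le> \<alpha>\<^sup>2 * 1" using \<delta>1 by (intro mult_left_mono) auto
      then have "\<delta> * (2 * \<alpha> * E + 2 * \<alpha>\<^sup>2 * \<Lambda> * E + \<alpha>\<^sup>2 * \<delta>) \<le> \<delta> * K"
        unfolding K_def using \<delta>0 by (intro mult_left_mono) auto
      with \<delta>K show ?thesis by linarith
    qed
    also have "\<dots> \<le> (\<beta> * E + \<eta>)\<^sup>2"
      using \<beta>0 E0 \<eta> by (simp add: power2_sum power_mult_distrib)
    finally have "nrm (\<lambda>x. e x + (- \<alpha>) * w x) \<le> sqrt ((\<beta> * E + \<eta>)\<^sup>2)"
      unfolding nrm_def[of "\<lambda>x. e x + (- \<alpha>) * w x"] by (rule real_sqrt_le_mono)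
    also have "\<dots> = \<beta> * E + \<eta>" unfolding real_sqrt_abs using \<beta>0 E0 \<eta> by simp
    finally show "nrm (\<lambda>x. e x + (- (\<mu> / \<Lambda>\<^sup>2)) * w x) \<le> sqrt (1 - \<mu>\<^sup>2 / \<Lambda>\<^sup>2) * nrm e + \<eta>"
      unfolding \<alpha>_def \<beta>_def E_def .
  qed
qed

end

context boundary_condition
begin

text \<open>The gradient iteration for the energy functional in the \<open>H\<^sup>1\<close> inner product. The coefficients
  are truncated anew in every step, so that all iterates are finite sums.\<close>

lemma iteration:
  assumes A: "\<And>i j. i < d \<Longrightarrow> j < d \<Longrightarrow> approximable d (sym_diff {i} {j}) 1 lA (A i j)"
    and c: "approximable d {} 2 lc c" and f: "approximable d D 0 lf f"
    and left: "\<And>u v w. u \<in> V \<Longrightarrow> v \<in> V \<Longrightarrow> w \<in> V \<Longrightarrow>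
      bform d A c (\<lambda>x. u x + (-1) * v x) w = bform d A c u w - bform d A c v w"
    and bd: "\<And>u v. u \<in> V \<Longrightarrow> v \<in> V \<Longrightarrow> \<bar>bform d A c u v\<bar> \<le> \<Lambda> * nrm u * nrm v"
    and co: "\<And>u. u \<in> V \<Longrightarrow> \<mu> * (nrm u)\<^sup>2 \<le> bform d A c u u"
    and l: "0 < \<mu>" "\<mu> \<le> \<Lambda>"
    and u: "u \<in> V" "\<And>v. v \<in> V \<Longrightarrow> bform d A c u v = l2_inner d f v" and \<eta>: "0 < \<eta>"
  shows "\<exists>u'. combo (trig d D) (wt d)
      (\<Sum>t<T. (1 + \<mu> / \<Lambda>\<^sup>2 * (lA * (real d)\<^sup>2 + lc)) ^ t * (\<mu> / \<Lambda>\<^sup>2 * (lf / 2))) u' \<and>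
    nrm (\<lambda>x. u' x + (-1) * u x) \<le> sqrt (1 - \<mu>\<^sup>2 / \<Lambda>\<^sup>2) ^ T * nrm u + \<eta>"
  using \<eta>
proof (induction T arbitrary: \<eta>)
  case 0
  have "nrm (\<lambda>x. 0 + (-1) * u x) \<le> nrm (\<lambda>x. 0) + \<bar>-1\<bar> * nrm u"
    by (rule triangle[OF zero_in[OF u(1)] u(1)])
  moreover have "nrm (\<lambda>x. 0) = 0" using scale_right[OF u(1) zero_in[OF u(1)], of 0] by (simp add: nrm_def)
  ultimately show ?case using 0 by (intro exI[of _ "\<lambda>x. 0"]) (auto intro: combo_zero)
next
  case (Suc T)
  let ?p = "1 + \<mu> / \<Lambda>\<^sup>2 * (lA * (real d)\<^sup>2 + lc)" and ?q = "\<mu> / \<Lambda>\<^sup>2 * (lf / 2)"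
  let ?\<beta> = "sqrt (1 - \<mu>\<^sup>2 / \<Lambda>\<^sup>2)" and ?X = "\<lambda>T. \<Sum>t<T. ?p ^ t * ?q"
  obtain u' where u': "combo (trig d D) (wt d) (?X T) u'"
    and le: "nrm (\<lambda>x. u' x + (-1) * u x) \<le> ?\<beta> ^ T * nrm u + \<eta> / 2"
    using Suc.IH[of "\<eta> / 2"] Suc.prems by auto
  have u'V: "u' \<in> V" by (rule combo_in_V[OF u'])
  define e where "e x = u' x + (-1) * u x" for x
  have eV: "e \<in> V" unfolding e_def[abs_def] by (rule V_lincomb[OF u'V u(1)])
  have "\<eta> / 2 > 0" using Suc.prems by simp
  from contraction_step[OF eV bd[OF eV] co[OF eV] l this] obtain \<delta> where \<delta>: "\<delta> > 0" and
    step: "\<And>w. w \<in> V \<Longrightarrow> (\<forall>v\<in>V. \<bar>H1_inner d w v - bform d A c e v\<bar> \<le> \<delta> * nrm v) \<Longrightarrow>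
      nrm (\<lambda>x. e x + (- (\<mu> / \<Lambda>\<^sup>2)) * w x) \<le> ?\<beta> * nrm e + \<eta> / 2" by blast
  from represented_residual[OF A c f u' \<delta>] obtain w where
    w: "combo (trig d D) (wt d) (?X T * (lA * (real d)\<^sup>2 + lc) + lf / 2) w"
    and R: "\<And>v. v \<in> V \<Longrightarrow> \<bar>H1_inner d w v - (bform d A c u' v - l2_inner d f v)\<bar> \<le> \<delta> * nrm v" by blast
  have "bform d A c e v = bform d A c u' v - l2_inner d f v" if "v \<in> V" for v
    unfolding e_def[abs_def] using left[OF u'V u(1) that] u(2)[OF that] by simp
  then have "nrm (\<lambda>x. e x + (- (\<mu> / \<Lambda>\<^sup>2)) * w x) \<le> ?\<beta> * nrm e + \<eta> / 2"
    using R by (intro step[OF combo_in_V[OF w]]) simp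
  also have "\<dots> \<le> ?\<beta> * (?\<beta> ^ T * nrm u + \<eta> / 2) + \<eta> / 2"
  proof -
    have "\<mu>\<^sup>2 \<le> \<Lambda>\<^sup>2" using l by (intro power_mono) auto
    then have "0 \<le> ?\<beta>" using l by (simp add: divide_le_eq)
    then show ?thesis using le unfolding e_def[abs_def] by (intro add_right_mono mult_left_mono) auto
  qed
  also have "\<dots> \<le> ?\<beta> ^ Suc T * nrm u + \<eta>"
  proof -
    have "?\<beta> \<le> 1" by simp
    then have "?\<beta> * (\<eta> / 2) \<le> 1 * (\<eta> / 2)" using Suc.prems by (intro mult_right_mono) auto
    then show ?thesis by (simp add: distrib_left mult.assoc)
  qed
  finally have fin: "nrm (\<lambda>x. (u' x + (- (\<mu> / \<Lambda>\<^sup>2)) * w x) + (-1) * u x) \<le> ?\<beta> ^ Suc T * nrm u + \<eta>"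
    by (simp add: e_def algebra_simps)
  have "combo (trig d D) (wt d) (?X (Suc T)) (\<lambda>x. u' x + (- (\<mu> / \<Lambda>\<^sup>2)) * w x)"
  proof (rule combo_mono[OF combo_sum2[OF combo_scale[OF w] u']])
    have "\<bar>- (\<mu> / \<Lambda>\<^sup>2)\<bar> = \<mu> / \<Lambda>\<^sup>2" using l by simp
    moreover have "?X (Suc T) = ?q + ?p * ?X T"
      by (simp only: sum.lessThan_Suc_shift power_0 mult_1_left power_Suc sum_distrib_left mult.assoc)
    moreover have "S + a * (S * L + h) = a * h + (1 + a * L) * S" for S a L h :: real
      by (simp add: algebra_simps)
    ultimately show "?X T + \<bar>- (\<mu> / \<Lambda>\<^sup>2)\<bar> * (?X T * (lA * (real d)\<^sup>2 + lc) + lf / 2) \<le> ?X (Suc T)"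
      by (simp only: order_refl)
  qed
  with fin show ?case by blast
qed

end

section \<open>The energy form and the dual norms\<close>

lemma amax_bound:
  assumes "is_amax d A amax" "x \<in> \<Omega> d"
  shows "L2_set (\<lambda>i. \<Sum>j<d. A i j x * v j) {..<d} \<le> amax * L2_set v {..<d}"
proof (cases "\<exists>i<d. v i \<noteq> 0")
  case True
  let ?Q = "{L2_set (\<lambda>i. \<Sum>j<d. A i j x * v j) {..<d} / L2_set v {..<d} | x v. x \<in> \<Omega> d \<and> (\<exists>i<d. v i \<noteq> 0)}"
  have "bdd_above ?Q" "amax = Sup ?Q" using assms(1) by (auto simp: is_amax_def Let_def)
  moreover have "L2_set (\<lambda>i. \<Sum>j<d. A i j x * v j) {..<d} / L2_set v {..<d} \<in> ?Q" using assms(2) True by blast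
  ultimately have le: "L2_set (\<lambda>i. \<Sum>j<d. A i j x * v j) {..<d} / L2_set v {..<d} \<le> amax"
    by (simp add: cSup_upper)
  have "L2_set v {..<d} \<noteq> 0" using True by (auto simp: L2_set_eq_0_iff)
  then have "0 < L2_set v {..<d}" using L2_set_nonneg[of v "{..<d}"] by linarith
  then show ?thesis using le by (simp add: divide_le_eq)
next
  case False
  then have "L2_set (\<lambda>i. \<Sum>j<d. A i j x * v j) {..<d} = 0" "L2_set v {..<d} = 0"
    by (auto simp: L2_set_def)
  then show ?thesis by simp
qed

text \<open>Apply the operator bound to the unit vector in direction \<open>j\<close>.\<close>

lemma coefficient_bounded:
  assumes "is_amax d A amax" "x \<in> \<Omega> d" "i < d" "j < d"
  shows "\<bar>A i j x\<bar> \<le> amax"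
proof -
  let ?v = "\<lambda>m. if m = j then 1 else 0 :: real"
  have sq: "(?v m)\<^sup>2 = ?v m" for m by simp
  have v1: "L2_set ?v {..<d} = 1" unfolding L2_set_def sq using assms(4) by simp
  have "A i j x = (\<Sum>m<d. A i m x * ?v m)" using assms(4) by (simp add: if_distrib cong: if_cong)
  also have "\<bar>\<dots>\<bar> \<le> L2_set (\<lambda>i. \<bar>\<Sum>m<d. A i m x * ?v m\<bar>) {..<d}"
    using assms(3) by (intro member_le_L2_set) auto
  also have "\<dots> = L2_set (\<lambda>i. \<Sum>m<d. A i m x * ?v m) {..<d}" by (simp add: L2_set_def)
  also have "\<dots> \<le> amax * 1" using amax_bound[OF assms(1,2), of ?v] unfolding v1 .
  finally show ?thesis by simp
qed

lemma two_term_cauchy_schwarz: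
  assumes "0 \<le> a" "0 \<le> b" "0 \<le> p" "0 \<le> q"
  shows "a * b + p * q \<le> sqrt (a\<^sup>2 + p\<^sup>2) * sqrt (b\<^sup>2 + q\<^sup>2)"
proof -
  have "(a * b + p * q)\<^sup>2 \<le> (a\<^sup>2 + p\<^sup>2) * (b\<^sup>2 + q\<^sup>2)"
    using sum_squares_bound[of "a * q" "p * b"]
    by (simp add: power2_sum power_mult_distrib algebra_simps)
  then have "sqrt ((a * b + p * q)\<^sup>2) \<le> sqrt ((a\<^sup>2 + p\<^sup>2) * (b\<^sup>2 + q\<^sup>2))" by (rule real_sqrt_le_mono)
  then show ?thesis using assms by (simp add: real_sqrt_mult)
qed

lemma L2_set_sq: "(L2_set v {..<d::nat})\<^sup>2 = (\<Sum>i<d. (v i)\<^sup>2)"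
  by (simp add: L2_set_def sum_nonneg)

text \<open>Pointwise Cauchy-Schwarz inequality for the vectors that consist of the gradient and the value.\<close>

lemma integrand_bound:
  assumes A: "is_amax d A amax" and x: "x \<in> \<Omega> d" and c: "0 \<le> c" "c \<le> cmax" and am: "0 \<le> amax"
  shows "\<bar>(\<Sum>i<d. p i * (\<Sum>j<d. A i j x * q j)) + c * a * b\<bar>
    \<le> max amax cmax * (sqrt ((\<Sum>i<d. (p i)\<^sup>2) + a\<^sup>2) * sqrt ((\<Sum>i<d. (q i)\<^sup>2) + b\<^sup>2))"
proof -
  let ?P = "L2_set p {..<d}" and ?Q = "L2_set q {..<d}" and ?m = "max amax cmax"
  have P0: "0 \<le> ?P" "0 \<le> ?Q" by (auto intro: L2_set_nonneg)
  have "\<bar>\<Sum>i<d. p i * (\<Sum>j<d. A i j x * q j)\<bar> \<le> (\<Sum>i<d. \<bar>p i * (\<Sum>j<d. A i j x * q j)\<bar>)" by (rule sum_abs)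
  also have "\<dots> \<le> ?P * L2_set (\<lambda>i. \<Sum>j<d. A i j x * q j) {..<d}"
    unfolding abs_mult by (rule L2_set_mult_ineq)
  also have "\<dots> \<le> ?P * (amax * ?Q)" by (intro mult_left_mono amax_bound[OF A x] P0)
  also have "\<dots> \<le> ?m * (?P * ?Q)"
    using P0 mult_right_mono[of amax ?m "?P * ?Q"] by (simp add: mult.left_commute)
  finally have 1: "\<bar>\<Sum>i<d. p i * (\<Sum>j<d. A i j x * q j)\<bar> \<le> ?m * (?P * ?Q)" .
  have "\<bar>c * a * b\<bar> = c * (\<bar>a\<bar> * \<bar>b\<bar>)" using c by (simp add: abs_mult)
  also have "\<dots> \<le> ?m * (\<bar>a\<bar> * \<bar>b\<bar>)" using c by (intro mult_right_mono) auto
  finally have "\<bar>(\<Sum>i<d. p i * (\<Sum>j<d. A i j x * q j)) + c * a * b\<bar> \<le> ?m * (?P * ?Q) + ?m * (\<bar>a\<bar> * \<bar>b\<bar>)"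
    using 1 by linarith
  also have "\<dots> = ?m * (?P * ?Q + \<bar>a\<bar> * \<bar>b\<bar>)" by (rule distrib_left[symmetric])
  also have "\<dots> \<le> ?m * (sqrt (?P\<^sup>2 + \<bar>a\<bar>\<^sup>2) * sqrt (?Q\<^sup>2 + \<bar>b\<bar>\<^sup>2))"
    using am by (intro mult_left_mono two_term_cauchy_schwarz P0) auto
  finally show ?thesis by (simp add: L2_set_sq)
qed

locale elliptic =
  fixes d :: nat and A :: "nat \<Rightarrow> nat \<Rightarrow> (nat \<Rightarrow> real) \<Rightarrow> real" and c f :: "(nat \<Rightarrow> real) \<Rightarrow> real"
    and amin amax cmin cmax :: real
  assumes d2: "2 \<le> d" and basic: "basic_assumptions d amin amax cmin cmax A c f"
begin

lemma amin_pos: "0 < amin" and cmin_pos: "0 < cmin"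
  and amax: "is_amax d A amax" and f_L2: "f \<in> L2 d"
  and A_meas: "i < d \<Longrightarrow> j < d \<Longrightarrow> A i j \<in> borel_measurable (leb d)"
  and c_meas: "c \<in> borel_measurable (leb d)"
  and c_bounds: "x \<in> \<Omega> d \<Longrightarrow> cmin \<le> c x \<and> c x \<le> cmax"
  and A_coercive: "x \<in> \<Omega> d \<Longrightarrow> amin * (L2_set v {..<d})\<^sup>2 \<le> (\<Sum>i<d. \<Sum>j<d. v i * A i j x * v j)"
  using basic by (auto simp: basic_assumptions_def)

lemma center_in_\<Omega>: "(\<lambda>m\<in>{..<d}. 1/2) \<in> \<Omega> d"
  by (auto simp: \<Omega>_def)

lemma amin_le_amax: "amin \<le> amax"
proof -
  let ?x = "\<lambda>m\<in>{..<d}. 1/2 :: real" and ?v = "\<lambda>m. if m = 0 then 1 else 0 :: real"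
  have x: "?x \<in> \<Omega> d" by (rule center_in_\<Omega>)
  have sq: "(?v m)\<^sup>2 = ?v m" for m by simp
  have v1: "L2_set ?v {..<d} = 1" unfolding L2_set_def sq using d2 by simp
  have "(\<Sum>i<d. \<Sum>j<d. ?v i * A i j ?x * ?v j) = A 0 0 ?x"
  proof -
    have "(\<Sum>i<d. \<Sum>j<d. ?v i * A i j ?x * ?v j) = (\<Sum>i<d. ?v i * (\<Sum>j<d. A i j ?x * ?v j))"
      by (simp only: sum_distrib_left mult.assoc)
    also have "\<dots> = (\<Sum>j<d. A 0 j ?x * ?v j)" using d2 by (simp add: if_distrib[of "\<lambda>t. t * _"] cong: if_cong)
    also have "\<dots> = A 0 0 ?x" using d2 by (simp add: if_distrib cong: if_cong)
    finally show ?thesis .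
  qed
  then have "amin \<le> A 0 0 ?x" using A_coercive[OF x, of ?v] unfolding v1 by simp
  also have "\<dots> \<le> amax" using coefficient_bounded[OF amax x, of 0 0] d2 by linarith
  finally show ?thesis .
qed

lemma cmin_le_cmax: "cmin \<le> cmax"
  using c_bounds[OF center_in_\<Omega>] by linarith

abbreviation "\<mu> \<equiv> lam_min amin cmin"
abbreviation "\<Lambda> \<equiv> lam_max amax cmax"

lemma lam: "0 < \<mu>" "\<mu> \<le> \<Lambda>"
  using amin_pos cmin_pos amin_le_amax cmin_le_cmax by (auto simp: lam_min_def lam_max_def)

lemma A_mult_L2: "i < d \<Longrightarrow> j < d \<Longrightarrow> g \<in> L2 d \<Longrightarrow> (\<lambda>x. A i j x * g x) \<in> L2 d"
  by (rule L2_mult_bounded[where B = amax]) (auto intro: A_meas coefficient_bounded[OF amax])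

lemma c_abs: "x \<in> \<Omega> d \<Longrightarrow> \<bar>c x\<bar> \<le> cmax"
  using c_bounds[of x] cmin_pos by linarith

lemma c_mult_L2: "g \<in> L2 d \<Longrightarrow> (\<lambda>x. c x * g x) \<in> L2 d"
  by (rule L2_mult_bounded[OF _ c_meas c_abs])

lemma bform_integral:
  assumes "u \<in> H1 d" "v \<in> H1 d"
  shows "bform d A c u v = (\<integral>x. (\<Sum>i<d. wderiv d i u x * (\<Sum>j<d. A i j x * wderiv d j v x)) + c x * u x * v x \<partial>leb d)"
    and "integrable (leb d) (\<lambda>x. (\<Sum>i<d. wderiv d i u x * (\<Sum>j<d. A i j x * wderiv d j v x)) + c x * u x * v x)"
proof -
  have I: "integrable (leb d) (\<lambda>x. A i j x * wderiv d i u x * wderiv d j v x)" if "i < d" "j < d" for i j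
    by (intro L2_mult_integrable A_mult_L2 wderiv_L2 assms that)
  have J: "integrable (leb d) (\<lambda>x. c x * u x * v x)"
    by (intro L2_mult_integrable c_mult_L2 H1_L2 assms)
  have eq: "(\<Sum>i<d. wderiv d i u x * (\<Sum>j<d. A i j x * wderiv d j v x))
      = (\<Sum>i<d. \<Sum>j<d. A i j x * wderiv d i u x * wderiv d j v x)" for x
    by (simp add: sum_distrib_left mult_ac)
  show "integrable (leb d) (\<lambda>x. (\<Sum>i<d. wderiv d i u x * (\<Sum>j<d. A i j x * wderiv d j v x)) + c x * u x * v x)"
    unfolding eq by (intro Bochner_Integration.integrable_add Bochner_Integration.integrable_sum I J) auto
  have "(\<integral>x. (\<Sum>i<d. \<Sum>j<d. A i j x * wderiv d i u x * wderiv d j v x) + c x * u x * v x \<partial>leb d)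
      = (\<Sum>i<d. \<Sum>j<d. \<integral>x. A i j x * wderiv d i u x * wderiv d j v x \<partial>leb d) + (\<integral>x. c x * u x * v x \<partial>leb d)"
  proof -
    have "integrable (leb d) (\<lambda>x. \<Sum>i<d. \<Sum>j<d. A i j x * wderiv d i u x * wderiv d j v x)"
      by (intro Bochner_Integration.integrable_sum I) auto
    moreover have "(\<integral>x. (\<Sum>i<d. \<Sum>j<d. A i j x * wderiv d i u x * wderiv d j v x) \<partial>leb d)
        = (\<Sum>i<d. \<integral>x. (\<Sum>j<d. A i j x * wderiv d i u x * wderiv d j v x) \<partial>leb d)"
      by (intro Bochner_Integration.integral_sum Bochner_Integration.integrable_sum I) auto
    moreover have "(\<integral>x. (\<Sum>j<d. A i j x * wderiv d i u x * wderiv d j v x) \<partial>leb d)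
        = (\<Sum>j<d. \<integral>x. A i j x * wderiv d i u x * wderiv d j v x \<partial>leb d)" if "i < d" for i
      by (intro Bochner_Integration.integral_sum I that) auto
    ultimately show ?thesis using J by simp
  qed
  then show "bform d A c u v = (\<integral>x. (\<Sum>i<d. wderiv d i u x * (\<Sum>j<d. A i j x * wderiv d j v x)) + c x * u x * v x \<partial>leb d)"
    unfolding eq by (simp add: bform_def l2_inner_def)
qed

lemma weak_identity_iff:
  assumes "u \<in> H1 d" "v \<in> H1 d"
  shows "weak_identity d A c f u v \<longleftrightarrow> bform d A c u v = l2_inner d f v"
  unfolding weak_identity_def bform_integral(1)[OF assms] l2_inner_def
  using Bochner_Integration.integral_diff[OF bform_integral(2)[OF assms] L2_mult_integrable[OF f_L2 H1_L2[OF assms(2)]]]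
  by simp

lemma bform_left:
  assumes "u \<in> H1 d" "v \<in> H1 d" "w \<in> H1 d"
  shows "bform d A c (\<lambda>x. u x + (-1) * v x) w = bform d A c u w - bform d A c v w"
proof -
  have 1: "l2_inner d (\<lambda>x. A i j x * wderiv d i (\<lambda>x. u x + (-1) * v x) x) (wderiv d j w)
    = l2_inner d (\<lambda>x. A i j x * wderiv d i u x) (wderiv d j w) - l2_inner d (\<lambda>x. A i j x * wderiv d i v x) (wderiv d j w)"
    if ij: "i < d" "j < d" for i j
  proof -
    have "AE x in leb d. A i j x * wderiv d i (\<lambda>x. u x + (-1) * v x) x
        = A i j x * wderiv d i u x + (-1) * (A i j x * wderiv d i v x)"
      using wderiv_lincomb[OF assms(1,2) ij(1), of "-1"]
    proof eventually_elim
      case (elim x)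
      show ?case unfolding elim by (simp add: algebra_simps)
    qed
    then have "l2_inner d (\<lambda>x. A i j x * wderiv d i (\<lambda>x. u x + (-1) * v x) x) (wderiv d j w)
      = l2_inner d (\<lambda>x. A i j x * wderiv d i u x + (-1) * (A i j x * wderiv d i v x)) (wderiv d j w)"
      by (intro l2_cong_meas L2_measurable A_mult_L2 l2.lincomb wderiv_L2 H1_lincomb assms ij)
    then show ?thesis
      using l2_left[OF A_mult_L2[OF ij wderiv_L2[OF assms(1) ij(1)]] A_mult_L2[OF ij wderiv_L2[OF assms(2) ij(1)]]
          wderiv_L2[OF assms(3) ij(2)], of "-1"] by simp
  qed
  have "(\<lambda>x. c x * (u x + (-1) * v x)) = (\<lambda>x. c x * u x + (-1) * (c x * v x))" by (simp add: algebra_simps)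
  then have 2: "l2_inner d (\<lambda>x. c x * (u x + (-1) * v x)) w = l2_inner d (\<lambda>x. c x * u x) w - l2_inner d (\<lambda>x. c x * v x) w"
    using l2_left[OF c_mult_L2[OF H1_L2[OF assms(1)]] c_mult_L2[OF H1_L2[OF assms(2)]] H1_L2[OF assms(3)], of "-1"] by simp
  have "(\<Sum>i<d. \<Sum>j<d. l2_inner d (\<lambda>x. A i j x * wderiv d i (\<lambda>x. u x + (-1) * v x) x) (wderiv d j w))
    = (\<Sum>i<d. \<Sum>j<d. l2_inner d (\<lambda>x. A i j x * wderiv d i u x) (wderiv d j w)
        - l2_inner d (\<lambda>x. A i j x * wderiv d i v x) (wderiv d j w))"
    by (intro sum.cong refl 1) auto
  then show ?thesis unfolding bform_def 2 by (simp add: sum_subtractf)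
qed

lemma bform_coercive:
  assumes u: "u \<in> H1 d"
  shows "\<mu> * (H1_norm d u)\<^sup>2 \<le> bform d A c u u"
proof -
  have "\<mu> * (H1_norm d u)\<^sup>2 = \<mu> * H1_inner d u u" by (simp add: H1_norm_def H1_nonneg)
  also have "\<dots> = (\<integral>x. \<mu> * ((\<Sum>i<d. wderiv d i u x * wderiv d i u x) + u x * u x) \<partial>leb d)"
    by (simp add: H1_inner_def)
  also have "\<dots> \<le> bform d A c u u"
    unfolding bform_integral(1)[OF u u]
  proof (rule integral_mono[OF _ bform_integral(2)[OF u u]])
    show "integrable (leb d) (\<lambda>x. \<mu> * ((\<Sum>i<d. wderiv d i u x * wderiv d i u x) + u x * u x))"
      by (intro integrable_mult_right Bochner_Integration.integrable_add Bochner_Integration.integrable_sum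
          L2_mult_integrable wderiv_L2 H1_L2 u) auto
    fix x assume "x \<in> space (leb d)"
    then have x: "x \<in> \<Omega> d" by simp
    let ?p = "\<lambda>i. wderiv d i u x"
    have "\<mu> * (\<Sum>i<d. ?p i * ?p i) \<le> amin * (\<Sum>i<d. ?p i * ?p i)"
      by (intro mult_right_mono sum_nonneg) (auto simp: lam_min_def)
    also have "\<dots> = amin * (L2_set ?p {..<d})\<^sup>2" unfolding L2_set_sq by (simp add: power2_eq_square)
    also have "\<dots> \<le> (\<Sum>i<d. \<Sum>j<d. ?p i * A i j x * ?p j)" by (rule A_coercive[OF x])
    also have "\<dots> = (\<Sum>i<d. ?p i * (\<Sum>j<d. A i j x * ?p j))" by (simp add: sum_distrib_left mult_ac)
    finally have "\<mu> * (\<Sum>i<d. ?p i * ?p i) \<le> (\<Sum>i<d. ?p i * (\<Sum>j<d. A i j x * ?p j))" .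
    moreover have "\<mu> * (u x * u x) \<le> c x * (u x * u x)"
      using c_bounds[OF x] by (intro mult_right_mono) (auto simp: lam_min_def)
    ultimately show "\<mu> * ((\<Sum>i<d. ?p i * ?p i) + u x * u x) \<le> (\<Sum>i<d. ?p i * (\<Sum>j<d. A i j x * ?p j)) + c x * u x * u x"
      by (simp add: distrib_left mult.assoc)
  qed
  finally show ?thesis .
qed

lemma bform_bounded:
  assumes u: "u \<in> H1 d" and v: "v \<in> H1 d"
  shows "\<bar>bform d A c u v\<bar> \<le> \<Lambda> * H1_norm d u * H1_norm d v"
proof -
  \<comment> \<open>The integrand is bounded by \<open>\<Lambda> E(u) E(v)\<close>, and the \<open>L\<^sup>2\<close> norm of \<open>E(u)\<close> is the \<open>H\<^sup>1\<close> norm of \<open>u\<close>.\<close>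
  define E where "E u x = sqrt ((\<Sum>i<d. (wderiv d i u x)\<^sup>2) + (u x)\<^sup>2)" for u x
  have E2: "E w x * E w x = (\<Sum>i<d. wderiv d i w x * wderiv d i w x) + w x * w x" for w x
    unfolding E_def by (subst real_sqrt_mult_self) (simp add: sum_nonneg power2_eq_square)
  have Em: "E w \<in> borel_measurable (leb d)" if "w \<in> H1 d" for w
  proof -
    have [measurable]: "w \<in> borel_measurable (leb d)" "\<And>i. i \<in> {..<d} \<Longrightarrow> wderiv d i w \<in> borel_measurable (leb d)"
      using L2_measurable[OF H1_L2[OF that]] L2_measurable[OF wderiv_L2[OF that]] by auto
    show ?thesis unfolding E_def[abs_def] by measurable
  qed
  have Ei: "integrable (leb d) (\<lambda>x. E w x * E w x)" if "w \<in> H1 d" for w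
    unfolding E2
    by (intro Bochner_Integration.integrable_add Bochner_Integration.integrable_sum
          L2_mult_integrable wderiv_L2 H1_L2 that) auto
  have EL: "E w \<in> L2 d" if "w \<in> H1 d" for w
    using Em[OF that] Ei[OF that] by (simp add: L2_def power2_eq_square)
  have En: "l2.nrm d (E w) = H1_norm d w" if "w \<in> H1 d" for w
    unfolding l2.nrm_def H1_norm_def l2_inner_def E2 H1_inner_def ..
  have "\<bar>bform d A c u v\<bar> \<le> (\<integral>x. \<bar>(\<Sum>i<d. wderiv d i u x * (\<Sum>j<d. A i j x * wderiv d j v x)) + c x * u x * v x\<bar> \<partial>leb d)"
    unfolding bform_integral(1)[OF u v] by (rule integral_abs_bound)
  also have "\<dots> \<le> (\<integral>x. \<Lambda> * (E u x * E v x) \<partial>leb d)"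
  proof (rule integral_mono)
    show "integrable (leb d) (\<lambda>x. \<bar>(\<Sum>i<d. wderiv d i u x * (\<Sum>j<d. A i j x * wderiv d j v x)) + c x * u x * v x\<bar>)"
      by (rule integrable_abs[OF bform_integral(2)[OF u v]])
    show "integrable (leb d) (\<lambda>x. \<Lambda> * (E u x * E v x))"
      using L2_mult_integrable[OF EL[OF u] EL[OF v]] by simp
    fix x assume "x \<in> space (leb d)"
    then have x: "x \<in> \<Omega> d" by simp
    show "\<bar>(\<Sum>i<d. wderiv d i u x * (\<Sum>j<d. A i j x * wderiv d j v x)) + c x * u x * v x\<bar> \<le> \<Lambda> * (E u x * E v x)"
      unfolding E_def lam_max_def
      using c_bounds[OF x] cmin_pos amin_pos amin_le_amax by (intro integrand_bound[OF amax x]) auto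
  qed
  also have "\<dots> = \<Lambda> * l2_inner d (E u) (E v)" by (simp add: l2_inner_def)
  also have "\<dots> \<le> \<Lambda> * (l2.nrm d (E u) * l2.nrm d (E v))"
    using l2.cauchy_schwarz[OF EL[OF u] EL[OF v]] lam by (intro mult_left_mono) auto
  finally show ?thesis by (simp add: En u v mult.assoc)
qed

end

section \<open>Barron norms bound finite partial sums\<close>

text \<open>The norm is the sum over all frequencies and dominates each finite part; convergence in \<open>L\<^sup>2\<close> provides
  the approximation.\<close>

lemma barron_approximable:
  assumes g: "g \<in> L2 d" and fin: "orth_barron_norm d Z e n g < \<infinity>"
    and e: "\<And>k x. e k x = trig d J (nfreq k) x"
  shows "approximable d J n (enn2real (orth_barron_norm d Z e n g)) g"
proof -
  define P where "P a \<longleftrightarrow> has_L2_expansion d (Nd d) e a g \<and> (\<forall>k\<in>Nd d \<inter> Z. a k = 0)" for a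
  define a where "a = (SOME a. P a)"
  define W where "W k = 1 + pi ^ n * nlen d k ^ n" for k
  have ob: "orth_barron_norm d Z e n g = (if \<exists>a. P a then \<Sum>\<^sub>\<infinity>k\<in>Nd d. ennreal (\<bar>a k\<bar> * W k) else \<infinity>)"
    unfolding orth_barron_norm_def P_def a_def W_def Let_def ..
  have ex: "\<exists>a. P a" using fin unfolding ob by (auto split: if_splits)
  then have "P a" unfolding a_def by (rule someI_ex)
  then have exp: "has_L2_expansion d (Nd d) e a g" by (simp add: P_def)
  have norm: "orth_barron_norm d Z e n g = (\<Sum>\<^sub>\<infinity>k\<in>Nd d. ennreal (\<bar>a k\<bar> * W k))"
    unfolding ob using ex by simp
  have W0: "0 \<le> W k" for k
    unfolding W_def by (intro add_nonneg_nonneg mult_nonneg_nonneg zero_le_power L2_set_nonneg) auto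
  have part: "(\<Sum>k\<in>F. \<bar>a k\<bar> * W k) \<le> enn2real (orth_barron_norm d Z e n g)"
    if F: "finite F" "F \<subseteq> Nd d" for F
  proof -
    have "ennreal (\<Sum>k\<in>F. \<bar>a k\<bar> * W k) = (\<Sum>k\<in>F. ennreal (\<bar>a k\<bar> * W k))"
      by (rule sum_ennreal[symmetric]) (simp add: W0)
    also have "\<dots> \<le> (\<Sum>\<^sub>\<infinity>k\<in>Nd d. ennreal (\<bar>a k\<bar> * W k))"
      by (subst nonneg_infsum_complete) (use F in \<open>auto intro: SUP_upper\<close>)
    finally have "ennreal (\<Sum>k\<in>F. \<bar>a k\<bar> * W k) \<le> orth_barron_norm d Z e n g" unfolding norm .
    then have "enn2real (ennreal (\<Sum>k\<in>F. \<bar>a k\<bar> * W k)) \<le> enn2real (orth_barron_norm d Z e n g)"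
      using fin by (intro enn2real_mono) auto
    then show ?thesis by (simp add: sum_nonneg W0)
  qed
  show ?thesis
    unfolding approximable_def
  proof (intro conjI g allI impI)
    fix \<delta> :: real assume \<delta>: "0 < \<delta>"
    then have "0 < ennreal (\<delta>\<^sup>2)" by simp
    from order_tendstoD(2)[OF exp[unfolded has_L2_expansion_def] this]
    obtain F where F: "finite F" "F \<subseteq> Nd d" and
      less: "(\<integral>\<^sup>+x. ennreal ((norm (g x - (\<Sum>k\<in>F. a k * e k x)))\<^sup>2) \<partial>leb d) < ennreal (\<delta>\<^sup>2)"
      unfolding eventually_finite_subsets_at_top by blast
    let ?r = "\<lambda>x. g x - (\<Sum>k\<in>F. a k * trig d J (nfreq k) x)"
    have sL: "(\<lambda>x. \<Sum>k\<in>F. a k * trig d J (nfreq k) x) \<in> L2 d"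
      by (rule l2_sum_left(1)[OF F(1) trig_L2 g])
    have rL: "?r \<in> L2 d" using l2.lincomb[OF g sL, of "-1"] by simp
    have "ennreal (l2_inner d ?r ?r) = (\<integral>\<^sup>+x. ennreal (?r x * ?r x) \<partial>leb d)"
      unfolding l2_inner_def
      by (rule nn_integral_eq_integral[symmetric, OF L2_mult_integrable[OF rL rL]]) auto
    also have "\<dots> < ennreal (\<delta>\<^sup>2)" using less by (simp add: e power2_eq_square)
    finally have "l2_inner d ?r ?r < \<delta>\<^sup>2" by (simp add: ennreal_less_iff l2_nonneg)
    then have "sqrt (l2_inner d ?r ?r) \<le> sqrt (\<delta>\<^sup>2)" by (intro real_sqrt_le_mono) simp
    then have "l2.nrm d ?r \<le> \<delta>" unfolding l2.nrm_def real_sqrt_abs using \<delta> by simp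
    then show "\<exists>F a. finite F \<and> (\<Sum>k\<in>F. \<bar>a k\<bar> * (1 + pi ^ n * nlen d k ^ n)) \<le> enn2real (orth_barron_norm d Z e n g) \<and>
        l2.nrm d (\<lambda>x. g x - (\<Sum>k\<in>F. a k * trig d J (nfreq k) x)) \<le> \<delta>"
      using part[OF F] F(1) unfolding W_def by blast
  qed
qed

lemma approximable_mono: "approximable d J n l g \<Longrightarrow> l \<le> l' \<Longrightarrow> approximable d J n l' g"
  unfolding approximable_def by (meson order_trans)

lemma sin_basis_trig: "sin_basis d k x = trig d UNIV (nfreq k) x"
  by (simp add: sin_basis_def trig_def tensor_def tfac_def)

lemma cos_basis_trig: "cos_basis d k x = trig d {} (nfreq k) x"
  by (simp add: cos_basis_def trig_def tensor_def tfac_def)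

lemma mixed_basis_trig:
  assumes "i < d" "j < d" "i \<noteq> j"
  shows "mixed_basis d i j k x = trig d {i, j} (nfreq k) x"
proof -
  have "trig d {i, j} (nfreq k) x = (\<Prod>m\<in>{..<d}. tfac {i, j} (nfreq k) m (x m))"
    by (simp add: trig_def tensor_def)
  also have "\<dots> = tfac {i, j} (nfreq k) i (x i) * (\<Prod>m\<in>{..<d} - {i}. tfac {i, j} (nfreq k) m (x m))"
    by (rule prod.remove) (use assms in auto)
  also have "(\<Prod>m\<in>{..<d} - {i}. tfac {i, j} (nfreq k) m (x m))
      = tfac {i, j} (nfreq k) j (x j) * (\<Prod>m\<in>{..<d} - {i} - {j}. tfac {i, j} (nfreq k) m (x m))"
    by (rule prod.remove) (use assms in auto)
  also have "(\<Prod>m\<in>{..<d} - {i} - {j}. tfac {i, j} (nfreq k) m (x m))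
      = (\<Prod>m\<in>{..<d} - {i, j}. cos (pi * real (k m) * x m))"
    by (rule prod.cong) (auto simp: tfac_def)
  finally show ?thesis by (simp add: mixed_basis_def tfac_def)
qed

text \<open>The symmetric difference of \<open>{i}\<close> and \<open>{j}\<close> is empty on the diagonal, where the expansion is in
  cosines.\<close>

lemma coefficients_approximable:
  assumes d: "2 \<le> d" and b: "barron_assumptions d A c" and ij: "i < d" "j < d"
  shows "approximable d (sym_diff {i} {j}) 1 (ell_A d A) (A i j)"
proof -
  let ?S1 = "{barron_c_norm d 1 (A i i) | i. i < d}"
  let ?S2 = "{barron_m_norm d i j 1 (A i j) | i j. i < d \<and> j < d \<and> i \<noteq> j}"
  have S1: "?S1 = (\<lambda>i. barron_c_norm d 1 (A i i)) ` {..<d}" by auto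
  have S2: "?S2 = (\<lambda>(i, j). barron_m_norm d i j 1 (A i j)) ` ({..<d} \<times> {..<d} - {(i, j). i = j})" by force
  have f1: "finite ?S1" unfolding S1 by simp
  have f2: "finite ?S2" unfolding S2 by simp
  have d0: "0 < d" using d by simp
  then have n1: "?S1 \<noteq> {}" by blast
  have "(0::nat) < d \<and> 1 < d \<and> (0::nat) \<noteq> 1" using d by auto
  then have n2: "?S2 \<noteq> {}" by blast
  have "Max ?S1 \<in> ?S1" "Max ?S2 \<in> ?S2" by (rule Max_in[OF f1 n1], rule Max_in[OF f2 n2])
  moreover have "s < \<infinity>" if "s \<in> ?S1 \<or> s \<in> ?S2" for s
    using that b by (auto simp: barron_assumptions_def barron_c_def barron_m_def)
  ultimately have fin: "max (Max ?S1) (Max ?S2) < \<infinity>" by (simp add: max_def)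
  show ?thesis
  proof (cases "i = j")
    case True
    have "A i i \<in> barron_c d 1" using b ij by (auto simp: barron_assumptions_def)
    then have A: "A i i \<in> L2 d" "barron_c_norm d 1 (A i i) < \<infinity>" by (auto simp: barron_c_def)
    have "approximable d {} 1 (enn2real (barron_c_norm d 1 (A i i))) (A i i)"
      using A(2) unfolding barron_c_norm_def by (intro barron_approximable[OF A(1)] cos_basis_trig)
    moreover have "barron_c_norm d 1 (A i i) \<le> max (Max ?S1) (Max ?S2)"
      using Max_ge[OF f1, of "barron_c_norm d 1 (A i i)"] ij by (intro max.coboundedI1) blast
    then have "enn2real (barron_c_norm d 1 (A i i)) \<le> ell_A d A"
      unfolding ell_A_def using fin by (intro enn2real_mono) auto
    ultimately have "approximable d {} 1 (ell_A d A) (A i i)" by (rule approximable_mono)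
    then show ?thesis using True by simp
  next
    case False
    have "A i j \<in> barron_m d i j 1" using b ij False by (auto simp: barron_assumptions_def)
    then have A: "A i j \<in> L2 d" "barron_m_norm d i j 1 (A i j) < \<infinity>" by (auto simp: barron_m_def)
    have "approximable d {i, j} 1 (enn2real (barron_m_norm d i j 1 (A i j))) (A i j)"
      using A(2) unfolding barron_m_norm_def
      by (intro barron_approximable[OF A(1)] mixed_basis_trig[OF ij False])
    moreover have "barron_m_norm d i j 1 (A i j) \<le> max (Max ?S1) (Max ?S2)"
      using Max_ge[OF f2, of "barron_m_norm d i j 1 (A i j)"] ij False by (intro max.coboundedI2) blast
    then have "enn2real (barron_m_norm d i j 1 (A i j)) \<le> ell_A d A"
      unfolding ell_A_def using fin by (intro enn2real_mono) auto
    ultimately have "approximable d {i, j} 1 (ell_A d A) (A i j)" by (rule approximable_mono)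
    moreover have "sym_diff {i} {j} = {i, j}" using False by auto
    ultimately show ?thesis by simp
  qed
qed

lemma c_approximable:
  assumes "barron_assumptions d A c" shows "approximable d {} 2 (ell_c d c) c"
proof -
  have "c \<in> barron_c d 2" using assms by (auto simp: barron_assumptions_def)
  then have A: "c \<in> L2 d" "barron_c_norm d 2 c < \<infinity>" by (auto simp: barron_c_def)
  then show ?thesis unfolding ell_c_def barron_c_norm_def
    by (intro barron_approximable cos_basis_trig)
qed

lemma approximable_sin:
  assumes "f \<in> barron_s d n" shows "approximable d UNIV n (enn2real (barron_s_norm d n f)) f"
  using assms unfolding barron_s_def barron_s_norm_def
  by (intro barron_approximable sin_basis_trig) auto

lemma approximable_cos:
  assumes "f \<in> barron_c d n" shows "approximable d {} n (enn2real (barron_c_norm d n f)) f"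
  using assms unfolding barron_c_def barron_c_norm_def
  by (intro barron_approximable cos_basis_trig) auto

text \<open>The bound \<open>0\<close> admits the zero approximation only. For \<open>c\<close> this gives \<open>l\<^sub>c > 0\<close> and so \<open>p(d) > 1\<close>,
  without which \<open>M\<close> would not be the geometric sum.\<close>

lemma approximable_pos:
  assumes a: "approximable d J n l g" and g: "\<And>x. x \<in> \<Omega> d \<Longrightarrow> m \<le> g x" and m: "0 < m"
  shows "0 < l"
proof (rule ccontr)
  assume l: "\<not> 0 < l"
  obtain F a where F: "finite F" "(\<Sum>k\<in>F. \<bar>a k\<bar> * (1 + pi ^ n * nlen d k ^ n)) \<le> l"
    "l2.nrm d (\<lambda>x. g x - (\<Sum>k\<in>F. a k * trig d J (nfreq k) x)) \<le> m / 2"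
    using assms unfolding approximable_def by (meson half_gt_zero)
  have W1: "1 \<le> 1 + pi ^ n * nlen d k ^ n" for k
    by (simp add: mult_nonneg_nonneg L2_set_nonneg)
  have "\<bar>a k\<bar> = 0" if "k \<in> F" for k
  proof -
    have "\<bar>a k\<bar> * 1 \<le> \<bar>a k\<bar> * (1 + pi ^ n * nlen d k ^ n)" by (intro mult_left_mono W1) auto
    also have "\<dots> \<le> (\<Sum>k\<in>F. \<bar>a k\<bar> * (1 + pi ^ n * nlen d k ^ n))"
      using that F(1) by (intro member_le_sum) (auto intro!: mult_nonneg_nonneg order_trans[OF zero_le_one W1])
    finally show ?thesis using F(2) l by linarith
  qed
  then have "(\<lambda>x. g x - (\<Sum>k\<in>F. a k * trig d J (nfreq k) x)) = g" by (auto simp: fun_eq_iff intro!: sum.neutral)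
  then have le: "l2.nrm d g \<le> m / 2" using F(3) by simp
  have gL: "g \<in> L2 d" using a by (simp add: approximable_def)
  have "m * m = (\<integral>x. m * m \<partial>leb d)" by (simp add: measure_leb)
  also have "\<dots> \<le> (\<integral>x. g x * g x \<partial>leb d)"
  proof (rule integral_mono)
    show "integrable (leb d) (\<lambda>x. g x * g x)" by (rule L2_mult_integrable[OF gL gL])
    fix x assume "x \<in> space (leb d)"
    then have "m \<le> g x" using g by simp
    then show "m * m \<le> g x * g x" using m by (intro mult_mono) auto
  qed simp
  also have "\<dots> = (l2.nrm d g)\<^sup>2" by (simp add: l2.nrm_sq[OF gL] l2_inner_def)
  also have "\<dots> \<le> (m / 2)\<^sup>2" using le l2.nrm_nonneg[OF gL] by (intro power_mono) auto
  finally show False using m by (simp add: power2_eq_square)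
qed


section \<open>The two boundary conditions\<close>

lemma boundary_condition_neumann: "0 < d \<Longrightarrow> boundary_condition d {} (H1 d)"
proof
  fix v j k assume "v \<in> H1 d" "j < d"
  then show "l2_inner d (trig d (sym_diff {} {j}) k) (wderiv d j v) = - l2_inner d (dtrig d (sym_diff {} {j}) k j) v"
    by (intro trig_by_parts_H1) auto
qed (auto intro: H1_lincomb trig_H1)

lemma boundary_condition_dirichlet: "0 < d \<Longrightarrow> boundary_condition d UNIV (H10 d)"
proof
  fix v j k assume "v \<in> H10 d" "j < d"
  then show "l2_inner d (trig d (sym_diff UNIV {j}) k) (wderiv d j v) = - l2_inner d (dtrig d (sym_diff UNIV {j}) k j) v"
    by (intro trig_by_parts_H10)
qed (auto intro: H10_lincomb sine_product_H10 H10_H1)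

lemma H1_norm_scale: "u \<in> H1 d \<Longrightarrow> H1_norm d (\<lambda>x. c * u x) = \<bar>c\<bar> * H1_norm d u"
proof -
  assume u: "u \<in> H1 d"
  have "H1_inner d (\<lambda>x. c * u x) (\<lambda>x. c * u x) = c * (c * H1_inner d u u)"
    using H1.scale_right[OF u H1.scale_in[OF u], of c c] H1.scale_right[OF u u, of c] H1_sym by simp
  then show ?thesis by (simp add: H1_norm_def real_sqrt_mult flip: mult.assoc)
qed

lemma l2_inner_scale: "l2_inner d f (\<lambda>x. c * u x) = c * l2_inner d f u"
  by (simp add: l2_inner_def mult.left_commute)

lemma dual_norm_neumann:
  assumes f: "f \<in> L2 d" and d: "0 < d"
  shows "0 \<le> H1_dual_norm d f" and "u \<in> H1 d \<Longrightarrow> l2_inner d f u \<le> H1_dual_norm d f * H1_norm d u"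
proof -
  let ?S = "{\<integral>x. f x * \<phi> x \<partial>leb d | \<phi>. \<phi> \<in> H1 d \<and> H1_norm d \<phi> \<le> 1}"
  have cs: "\<bar>l2_inner d f \<phi>\<bar> \<le> l2.nrm d f * H1_norm d \<phi>" if "\<phi> \<in> H1 d" for \<phi>
    by (rule order_trans[OF l2.cauchy_schwarz[OF f H1_L2[OF that]]])
      (intro mult_left_mono l2_norm_le_H1[OF that] l2.nrm_nonneg[OF f])
  have bdd: "bdd_above ?S"
  proof (rule bdd_aboveI[of _ "l2.nrm d f"])
    fix s assume "s \<in> ?S"
    then obtain \<phi> where \<phi>: "s = l2_inner d f \<phi>" "\<phi> \<in> H1 d" "H1_norm d \<phi> \<le> 1" by (auto simp: l2_inner_def)
    have "l2.nrm d f * H1_norm d \<phi> \<le> l2.nrm d f * 1"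
      using \<phi>(3) l2.nrm_nonneg[OF f] by (intro mult_left_mono) auto
    then show "s \<le> l2.nrm d f" using cs[OF \<phi>(2)] \<phi>(1) by linarith
  qed
  have up: "l2_inner d f \<phi> \<le> H1_dual_norm d f" if "\<phi> \<in> H1 d" "H1_norm d \<phi> \<le> 1" for \<phi>
    unfolding H1_dual_norm_def using that by (intro cSup_upper[OF _ bdd]) (auto simp: l2_inner_def)
  have z: "(\<lambda>x. 0) \<in> H1 d" by (rule H1.zero_in[OF trig_H1[OF d]])
  have "H1_norm d (\<lambda>x. 0) = 0" using H1_norm_scale[OF z, of 0] by simp
  then show F0: "0 \<le> H1_dual_norm d f" using up[OF z] by (simp add: l2_inner_def)
  assume u: "u \<in> H1 d"
  have n0: "0 \<le> H1_norm d u" using H1.nrm_nonneg[OF u] by (simp add: H1_nrm)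
  show "l2_inner d f u \<le> H1_dual_norm d f * H1_norm d u"
  proof (cases "H1_norm d u = 0")
    case True
    then show ?thesis using cs[OF u] by simp
  next
    case False
    then have p: "0 < H1_norm d u" using n0 by simp
    define c where "c = 1 / H1_norm d u"
    have "H1_norm d (\<lambda>x. c * u x) \<le> 1" unfolding H1_norm_scale[OF u] using p by (simp add: c_def)
    from up[OF H1.scale_in[OF u] this] have "c * l2_inner d f u \<le> H1_dual_norm d f"
      unfolding l2_inner_scale .
    then show ?thesis using p by (simp add: c_def divide_le_eq)
  qed
qed

lemma wderiv_scale:
  assumes "u \<in> H1 d" "i < d"
  shows "AE x in leb d. wderiv d i (\<lambda>x. c * u x) x = c * wderiv d i u x"
  using wderiv_lincomb[OF H1.zero_in[OF assms(1)] assms(1,2), of c]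
    wderiv_lincomb[OF H1.zero_in[OF assms(1)] H1.zero_in[OF assms(1)] assms(2), of 1]
  by eventually_elim simp

lemma grad_norm_eq:
  assumes "u \<in> H1 d"
  shows "grad_norm d u = sqrt (\<Sum>i<d. l2_inner d (wderiv d i u) (wderiv d i u))"
proof -
  have "(\<integral>x. (\<Sum>i<d. (wderiv d i u x)\<^sup>2) \<partial>leb d) = (\<Sum>i<d. \<integral>x. (wderiv d i u x)\<^sup>2 \<partial>leb d)"
    by (rule Bochner_Integration.integral_sum)
      (use L2_mult_integrable[OF wderiv_L2[OF assms] wderiv_L2[OF assms]] in \<open>auto simp: power2_eq_square\<close>)
  then show ?thesis by (simp add: grad_norm_def l2_inner_def power2_eq_square)
qed

lemma grad_norm_scale:
  assumes u: "u \<in> H1 d"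
  shows "grad_norm d (\<lambda>x. c * u x) = \<bar>c\<bar> * grad_norm d u"
proof -
  have "l2_inner d (wderiv d i (\<lambda>x. c * u x)) (wderiv d i (\<lambda>x. c * u x)) = c\<^sup>2 * l2_inner d (wderiv d i u) (wderiv d i u)"
    if i: "i < d" for i
  proof -
    have "l2_inner d (wderiv d i (\<lambda>x. c * u x)) (wderiv d i (\<lambda>x. c * u x))
        = l2_inner d (\<lambda>x. c * wderiv d i u x) (\<lambda>x. c * wderiv d i u x)"
      by (intro l2_cong_AE wderiv_scale u i wderiv_L2 H1.scale_in l2.scale_in)
    also have "\<dots> = c\<^sup>2 * l2_inner d (wderiv d i u) (wderiv d i u)"
      by (simp add: l2_inner_scale l2_sym[of _ "\<lambda>x. c * wderiv d i u x"] power2_eq_square)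
    finally show ?thesis .
  qed
  then show ?thesis
    by (simp add: grad_norm_eq u H1.scale_in[OF u] real_sqrt_mult flip: sum_distrib_left)
qed

lemma grad_norm_le: "u \<in> H1 d \<Longrightarrow> grad_norm d u \<le> H1_norm d u"
  by (simp add: grad_norm_eq H1_norm_def H1_inner_eq l2_nonneg)

text \<open>The sine expansion of \<open>f\<close> makes it a bounded functional with respect to the norm of the
  gradient alone: each sine product is itself a derivative.\<close>

lemma sine_functional:
  assumes d: "0 < d" and \<phi>: "\<phi> \<in> H10 d"
  shows "\<bar>l2_inner d (trig d UNIV k) \<phi>\<bar> \<le> grad_norm d \<phi>"
proof -
  interpret boundary_condition d UNIV "H10 d" by (rule boundary_condition_dirichlet[OF d])
  have \<phi>1: "\<phi> \<in> H1 d" by (rule H10_H1[OF \<phi>])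
  have g0: "0 \<le> grad_norm d \<phi>" by (simp add: grad_norm_eq[OF \<phi>1] sum_nonneg l2_nonneg)
  show ?thesis
  proof (cases "k 0 = 0")
    case True
    then have "tfac UNIV k 0 t = 0" for t by (simp add: tfac_def)
    then have "trig d UNIV k x = 0" for x
      unfolding trig_def using d by (simp add: tensor_split[of 0])
    then show ?thesis using g0 by (simp add: l2_inner_def)
  next
    case False
    then have "1 \<le> \<bar>k 0\<bar>" by linarith
    then have k1: "1 \<le> \<bar>real_of_int (k 0)\<bar>" by linarith
    have "1 * 1 \<le> pi * \<bar>real_of_int (k 0)\<bar>" using pi_gt3 k1 by (intro mult_mono) auto
    then have "1 * \<bar>l2_inner d (trig d UNIV k) \<phi>\<bar> \<le> (pi * \<bar>real_of_int (k 0)\<bar>) * \<bar>l2_inner d (trig d UNIV k) \<phi>\<bar>"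
      by (intro mult_right_mono) auto
    also have "\<dots> = \<bar>l2_inner d (trig d (sym_diff UNIV {0}) k) (wderiv d 0 \<phi>)\<bar>"
      unfolding by_parts'[OF \<phi> d] by (simp add: abs_mult)
    also have "\<dots> \<le> l2.nrm d (trig d (sym_diff UNIV {0}) k) * l2.nrm d (wderiv d 0 \<phi>)"
      by (rule l2.cauchy_schwarz[OF trig_L2 wderiv_L2[OF \<phi>1 d]])
    also have "\<dots> \<le> 1 * grad_norm d \<phi>"
    proof (intro mult_mono)
      show "l2.nrm d (trig d (sym_diff UNIV {0}) k) \<le> 1"
        using l2_nrm_bounded[OF trig_L2 trig_abs_le, of d "sym_diff UNIV {0}" k] by simp
      show "l2.nrm d (wderiv d 0 \<phi>) \<le> grad_norm d \<phi>"
        unfolding l2.nrm_def grad_norm_eq[OF \<phi>1]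
        using d l2_nonneg by (intro real_sqrt_le_mono member_le_sum) auto
    qed (auto intro: l2.nrm_nonneg wderiv_L2[OF \<phi>1 d])
    finally show ?thesis by simp
  qed
qed

lemma approximable_functional:
  assumes d: "0 < d" and \<phi>: "\<phi> \<in> H10 d" and f: "approximable d UNIV 0 l f"
  shows "\<bar>l2_inner d f \<phi>\<bar> \<le> l * grad_norm d \<phi>"
proof (rule field_le_epsilon)
  fix e :: real assume e: "0 < e"
  have \<phi>1: "\<phi> \<in> H1 d" by (rule H10_H1[OF \<phi>])
  have \<phi>L: "\<phi> \<in> L2 d" by (rule H1_L2[OF \<phi>1])
  have g0: "0 \<le> grad_norm d \<phi>" by (simp add: grad_norm_eq[OF \<phi>1] sum_nonneg l2_nonneg)
  have n0: "0 \<le> l2.nrm d \<phi>" by (rule l2.nrm_nonneg[OF \<phi>L])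
  have fL: "f \<in> L2 d" using f by (simp add: approximable_def)
  have "0 < e / (l2.nrm d \<phi> + 1)" using e n0 by (intro divide_pos_pos) auto
  then obtain F a where F: "finite F" "(\<Sum>k\<in>F. \<bar>a k\<bar> * (1 + pi ^ 0 * nlen d k ^ 0)) \<le> l"
    "l2.nrm d (\<lambda>x. f x - (\<Sum>k\<in>F. a k * trig d UNIV (nfreq k) x)) \<le> e / (l2.nrm d \<phi> + 1)"
    using f unfolding approximable_def by blast
  let ?s = "\<lambda>x. \<Sum>k\<in>F. a k * trig d UNIV (nfreq k) x"
  have sL: "?s \<in> L2 d" by (rule l2_sum_left(1)[OF F(1) trig_L2 \<phi>L])
  have rL: "(\<lambda>x. f x - ?s x) \<in> L2 d" using l2.lincomb[OF fL sL, of "-1"] by simp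
  have split: "l2_inner d f \<phi> = l2_inner d (\<lambda>x. f x - ?s x) \<phi> + l2_inner d ?s \<phi>"
    using l2_left[OF rL sL \<phi>L, of 1] by simp
  have "\<bar>l2_inner d (\<lambda>x. f x - ?s x) \<phi>\<bar> \<le> l2.nrm d (\<lambda>x. f x - ?s x) * l2.nrm d \<phi>"
    by (rule l2.cauchy_schwarz[OF rL \<phi>L])
  also have "\<dots> \<le> e / (l2.nrm d \<phi> + 1) * (l2.nrm d \<phi> + 1)"
    using F(3) n0 e by (intro mult_mono) auto
  also have "\<dots> = e" using n0 by simp
  finally have 1: "\<bar>l2_inner d (\<lambda>x. f x - ?s x) \<phi>\<bar> \<le> e" .
  have "\<bar>l2_inner d ?s \<phi>\<bar> = \<bar>\<Sum>k\<in>F. a k * l2_inner d (trig d UNIV (nfreq k)) \<phi>\<bar>"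
    by (simp only: l2_sum_left(2)[OF F(1) trig_L2 \<phi>L])
  also have "\<dots> \<le> (\<Sum>k\<in>F. \<bar>a k * l2_inner d (trig d UNIV (nfreq k)) \<phi>\<bar>)" by (rule sum_abs)
  also have "\<dots> \<le> (\<Sum>k\<in>F. \<bar>a k\<bar> * (1 + pi ^ 0 * nlen d k ^ 0) * grad_norm d \<phi>)"
  proof (rule sum_mono)
    fix k
    have "\<bar>a k\<bar> * \<bar>l2_inner d (trig d UNIV (nfreq k)) \<phi>\<bar> \<le> \<bar>a k\<bar> * (2 * grad_norm d \<phi>)"
      using sine_functional[OF d \<phi>, of "nfreq k"] g0 by (intro mult_left_mono) auto
    then show "\<bar>a k * l2_inner d (trig d UNIV (nfreq k)) \<phi>\<bar> \<le> \<bar>a k\<bar> * (1 + pi ^ 0 * nlen d k ^ 0) * grad_norm d \<phi>"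
      by (simp add: abs_mult mult.assoc)
  qed
  also have "\<dots> \<le> l * grad_norm d \<phi>"
    unfolding sum_distrib_right[symmetric] by (rule mult_right_mono[OF F(2) g0])
  finally show "\<bar>l2_inner d f \<phi>\<bar> \<le> l * grad_norm d \<phi> + e" using 1 split by linarith
qed

text \<open>The set under the supremum is bounded by the previous lemma, so the supremum is an upper bound.\<close>

lemma dual_norm_dirichlet:
  assumes d: "0 < d" and f: "approximable d UNIV 0 l f"
  shows "0 \<le> H_minus1_norm d f" and "u \<in> H10 d \<Longrightarrow> l2_inner d f u \<le> H_minus1_norm d f * H1_norm d u"
proof -
  interpret boundary_condition d UNIV "H10 d" by (rule boundary_condition_dirichlet[OF d])
  let ?S = "{\<integral>x. f x * \<phi> x \<partial>leb d | \<phi>. \<phi> \<in> H10 d \<and> grad_norm d \<phi> \<le> 1}"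
  have g0: "0 \<le> grad_norm d \<phi>" if "\<phi> \<in> H10 d" for \<phi>
    by (simp add: grad_norm_eq[OF H10_H1[OF that]] sum_nonneg l2_nonneg)
  have bdd: "bdd_above ?S"
  proof (rule bdd_aboveI[of _ "\<bar>l\<bar>"])
    fix s assume "s \<in> ?S"
    then obtain \<phi> where \<phi>: "s = l2_inner d f \<phi>" "\<phi> \<in> H10 d" "grad_norm d \<phi> \<le> 1" by (auto simp: l2_inner_def)
    have "l * grad_norm d \<phi> \<le> \<bar>l\<bar> * 1"
      using \<phi>(3) g0[OF \<phi>(2)] by (intro mult_mono) auto
    then show "s \<le> \<bar>l\<bar>" using approximable_functional[OF d \<phi>(2) f] \<phi>(1) by linarith
  qed
  have up: "l2_inner d f \<phi> \<le> H_minus1_norm d f" if "\<phi> \<in> H10 d" "grad_norm d \<phi> \<le> 1" for \<phi>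
    unfolding H_minus1_norm_def using that by (intro cSup_upper[OF _ bdd]) (auto simp: l2_inner_def)
  have z: "(\<lambda>x. 0) \<in> H10 d" by (rule zero_in[OF trig_V])
  have "grad_norm d (\<lambda>x. 0) = 0" using grad_norm_scale[OF H10_H1[OF z], of 0] by simp
  then show F0: "0 \<le> H_minus1_norm d f" using up[OF z] by (simp add: l2_inner_def)
  assume u: "u \<in> H10 d"
  have u1: "u \<in> H1 d" by (rule H10_H1[OF u])
  have "l2_inner d f u \<le> H_minus1_norm d f * grad_norm d u"
  proof (cases "grad_norm d u = 0")
    case True
    then show ?thesis using approximable_functional[OF d u f] by simp
  next
    case False
    then have p: "0 < grad_norm d u" using g0[OF u] by simp
    define c where "c = 1 / grad_norm d u"
    have "grad_norm d (\<lambda>x. c * u x) \<le> 1" unfolding grad_norm_scale[OF u1] using p by (simp add: c_def)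
    from up[OF scale_in[OF u] this] have "c * l2_inner d f u \<le> H_minus1_norm d f"
      unfolding l2_inner_scale .
    then show ?thesis using p by (simp add: c_def divide_le_eq)
  qed
  also have "\<dots> \<le> H_minus1_norm d f * H1_norm d u"
    by (intro mult_left_mono grad_norm_le u1 F0)
  finally show "l2_inner d f u \<le> H_minus1_norm d f * H1_norm d u" .
qed

section \<open>Cosine networks\<close>

text \<open>A plane wave; the index is a pair of frequency and phase.\<close>

definition wave :: "nat \<Rightarrow> (nat \<Rightarrow> int) \<times> real \<Rightarrow> (nat \<Rightarrow> real) \<Rightarrow> real" where
  "wave d p x = cos ((\<Sum>j<d. pi * real_of_int (fst p j) * x j) + snd p)"

definition wave_deriv :: "nat \<Rightarrow> (nat \<Rightarrow> int) \<times> real \<Rightarrow> nat \<Rightarrow> (nat \<Rightarrow> real) \<Rightarrow> real" where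
  "wave_deriv d p i x = - (pi * real_of_int (fst p i)) * sin ((\<Sum>j<d. pi * real_of_int (fst p j) * x j) + snd p)"

lemma wave_C1: 
  assumes i: "i < d" shows "C1_pair d i (wave d p) (wave_deriv d p i)"
  unfolding C1_pair_def
proof (intro conjI exI[of _ "1 + pi * \<bar>real_of_int (fst p i)\<bar>"] ballI)
  have c: "continuous_on (\<Omega> d) (\<lambda>x::nat \<Rightarrow> real. x j)" for j
    by (rule continuous_on_subset[OF continuous_on_product_coordinates subset_UNIV])
  show "continuous_on (\<Omega> d) (wave d p)" "continuous_on (\<Omega> d) (wave_deriv d p i)"
    unfolding wave_def[abs_def] wave_deriv_def[abs_def] by (intro continuous_intros c)+
  fix x :: "nat \<Rightarrow> real"
  show "\<bar>wave d p x\<bar> \<le> 1 + pi * \<bar>real_of_int (fst p i)\<bar>"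
    unfolding wave_def by (rule order_trans[OF abs_cos_le_one]) simp
  have "\<bar>wave_deriv d p i x\<bar> \<le> (pi * \<bar>real_of_int (fst p i)\<bar>) * 1"
    unfolding wave_deriv_def abs_mult by (intro mult_mono abs_sin_le_one) (auto simp: abs_mult)
  then show "\<bar>wave_deriv d p i x\<bar> \<le> 1 + pi * \<bar>real_of_int (fst p i)\<bar>" by simp
  let ?R = "(\<Sum>j\<in>{..<d} - {i}. pi * real_of_int (fst p j) * x j) + snd p"
  have split: "(\<Sum>j<d. pi * real_of_int (fst p j) * (x(i := t)) j) + snd p = pi * real_of_int (fst p i) * t + ?R" for t
  proof -
    have "(\<Sum>j<d. pi * real_of_int (fst p j) * (x(i := t)) j)
      = pi * real_of_int (fst p i) * (x(i := t)) i + (\<Sum>j\<in>{..<d} - {i}. pi * real_of_int (fst p j) * (x(i := t)) j)"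
      by (rule sum.remove) (use i in auto)
    also have "(\<Sum>j\<in>{..<d} - {i}. pi * real_of_int (fst p j) * (x(i := t)) j)
      = (\<Sum>j\<in>{..<d} - {i}. pi * real_of_int (fst p j) * x j)" by (rule sum.cong) auto
    finally show ?thesis by simp
  qed
  have "((\<lambda>t. cos (pi * real_of_int (fst p i) * t + ?R)) has_real_derivative
      - (pi * real_of_int (fst p i)) * sin (pi * real_of_int (fst p i) * x i + ?R)) (at (x i))"
    by (auto intro!: derivative_eq_intros)
  moreover have "wave_deriv d p i x = - (pi * real_of_int (fst p i)) * sin (pi * real_of_int (fst p i) * x i + ?R)"
    unfolding wave_deriv_def using split[of "x i"] by (simp only: fun_upd_triv)
  ultimately show "((\<lambda>t. wave d p (x(i := t))) has_real_derivative wave_deriv d p i x) (at (x i))"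
    unfolding wave_def split by simp
qed

lemma wave_H1: "0 < d \<Longrightarrow> wave d p \<in> H1 d"
  by (rule C1_H1(1)[OF _ wave_C1])

lemma wave_H1_inner:
  assumes d: "0 < d" shows "H1_inner d (wave d p) (wave d p) \<le> wt d (fst p)"
proof -
  have nb: "l2_inner d g g \<le> B\<^sup>2" if "g \<in> L2 d" "\<And>x. \<bar>g x\<bar> \<le> B" "0 \<le> B" for g B
  proof -
    have "(l2.nrm d g)\<^sup>2 \<le> B\<^sup>2"
      using l2_nrm_bounded[OF that(1,2)] that(3) l2.nrm_nonneg[OF that(1)] by (intro power_mono) auto
    then show ?thesis by (simp add: l2.nrm_sq[OF that(1)])
  qed
  have "H1_inner d (wave d p) (wave d p)
      = (\<Sum>i<d. l2_inner d (wave_deriv d p i) (wave_deriv d p i)) + l2_inner d (wave d p) (wave d p)"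
    by (rule C1_H1_inner_self[OF d wave_C1])
  also have "\<dots> \<le> (\<Sum>i<d. (pi * \<bar>real_of_int (fst p i)\<bar>)\<^sup>2) + 1\<^sup>2"
  proof (intro add_mono sum_mono nb)
    fix i assume "i \<in> {..<d}"
    then show "wave_deriv d p i \<in> L2 d" using C1_pair_L2(2)[OF wave_C1] by simp
    fix x
    have "\<bar>wave_deriv d p i x\<bar> \<le> (pi * \<bar>real_of_int (fst p i)\<bar>) * 1"
      unfolding wave_deriv_def abs_mult by (intro mult_mono abs_sin_le_one) (auto simp: abs_mult)
    then show "\<bar>wave_deriv d p i x\<bar> \<le> pi * \<bar>real_of_int (fst p i)\<bar>" by simp
  next
    show "wave d p \<in> L2 d" using C1_pair_L2(1)[OF wave_C1[OF d]] .
    show "\<bar>wave d p x\<bar> \<le> 1" for x unfolding wave_def by (rule abs_cos_le_one)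
  qed auto
  also have "\<dots> = wt d (fst p)" by (simp add: wt_def power_mult_distrib sum_distrib_left)
  finally show ?thesis .
qed

lemma prod_cis: "finite B \<Longrightarrow> (\<Prod>m\<in>B. cis (y m)) = cis (\<Sum>m\<in>B. y m)"
  by (induction B rule: finite_induct) (auto simp: cis_mult)

text \<open>Expand the product of the factors \<open>cos y = (cis y + cis (- y)) / 2\<close> and take real parts: the product is
  the average of the cosines of all signed sums.\<close>

lemma prod_cos:
  fixes y :: "nat \<Rightarrow> real"
  shows "(\<Prod>m<d. cos (y m)) = (\<Sum>B\<in>Pow {..<d}. (1 / 2 ^ d) * cos (\<Sum>m<d. (if m \<in> B then 1 else -1) * y m))"
proof -
  have c: "complex_of_real (cos t) = cis t / 2 + cis (- t) / 2" for t
    by (simp add: complex_eq_iff)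
  have "complex_of_real (\<Prod>m<d. cos (y m)) = (\<Prod>m<d. cis (y m) / 2 + cis (- y m) / 2)"
    by (simp add: c)
  also have "\<dots> = (\<Sum>B\<in>Pow {..<d}. (\<Prod>m\<in>B. cis (y m) / 2) * (\<Prod>m\<in>{..<d} - B. cis (- y m) / 2))"
    by (rule prod_add) simp
  also have "\<dots> = (\<Sum>B\<in>Pow {..<d}. complex_of_real (1 / 2 ^ d) * cis (\<Sum>m<d. (if m \<in> B then 1 else -1) * y m))"
  proof (rule sum.cong[OF refl])
    fix B assume "B \<in> Pow {..<d}"
    then have B: "B \<subseteq> {..<d}" "finite B" by (auto intro: finite_subset)
    let ?z = "\<lambda>m. (if m \<in> B then 1 else -1) * y m"
    have "(\<Prod>m\<in>B. cis (y m) / 2) * (\<Prod>m\<in>{..<d} - B. cis (- y m) / 2)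
        = (\<Prod>m\<in>B. cis (?z m) / 2) * (\<Prod>m\<in>{..<d} - B. cis (?z m) / 2)"
      by (intro arg_cong2[where f = times] prod.cong) auto
    also have "\<dots> = (\<Prod>m\<in>{..<d}. cis (?z m) / 2)"
      using prod.subset_diff[OF B(1), of "\<lambda>m. cis (?z m) / 2"] by (simp add: mult.commute)
    also have "\<dots> = (\<Prod>m\<in>{..<d}. cis (?z m)) / 2 ^ d" by (simp add: prod_dividef)
    also have "\<dots> = complex_of_real (1 / 2 ^ d) * cis (\<Sum>m<d. ?z m)" by (simp add: prod_cis)
    finally show "(\<Prod>m\<in>B. cis (y m) / 2) * (\<Prod>m\<in>{..<d} - B. cis (- y m) / 2)
      = complex_of_real (1 / 2 ^ d) * cis (\<Sum>m<d. ?z m)" .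
  qed
  finally have "Re (complex_of_real (\<Prod>m<d. cos (y m)))
      = Re (\<Sum>B\<in>Pow {..<d}. complex_of_real (1 / 2 ^ d) * cis (\<Sum>m<d. (if m \<in> B then 1 else -1) * y m))"
    by (rule arg_cong)
  then show ?thesis by (simp only: Re_complex_of_real Re_sum) simp
qed

text \<open>A sine is a cosine with phase \<open>\<pi> / 2\<close>. Changing signs of the components does not change the weight
  of a frequency.\<close>

lemma trig_combo_wave: "combo (wave d) (\<lambda>p. wt d (fst p)) (wt d k) (trig d J k)"
proof -
  define \<theta> where "\<theta> m = (if m \<in> J then pi / 2 else 0 :: real)" for m
  define \<sigma> where "\<sigma> B m = (if m \<in> B then 1 else -1 :: int)" for B and m :: nat
  define P where "P B = ((\<lambda>m. \<sigma> B m * k m), - (\<Sum>m<d. real_of_int (\<sigma> B m) * \<theta> m))" for B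
  have fac: "tfac J k m t = cos (pi * real_of_int (k m) * t - \<theta> m)" for m t
    by (simp add: tfac_def \<theta>_def cos_diff)
  have eq: "trig d J k x = (\<Sum>B\<in>Pow {..<d}. (1 / 2 ^ d) * wave d (P B) x)" for x
  proof -
    have "trig d J k x = (\<Sum>B\<in>Pow {..<d}. (1 / 2 ^ d) *
        cos (\<Sum>m<d. (if m \<in> B then 1 else -1) * (pi * real_of_int (k m) * x m - \<theta> m)))"
      unfolding trig_def tensor_def fac by (rule prod_cos)
    also have "\<dots> = (\<Sum>B\<in>Pow {..<d}. (1 / 2 ^ d) * wave d (P B) x)"
    proof (rule sum.cong[OF refl])
      fix B
      have "(\<Sum>m<d. (if m \<in> B then 1 else -1) * (pi * real_of_int (k m) * x m - \<theta> m))
        = (\<Sum>m<d. pi * real_of_int (\<sigma> B m * k m) * x m - real_of_int (\<sigma> B m) * \<theta> m)"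
        by (intro sum.cong refl) (simp add: \<sigma>_def)
      then show "(1 / 2 ^ d) * cos (\<Sum>m<d. (if m \<in> B then 1 else -1) * (pi * real_of_int (k m) * x m - \<theta> m))
        = (1 / 2 ^ d) * wave d (P B) x"
        by (simp add: wave_def P_def sum_subtractf)
    qed
    finally show ?thesis .
  qed
  have w: "wt d (fst (P B)) = wt d k" for B
  proof -
    have "(real_of_int (\<sigma> B m * k m))\<^sup>2 = (real_of_int (k m))\<^sup>2" for m
      by (cases "m \<in> B") (auto simp: \<sigma>_def)
    then show ?thesis by (simp add: wt_def P_def)
  qed
  have "combo (wave d) (\<lambda>p. wt d (fst p)) (\<Sum>B\<in>Pow {..<d}. \<bar>1 / 2 ^ d\<bar> * wt d (fst (P B)))
      (\<lambda>x. \<Sum>B\<in>Pow {..<d}. (1 / 2 ^ d) * wave d (P B) x)"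
    by (intro combo_sum combo_scale combo_atom) simp
  moreover have "(\<Sum>B\<in>Pow {..<d}. \<bar>1 / 2 ^ d\<bar> * wt d (fst (P B))) = wt d k"
    by (simp add: w card_Pow)
  ultimately show ?thesis by (simp add: eq[abs_def])
qed


lemma cos_network_wave:
  "cos_network d k a (\<lambda>i j. pi * real_of_int (z i j)) b x = 1 / real k * (\<Sum>i=1..k. a i * wave d (z i, b i) x)"
  by (simp add: cos_network_def wave_def)

lemma wt_L2_set: "1 + (L2_set (\<lambda>j. pi * real_of_int (z j)) {..<d})\<^sup>2 = wt d z"
  by (simp add: wt_def L2_set_def sum_nonneg power_mult_distrib sum_distrib_left)

lemma exp_basis_cis: "exp_basis d \<omega> x = cis (\<Sum>j<d. pi * real_of_int (\<omega> j) * x j)"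
  by (simp add: exp_basis_def cis_conv_exp sum_distrib_left mult.assoc)

text \<open>Every cosine with frequency in \<open>\<pi> \<int>\<^sup>d\<close> is half the sum of two exponentials.\<close>

lemma network_barron_norm:
  assumes "(\<Sum>i\<in>I. \<bar>a i\<bar> * wt d (z i)) \<le> M" and I: "finite I"
  shows "barron_e_norm d 2 (\<lambda>x. \<Sum>i\<in>I. a i * wave d (z i, b i) x) \<le> ennreal M"
proof -
  \<comment> \<open>The index set consists of extensional functions. Frequencies may coincide, so coefficients are sums over \<open>I\<close>.\<close>
  define r where "r i = restrict (z i) {..<d}" for i
  define r' where "r' i = restrict (\<lambda>j. - z i j) {..<d}" for i
  define \<alpha> where "\<alpha> \<omega> = (\<Sum>i\<in>I. (if \<omega> = r i then complex_of_real (a i / 2) * cis (b i) else 0)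
      + (if \<omega> = r' i then complex_of_real (a i / 2) * cis (- b i) else 0))" for \<omega>
  define S where "S = r ` I \<union> r' ` I"
  define W where "W \<omega> = 1 + pi ^ 2 * (L2_set (\<lambda>i. real_of_int (\<omega> i)) {..<d}) ^ 2" for \<omega> :: "nat \<Rightarrow> int"
  have "r i \<in> Zd d" "r' i \<in> Zd d" for i
    unfolding r_def r'_def Zd_def PiE_def by simp_all
  then have S: "finite S" "S \<subseteq> Zd d" using I by (auto simp: S_def)
  have \<alpha>0: "\<alpha> \<omega> = 0" if "\<omega> \<notin> S" for \<omega>
    unfolding \<alpha>_def using that by (intro sum.neutral) (auto simp: S_def)
  have expand: "(\<Sum>\<omega>\<in>F. \<alpha> \<omega> * exp_basis d \<omega> x) = complex_of_real (\<Sum>i\<in>I. a i * wave d (z i, b i) x)"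
    if F: "finite F" "S \<subseteq> F" for F x
  proof -
    have "(\<Sum>\<omega>\<in>F. \<alpha> \<omega> * exp_basis d \<omega> x) = (\<Sum>\<omega>\<in>F. \<Sum>i\<in>I.
        (if \<omega> = r i then complex_of_real (a i / 2) * cis (b i) * exp_basis d \<omega> x else 0)
      + (if \<omega> = r' i then complex_of_real (a i / 2) * cis (- b i) * exp_basis d \<omega> x else 0))"
      unfolding \<alpha>_def sum_distrib_right by (intro sum.cong refl) (simp add: distrib_right)
    also have "\<dots> = (\<Sum>i\<in>I. \<Sum>\<omega>\<in>F.
        (if \<omega> = r i then complex_of_real (a i / 2) * cis (b i) * exp_basis d \<omega> x else 0)
      + (if \<omega> = r' i then complex_of_real (a i / 2) * cis (- b i) * exp_basis d \<omega> x else 0))"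
      by (rule sum.swap)
    also have "\<dots> = (\<Sum>i\<in>I. complex_of_real (a i * wave d (z i, b i) x))"
    proof (rule sum.cong[OF refl])
      fix i assume i: "i \<in> I"
      have m: "r i \<in> F" "r' i \<in> F" using i F(2) by (auto simp: S_def)
      let ?s = "\<Sum>j<d. pi * real_of_int (z i j) * x j"
      have e: "exp_basis d (r i) x = cis ?s" "exp_basis d (r' i) x = cis (- ?s)"
        unfolding exp_basis_cis by (simp_all add: r_def r'_def sum_negf)
      have "(\<Sum>\<omega>\<in>F. (if \<omega> = r i then complex_of_real (a i / 2) * cis (b i) * exp_basis d \<omega> x else 0)
        + (if \<omega> = r' i then complex_of_real (a i / 2) * cis (- b i) * exp_basis d \<omega> x else 0))
        = complex_of_real (a i / 2) * cis (b i) * cis ?s + complex_of_real (a i / 2) * cis (- b i) * cis (- ?s)"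
        using F(1) m by (simp add: sum.distrib e)
      also have "\<dots> = complex_of_real (a i / 2) * (cis (?s + b i) + cis (- (?s + b i)))"
        by (simp add: cis_mult distrib_left mult.assoc add.commute)
      also have "\<dots> = complex_of_real (a i * wave d (z i, b i) x)"
      proof -
        have "complex_of_real (A / 2) * (cis y + cis (- y)) = complex_of_real (A * cos y)" for A y
          by (simp add: complex_eq_iff)
        then show ?thesis unfolding wave_def fst_conv snd_conv .
      qed
      finally show "(\<Sum>\<omega>\<in>F. (if \<omega> = r i then complex_of_real (a i / 2) * cis (b i) * exp_basis d \<omega> x else 0)
        + (if \<omega> = r' i then complex_of_real (a i / 2) * cis (- b i) * exp_basis d \<omega> x else 0))
        = complex_of_real (a i * wave d (z i, b i) x)" .
    qed
    finally show ?thesis by simp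
  qed
  have exp: "has_L2_expansion d (Zd d) (exp_basis d) \<alpha> (\<lambda>x. complex_of_real (\<Sum>i\<in>I. a i * wave d (z i, b i) x))"
    unfolding has_L2_expansion_def
  proof (rule tendsto_eventually)
    show "\<forall>\<^sub>F F in finite_subsets_at_top (Zd d). (\<integral>\<^sup>+x. ennreal ((norm (complex_of_real (\<Sum>i\<in>I. a i * wave d (z i, b i) x)
        - (\<Sum>k\<in>F. \<alpha> k * exp_basis d k x)))\<^sup>2) \<partial>leb d) = 0"
      unfolding eventually_finite_subsets_at_top
      by (intro exI[of _ S] conjI S allI impI) (simp add: expand)
  qed
  have Wr: "W (r i) = wt d (z i)" "W (r' i) = wt d (z i)" for i
    unfolding wt_L2_set[symmetric] W_def by (simp_all add: r_def r'_def L2_set_def power_mult_distrib sum_nonneg sum_distrib_left)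
  have W0: "0 \<le> W \<omega>" for \<omega> by (simp add: W_def)
  have "(\<Sum>\<omega>\<in>S. cmod (\<alpha> \<omega>) * W \<omega>) \<le> (\<Sum>\<omega>\<in>S. \<Sum>i\<in>I. (if \<omega> = r i then \<bar>a i\<bar> / 2 * W \<omega> else 0)
      + (if \<omega> = r' i then \<bar>a i\<bar> / 2 * W \<omega> else 0))"
  proof (rule sum_mono)
    fix \<omega>
    have "cmod (\<alpha> \<omega>) \<le> (\<Sum>i\<in>I. (if \<omega> = r i then \<bar>a i\<bar> / 2 else 0) + (if \<omega> = r' i then \<bar>a i\<bar> / 2 else 0))"
      unfolding \<alpha>_def
      by (rule order_trans[OF norm_sum]) (intro sum_mono order_trans[OF norm_triangle_ineq] add_mono, auto simp: norm_mult)
    then have "cmod (\<alpha> \<omega>) * W \<omega> \<le> (\<Sum>i\<in>I. (if \<omega> = r i then \<bar>a i\<bar> / 2 else 0) + (if \<omega> = r' i then \<bar>a i\<bar> / 2 else 0)) * W \<omega>"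
      by (rule mult_right_mono[OF _ W0])
    also have "\<dots> = (\<Sum>i\<in>I. (if \<omega> = r i then \<bar>a i\<bar> / 2 * W \<omega> else 0) + (if \<omega> = r' i then \<bar>a i\<bar> / 2 * W \<omega> else 0))"
      unfolding sum_distrib_right by (intro sum.cong refl) (simp add: distrib_right)
    finally show "cmod (\<alpha> \<omega>) * W \<omega> \<le> \<dots>" .
  qed
  also have "\<dots> = (\<Sum>i\<in>I. \<Sum>\<omega>\<in>S. (if \<omega> = r i then \<bar>a i\<bar> / 2 * W \<omega> else 0)
      + (if \<omega> = r' i then \<bar>a i\<bar> / 2 * W \<omega> else 0))"
    by (rule sum.swap)
  also have "\<dots> = (\<Sum>i\<in>I. \<bar>a i\<bar> * wt d (z i))"
  proof (rule sum.cong[OF refl])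
    fix i assume i: "i \<in> I"
    have m: "r i \<in> S" "r' i \<in> S" using i by (auto simp: S_def)
    show "(\<Sum>\<omega>\<in>S. (if \<omega> = r i then \<bar>a i\<bar> / 2 * W \<omega> else 0) + (if \<omega> = r' i then \<bar>a i\<bar> / 2 * W \<omega> else 0))
      = \<bar>a i\<bar> * wt d (z i)"
      using S(1) m by (simp add: sum.distrib Wr)
  qed
  finally have sM: "(\<Sum>\<omega>\<in>S. cmod (\<alpha> \<omega>) * W \<omega>) \<le> M" using assms(1) by linarith
  have "barron_e_norm d 2 (\<lambda>x. \<Sum>i\<in>I. a i * wave d (z i, b i) x) \<le> (\<Sum>\<^sub>\<infinity>\<omega>\<in>Zd d. ennreal (cmod (\<alpha> \<omega>) * W \<omega>))"
    unfolding barron_e_norm_def W_def by (rule INF_lower) (use exp in simp)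
  also have "\<dots> = (\<Sum>\<^sub>\<infinity>\<omega>\<in>S. ennreal (cmod (\<alpha> \<omega>) * W \<omega>))"
    by (rule infsum_cong_neutral) (use S(2) \<alpha>0 in auto)
  also have "\<dots> = (\<Sum>\<omega>\<in>S. ennreal (cmod (\<alpha> \<omega>) * W \<omega>))" by (rule infsum_finite[OF S(1)])
  also have "\<dots> = ennreal (\<Sum>\<omega>\<in>S. cmod (\<alpha> \<omega>) * W \<omega>)" by (rule sum_ennreal) (simp add: W0)
  also have "\<dots> \<le> ennreal M" by (rule ennreal_leI[OF sM])
  finally show ?thesis .
qed

text \<open>Sampling turns a combination of mass \<open>M\<close> into a network of width \<open>k\<close>.\<close>

lemma network_approximation:
  assumes d: "0 < d" and u: "combo (trig d D) (wt d) M u" and k: "1 \<le> k"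
  shows "\<exists>a w b. (\<forall>i\<in>{1..k}. \<bar>a i\<bar> \<le> M \<and> (\<forall>j<d. \<exists>z::int. w i j = pi * real_of_int z)) \<and>
    1 / real k * (\<Sum>i=1..k. \<bar>a i\<bar> * (1 + (L2_set (w i) {..<d})\<^sup>2)) \<le> M \<and>
    barron_e_norm d 2 (cos_network d k a w b) \<le> ennreal M \<and>
    cos_network d k a w b \<in> H1 d \<and>
    H1_norm d (\<lambda>x. cos_network d k a w b x + (-1) * u x) \<le> M / sqrt (real k)"
proof -
  have uw: "combo (wave d) (\<lambda>p. wt d (fst p)) M u" by (rule combo_trans[OF u trig_combo_wave])
  have le: "H1_inner d (wave d p) (wave d p) \<le> (wt d (fst p))\<^sup>2" for p
  proof -
    have "wt d (fst p) * 1 \<le> wt d (fst p) * wt d (fst p)"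
      using wt_ge_1[of d "fst p"] by (intro mult_left_mono) auto
    then show ?thesis using wave_H1_inner[OF d, of p] by (simp add: power2_eq_square)
  qed
  obtain q s where s: "\<And>n. n < k \<Longrightarrow> \<bar>s n\<bar> * wt d (fst (q n)) \<le> M"
    and RV: "(\<lambda>x. (\<Sum>n<k. s n * wave d (q n) x) - real k * u x) \<in> H1 d"
    and R: "H1_inner d (\<lambda>x. (\<Sum>n<k. s n * wave d (q n) x) - real k * u x)
        (\<lambda>x. (\<Sum>n<k. s n * wave d (q n) x) - real k * u x) \<le> real k * M\<^sup>2"
    using H1.maurey[OF uw wave_H1[OF d] wt_pos le, of k] by blast
  have uH: "u \<in> H1 d" by (rule H1.combo_in[OF uw wave_H1[OF d]])
  have M: "0 \<le> M" by (rule combo_nonneg[OF uw less_imp_le[OF wt_pos]])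
  define a where "a i = s (i - 1)" for i
  define z where "z i = fst (q (i - 1))" for i
  define b where "b i = snd (q (i - 1))" for i
  let ?w = "\<lambda>i j. pi * real_of_int (z i j)"
  have shift: "(\<Sum>i=1..k. g (i - 1)) = (\<Sum>n<k. g n)" for g :: "nat \<Rightarrow> real"
    by (rule sum.reindex_bij_witness[of _ Suc "\<lambda>i. i - 1"]) auto
  have mass: "\<bar>a i\<bar> * wt d (z i) \<le> M" if "i \<in> {1..k}" for i
    unfolding a_def z_def using that by (intro s) auto
  have k0: "0 < real k" using k by simp
  have net: "cos_network d k a ?w b = (\<lambda>x. (1 / real k) * (\<Sum>n<k. s n * wave d (q n) x))"
  proof
    fix x
    have "(\<Sum>i=1..k. a i * wave d (z i, b i) x) = (\<Sum>n<k. s n * wave d (q n) x)"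
      using shift[of "\<lambda>n. s n * wave d (q n) x"] by (simp add: a_def z_def b_def)
    then show "cos_network d k a ?w b x = (1 / real k) * (\<Sum>n<k. s n * wave d (q n) x)"
      unfolding cos_network_wave by simp
  qed
  have err_eq: "(\<lambda>x. cos_network d k a ?w b x + (-1) * u x)
      = (\<lambda>x. (1 / real k) * ((\<Sum>n<k. s n * wave d (q n) x) - real k * u x))"
    unfolding net using k0 by (auto simp: fun_eq_iff field_simps)
  have errV: "(\<lambda>x. cos_network d k a ?w b x + (-1) * u x) \<in> H1 d"
    unfolding err_eq by (rule H1.scale_in[OF RV])
  have "(\<lambda>x. (cos_network d k a ?w b x + (-1) * u x) + 1 * u x) \<in> H1 d"
    by (rule H1_lincomb[OF errV uH])
  then have netH: "cos_network d k a ?w b \<in> H1 d" by simp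
  have "H1_norm d (\<lambda>x. cos_network d k a ?w b x + (-1) * u x)
      = \<bar>1 / real k\<bar> * H1_norm d (\<lambda>x. (\<Sum>n<k. s n * wave d (q n) x) - real k * u x)"
    unfolding err_eq by (rule H1_norm_scale[OF RV])
  also have "\<dots> \<le> \<bar>1 / real k\<bar> * sqrt (real k * M\<^sup>2)"
    unfolding H1_norm_def by (intro mult_left_mono real_sqrt_le_mono R) simp
  also have "\<dots> = M / sqrt (real k)"
    using M k0 by (simp add: real_sqrt_mult real_div_sqrt field_simps)
  finally have err: "H1_norm d (\<lambda>x. cos_network d k a ?w b x + (-1) * u x) \<le> M / sqrt (real k)" .
  have avg: "1 / real k * (\<Sum>i=1..k. \<bar>a i\<bar> * wt d (z i)) \<le> M"
  proof -
    have "(\<Sum>i=1..k. \<bar>a i\<bar> * wt d (z i)) \<le> (\<Sum>i=1..k. M)" by (rule sum_mono[OF mass])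
    then show ?thesis using k0 by (simp add: divide_le_eq mult.commute)
  qed
  have "(\<Sum>i\<in>{1..k}. \<bar>1 / real k * a i\<bar> * wt d (z i)) = 1 / real k * (\<Sum>i=1..k. \<bar>a i\<bar> * wt d (z i))"
    by (simp add: abs_mult sum_divide_distrib)
  then have "barron_e_norm d 2 (\<lambda>x. \<Sum>i\<in>{1..k}. (1 / real k * a i) * wave d (z i, b i) x) \<le> ennreal M"
    using avg by (intro network_barron_norm) auto
  moreover have "cos_network d k a ?w b = (\<lambda>x. \<Sum>i\<in>{1..k}. (1 / real k * a i) * wave d (z i, b i) x)"
    unfolding cos_network_wave[abs_def] by (simp add: sum_distrib_left)
  ultimately have bar: "barron_e_norm d 2 (cos_network d k a ?w b) \<le> ennreal M" by simp
  have "\<bar>a i\<bar> \<le> M" if "i \<in> {1..k}" for i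
    using mult_left_mono[OF wt_ge_1[of d "z i"] abs_ge_zero[of "a i"]] mass[OF that] by linarith
  then show ?thesis
    using avg err bar netH by (intro exI[of _ a] exI[of _ ?w] exI[of _ b]) (auto simp: wt_L2_set)
qed

section \<open>The rates\<close>

locale rate_constants =
  fixes amin amax cmin cmax lA lc lf F :: real
  assumes lam: "0 < lam_min amin cmin" "lam_min amin cmin \<le> lam_max amax cmax"
    and nonneg: "0 \<le> lA" "0 < lc" "0 \<le> lf" "0 \<le> F"
begin

abbreviation "\<mu> \<equiv> lam_min amin cmin"
abbreviation "\<Lambda> \<equiv> lam_max amax cmax"
abbreviation "\<alpha> \<equiv> alpha_star amin amax cmin cmax"
abbreviation "\<beta> \<equiv> beta_star amin amax cmin cmax"
abbreviation "p d \<equiv> p_const amin amax cmin cmax lA lc d"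
abbreviation "T \<epsilon> \<equiv> T_const amin amax cmin cmax F \<epsilon>"
abbreviation "M d \<epsilon> \<equiv> M_const amin amax cmin cmax lA lc lf F d \<epsilon>"

lemma alpha_pos: "0 < \<alpha>"
  using lam by (simp add: alpha_star_def)

lemma beta_bounds: "0 \<le> \<beta>" "\<beta> < 1"
proof -
  have "\<mu>\<^sup>2 \<le> \<Lambda>\<^sup>2" using lam by (intro power_mono) auto
  then show "0 \<le> \<beta>" using lam by (simp add: beta_star_def divide_le_eq)
  have "0 < \<mu>\<^sup>2 / \<Lambda>\<^sup>2" using lam by (intro divide_pos_pos) auto
  then show "\<beta> < 1" by (simp add: beta_star_def)
qed

lemma ln_beta: "\<beta> \<noteq> 0 \<Longrightarrow> 0 < \<bar>ln \<beta>\<bar>"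
  using beta_bounds by simp

lemma T_ge:
  assumes "\<beta> \<noteq> 0"
  shows "log_plus (2 * F / (\<epsilon> * \<mu>)) \<le> real (T \<epsilon>) * \<bar>ln \<beta>\<bar>"
proof -
  have "log_plus (2 * F / (\<epsilon> * \<mu>)) / \<bar>ln \<beta>\<bar> \<le> real (T \<epsilon>)"
    unfolding T_const_def using assms by (simp add: real_nat_ceiling_ge)
  then show ?thesis using ln_beta[OF assms] by (simp add: divide_le_eq)
qed

text \<open>For \<open>\<beta> > 0\<close> and \<open>F > 0\<close> the number of steps is chosen so that \<open>\<beta>\<^sup>T \<le> \<epsilon> \<mu> / (2 F)\<close>.\<close>

lemma contraction_suffices:
  assumes \<epsilon>: "0 < \<epsilon>"
  shows "\<beta> ^ T \<epsilon> * (F / \<mu>) \<le> \<epsilon> / 2"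
proof (cases "\<beta> = 0 \<or> F = 0")
  case True
  then show ?thesis using \<epsilon> by (auto simp: T_const_def)
next
  case False
  then have b: "0 < \<beta>" and F: "0 < F" using beta_bounds nonneg by auto
  let ?t = "2 * F / (\<epsilon> * \<mu>)"
  have t: "0 < ?t" using F \<epsilon> lam by simp
  then have "ln ?t \<le> log_plus ?t" by (simp add: log_plus_def)
  also have "\<dots> \<le> real (T \<epsilon>) * \<bar>ln \<beta>\<bar>" by (rule T_ge) (use b in simp)
  also have "\<bar>ln \<beta>\<bar> = - ln \<beta>" using b beta_bounds(2) by simp
  finally have le: "real (T \<epsilon>) * ln \<beta> \<le> - ln ?t" by simp
  have "\<beta> ^ T \<epsilon> = exp (real (T \<epsilon>) * ln \<beta>)" using b by (simp add: exp_of_nat_mult)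
  also have "\<dots> \<le> exp (- ln ?t)" using le by simp
  also have "\<dots> = 1 / ?t" using exp_ln[OF t] by (simp add: exp_minus inverse_eq_divide)
  finally have "\<beta> ^ T \<epsilon> * (F / \<mu>) \<le> 1 / ?t * (F / \<mu>)" using F lam by (intro mult_right_mono) auto
  also have "\<dots> = \<epsilon> / 2" using F \<epsilon> lam by (simp add: field_simps)
  finally show ?thesis .
qed

lemma p_gt_1: "1 + \<alpha> * lc \<le> p d"
  unfolding p_const_def using alpha_pos nonneg by simp

lemma M_eq: "M d \<epsilon> = \<alpha> * lf / 2 * (\<Sum>t<T \<epsilon>. p d ^ t)"
proof -
  have "p d \<noteq> 1" using p_gt_1[of d] mult_pos_pos[OF alpha_pos nonneg(2)] by linarith
  then show ?thesis by (simp add: M_const_def Let_def geometric_sum)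
qed

lemma M_nonneg: "0 \<le> M d \<epsilon>"
proof -
  have "0 \<le> p d" using p_gt_1[of d] mult_pos_pos[OF alpha_pos nonneg(2)] by linarith
  then show ?thesis unfolding M_eq using alpha_pos nonneg by (intro mult_nonneg_nonneg sum_nonneg) auto
qed

text \<open>The factor \<open>(1 + \<pi>) / \<pi>\<close> in \<open>p(d)\<close> is at least \<open>1\<close>, so the growth factor of the mass is at most \<open>p(d)\<close>.\<close>

lemma iteration_mass:
  "(\<Sum>t<T \<epsilon>. (1 + \<mu> / \<Lambda>\<^sup>2 * (lA * (real d)\<^sup>2 + lc)) ^ t * (\<mu> / \<Lambda>\<^sup>2 * (lf / 2))) \<le> M d \<epsilon>"
proof -
  let ?q = "1 + \<alpha> * (lA * (real d)\<^sup>2 + lc)"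
  have "1 * (\<alpha> * lA * (real d)\<^sup>2) \<le> (1 + pi) / pi * (\<alpha> * lA * (real d)\<^sup>2)"
    using alpha_pos nonneg by (intro mult_right_mono mult_nonneg_nonneg) auto
  then have qp: "?q \<le> p d" unfolding p_const_def by (simp add: algebra_simps)
  have q0: "0 \<le> ?q" using alpha_pos nonneg by (intro add_nonneg_nonneg mult_nonneg_nonneg) auto
  have "(\<Sum>t<T \<epsilon>. ?q ^ t * (\<alpha> * (lf / 2))) \<le> (\<Sum>t<T \<epsilon>. p d ^ t * (\<alpha> * (lf / 2)))"
    using alpha_pos nonneg by (intro sum_mono mult_right_mono power_mono qp q0) auto
  also have "\<dots> = M d \<epsilon>" unfolding M_eq sum_distrib_right[symmetric] by simp
  finally show ?thesis unfolding alpha_star_def .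
qed

text \<open>Since \<open>|ln \<epsilon>| \<ge> ln 2\<close>, additive constants are bounded by multiples of \<open>|ln \<epsilon>|\<close>.\<close>

lemma T_le:
  obtains \<tau> where "0 < \<tau>" "\<And>\<epsilon>. 0 < \<epsilon> \<Longrightarrow> \<epsilon> < 1/2 \<Longrightarrow> real (T \<epsilon>) \<le> \<tau> * \<bar>ln \<epsilon>\<bar>"
proof
  define L0 where "L0 = max 0 (ln (2 * F / \<mu>))"
  define \<tau> where "\<tau> = (L0 / ln 2 + 1) / \<bar>ln \<beta>\<bar> + 1 / ln 2"
  have L0: "0 \<le> L0" by (simp add: L0_def)
  show "0 < \<tau>" unfolding \<tau>_def using L0 by (intro add_nonneg_pos divide_nonneg_nonneg) auto
  fix \<epsilon> :: real assume \<epsilon>: "0 < \<epsilon>" "\<epsilon> < 1/2"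
  have "ln \<epsilon> < ln (1/2)" using \<epsilon> by simp
  then have l2: "ln 2 \<le> \<bar>ln \<epsilon>\<bar>" by (simp add: ln_div)
  have ln2: "0 < ln (2::real)" by simp
  have one: "1 \<le> \<bar>ln \<epsilon>\<bar> / ln 2" using l2 ln2 by simp
  show "real (T \<epsilon>) \<le> \<tau> * \<bar>ln \<epsilon>\<bar>"
  proof (cases "\<beta> = 0")
    case True
    \<comment> \<open>Here \<open>T = 1\<close>, and the first summand of \<open>\<tau>\<close> is \<open>0\<close> because \<open>ln 0 = 0\<close> and \<open>x / 0 = 0\<close>.\<close>
    then show ?thesis using one by (simp add: T_const_def \<tau>_def)
  next
    case False
    let ?t = "2 * F / (\<epsilon> * \<mu>)"
    have "log_plus ?t \<le> L0 + \<bar>ln \<epsilon>\<bar>"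
    proof (cases "F = 0")
      case True
      then show ?thesis using L0 by (simp add: log_plus_def)
    next
      case False
      then have F: "0 < F" using nonneg by simp
      have "ln ?t = ln (2 * F / \<mu> / \<epsilon>)" by (simp add: field_simps)
      also have "\<dots> = ln (2 * F / \<mu>) - ln \<epsilon>" using F \<epsilon> lam by (subst ln_div) auto
      finally show ?thesis unfolding log_plus_def L0_def by auto
    qed
    also have "\<dots> \<le> L0 * (\<bar>ln \<epsilon>\<bar> / ln 2) + \<bar>ln \<epsilon>\<bar>"
      using mult_left_mono[OF one L0] by simp
    also have "\<dots> = (L0 / ln 2 + 1) * \<bar>ln \<epsilon>\<bar>" by (simp add: field_simps)
    finally have "log_plus ?t / \<bar>ln \<beta>\<bar> \<le> (L0 / ln 2 + 1) * \<bar>ln \<epsilon>\<bar> / \<bar>ln \<beta>\<bar>"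
      by (rule divide_right_mono) simp
    moreover have "0 \<le> log_plus ?t / \<bar>ln \<beta>\<bar>" by (simp add: log_plus_def)
    then have "real (T \<epsilon>) \<le> log_plus ?t / \<bar>ln \<beta>\<bar> + 1"
      unfolding T_const_def using False of_int_ceiling_le_add_one[of "log_plus ?t / \<bar>ln \<beta>\<bar>"] by simp
    moreover have "\<tau> * \<bar>ln \<epsilon>\<bar> = (L0 / ln 2 + 1) * \<bar>ln \<epsilon>\<bar> / \<bar>ln \<beta>\<bar> + \<bar>ln \<epsilon>\<bar> / ln 2"
      by (simp add: \<tau>_def distrib_right)
    ultimately show ?thesis using one by linarith
  qed
qed

text \<open>The number of neurons that makes the sampling error at most \<open>\<epsilon> / 4\<close>.\<close>

definition width :: "nat \<Rightarrow> real \<Rightarrow> nat" where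
  "width d \<epsilon> = nat \<lceil>16 * (M d \<epsilon>)\<^sup>2 / \<epsilon>\<^sup>2\<rceil> + 1"

lemma sampling_error:
  assumes "0 < \<epsilon>" shows "M d \<epsilon> / sqrt (real (width d \<epsilon>)) \<le> \<epsilon> / 4"
proof -
  have "16 * (M d \<epsilon>)\<^sup>2 / \<epsilon>\<^sup>2 \<le> real (width d \<epsilon>)"
    unfolding width_def of_nat_add using real_nat_ceiling_ge[of "16 * (M d \<epsilon>)\<^sup>2 / \<epsilon>\<^sup>2"] by linarith
  then have "sqrt ((4 * M d \<epsilon> / \<epsilon>)\<^sup>2) \<le> sqrt (real (width d \<epsilon>))"
    by (intro real_sqrt_le_mono) (simp add: power_divide power_mult_distrib)
  then have "4 * M d \<epsilon> / \<epsilon> \<le> sqrt (real (width d \<epsilon>))"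
    unfolding real_sqrt_abs using M_nonneg[of d \<epsilon>] assms by simp
  moreover have "0 < width d \<epsilon>" by (simp add: width_def)
  then have "0 < sqrt (real (width d \<epsilon>))" by simp
  ultimately show ?thesis using assms by (simp add: field_simps)
qed

text \<open>With \<open>p(d) \<le> P d\<^sup>2\<close> and \<open>P \<le> d\<close> raised to \<open>log\<^sub>2 P\<close>, all factors become powers of \<open>d \<ge> 2\<close>, also
  \<open>1 / \<epsilon>\<^sup>2 = exp (2 |ln \<epsilon>|)\<close>.\<close>

lemma polynomial_rates:
  "\<exists>C0>0. \<exists>C1>0. \<exists>C2>0. \<forall>d\<ge>2. \<forall>\<epsilon>. 0 < \<epsilon> \<and> \<epsilon> < 1/2 \<longrightarrow>
     M d \<epsilon> \<le> C0 * real d powr (C2 * \<bar>ln \<epsilon>\<bar>) \<and> real (width d \<epsilon>) \<le> C0 * real d powr (C1 * \<bar>ln \<epsilon>\<bar>)"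
proof -
  obtain \<tau> where \<tau>: "0 < \<tau>" "\<And>\<epsilon>. 0 < \<epsilon> \<Longrightarrow> \<epsilon> < 1/2 \<Longrightarrow> real (T \<epsilon>) \<le> \<tau> * \<bar>ln \<epsilon>\<bar>" by (rule T_le) (rule that; assumption)
  define P where "P = (1 + pi) / pi * \<alpha> * lA + \<alpha> * lc + 1"
  have P1: "1 \<le> P" unfolding P_def using alpha_pos nonneg by (simp add: add_nonneg_nonneg)
  define G where "G = 2 + log 2 P"
  have G: "0 < G" unfolding G_def using P1 by (simp add: add_pos_nonneg zero_le_log_cancel_iff)
  \<comment> \<open>From \<open>p(d) - 1 \<ge> \<alpha> l\<^sub>c\<close> in the denominator of \<open>M\<close>.\<close>
  define K where "K = lf / (2 * lc)"
  have K: "0 \<le> K" unfolding K_def using nonneg by simp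
  define C2 where "C2 = G * \<tau>"
  define C1 where "C1 = 2 * C2 + 2 / ln 2"
  have C2: "0 < C2" unfolding C2_def using G \<tau> by simp
  have C1: "0 < C1" unfolding C1_def using C2 by (simp add: add_pos_pos)
  have Mle: "M d \<epsilon> \<le> K * real d powr (C2 * \<bar>ln \<epsilon>\<bar>)" if d: "2 \<le> d" and \<epsilon>: "0 < \<epsilon>" "\<epsilon> < 1/2" for d \<epsilon>
  proof -
    have d': "2 \<le> real d" using d by simp
    have ac: "0 < \<alpha> * lc" by (rule mult_pos_pos[OF alpha_pos nonneg(2)])
    have p1: "1 \<le> p d" using p_gt_1[of d] ac by linarith
    have d1: "1 \<le> (real d)\<^sup>2" using d' by (simp add: one_le_power)
    have "p d \<le> P * (real d)\<^sup>2"
    proof -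
      have "(\<alpha> * lc + 1) * 1 \<le> (\<alpha> * lc + 1) * (real d)\<^sup>2"
        using ac by (intro mult_left_mono d1) auto
      then show ?thesis unfolding p_const_def P_def by (simp add: algebra_simps)
    qed
    also have "\<dots> \<le> real d powr log 2 P * real d powr 2"
    proof (intro mult_mono)
      have "P = 2 powr log 2 P" using P1 by simp
      also have "\<dots> \<le> real d powr log 2 P"
        using d' P1 by (intro powr_mono2) (auto simp: zero_le_log_cancel_iff)
      finally show "P \<le> real d powr log 2 P" .
      show "(real d)\<^sup>2 \<le> real d powr 2" using d' by (simp add: powr_numeral)
    qed auto
    also have "\<dots> = real d powr G" unfolding G_def by (simp add: powr_add mult.commute)
    finally have pG: "p d \<le> real d powr G" .
    have "p d ^ T \<epsilon> \<le> (real d powr G) ^ T \<epsilon>" using p1 by (intro power_mono pG) auto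
    also have "\<dots> = real d powr (G * real (T \<epsilon>))" using d' by (simp add: powr_powr flip: powr_realpow)
    also have "\<dots> \<le> real d powr (C2 * \<bar>ln \<epsilon>\<bar>)"
      using d' mult_left_mono[OF \<tau>(2)[OF \<epsilon>] less_imp_le[OF G]] unfolding C2_def
      by (intro powr_mono) (auto simp: mult.assoc)
    finally have pT: "p d ^ T \<epsilon> \<le> real d powr (C2 * \<bar>ln \<epsilon>\<bar>)" .
    have "M d \<epsilon> = \<alpha> * lf * (p d ^ T \<epsilon> - 1) / (2 * (p d - 1))" by (simp add: M_const_def Let_def)
    also have "\<dots> \<le> \<alpha> * lf * p d ^ T \<epsilon> / (2 * (\<alpha> * lc))"
      using p_gt_1[of d] ac p1 alpha_pos nonneg
      by (intro frac_le mult_left_mono mult_nonneg_nonneg) (auto simp: one_le_power)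
    also have "\<dots> = K * p d ^ T \<epsilon>" unfolding K_def using alpha_pos by simp
    also have "\<dots> \<le> K * real d powr (C2 * \<bar>ln \<epsilon>\<bar>)" by (intro mult_left_mono pT K)
    finally show ?thesis .
  qed
  have Wle: "real (width d \<epsilon>) \<le> (16 * K\<^sup>2 + 2) * real d powr (C1 * \<bar>ln \<epsilon>\<bar>)"
    if d: "2 \<le> d" and \<epsilon>: "0 < \<epsilon>" "\<epsilon> < 1/2" for d \<epsilon>
  proof -
    have d': "2 \<le> real d" using d by simp
    let ?e = "\<bar>ln \<epsilon>\<bar>" and ?D = "real d powr (C1 * \<bar>ln \<epsilon>\<bar>)"
    have ln2: "0 < ln (2::real)" by simp
    have "1 / \<epsilon>\<^sup>2 = exp (2 * ?e)"
    proof -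
      have "?e = - ln \<epsilon>" using \<epsilon> by simp
      then have "exp (2 * ?e) = exp (- ln \<epsilon>) * exp (- ln \<epsilon>)" by (simp flip: exp_add)
      then show ?thesis using \<epsilon> by (simp add: exp_minus power2_eq_square field_simps)
    qed
    also have "\<dots> \<le> exp (2 / ln 2 * ?e * ln (real d))"
    proof -
      have "2 * ?e * 1 \<le> 2 * ?e * (ln (real d) / ln 2)"
        using d' ln2 by (intro mult_left_mono) auto
      then show ?thesis by (simp add: mult_ac)
    qed
    also have "\<dots> = real d powr (2 / ln 2 * ?e)" using d' by (simp add: powr_def)
    finally have e2: "1 / \<epsilon>\<^sup>2 \<le> real d powr (2 / ln 2 * ?e)" .
    have "(M d \<epsilon>)\<^sup>2 \<le> (K * real d powr (C2 * ?e))\<^sup>2" by (intro power_mono Mle d \<epsilon> M_nonneg)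
    also have "\<dots> = K\<^sup>2 * real d powr (2 * C2 * ?e)"
    proof -
      have "2 * C2 * ?e = C2 * ?e + C2 * ?e" by simp
      then show ?thesis by (simp only: powr_add power2_eq_square mult_ac)
    qed
    finally have M2: "(M d \<epsilon>)\<^sup>2 \<le> K\<^sup>2 * real d powr (2 * C2 * ?e)" .
    have "(M d \<epsilon>)\<^sup>2 * (1 / \<epsilon>\<^sup>2) \<le> (K\<^sup>2 * real d powr (2 * C2 * ?e)) * real d powr (2 / ln 2 * ?e)"
      by (intro mult_mono M2 e2) auto
    also have "\<dots> = K\<^sup>2 * ?D" unfolding C1_def by (simp add: distrib_right powr_add mult.assoc)
    finally have main: "16 * (M d \<epsilon>)\<^sup>2 / \<epsilon>\<^sup>2 \<le> 16 * K\<^sup>2 * ?D" by simp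
    have "0 \<le> C1 * ?e" using C1 by simp
    then have D1: "1 \<le> ?D" using d' by (simp add: ge_one_powr_ge_zero)
    have "real (width d \<epsilon>) \<le> 16 * (M d \<epsilon>)\<^sup>2 / \<epsilon>\<^sup>2 + 2"
    proof -
      have "real (nat \<lceil>x\<rceil>) \<le> x + 1" if "0 \<le> x" for x :: real
        using of_int_ceiling_le_add_one[of x] that by simp
      moreover have "0 \<le> 16 * (M d \<epsilon>)\<^sup>2 / \<epsilon>\<^sup>2" by simp
      ultimately have "real (nat \<lceil>16 * (M d \<epsilon>)\<^sup>2 / \<epsilon>\<^sup>2\<rceil>) \<le> 16 * (M d \<epsilon>)\<^sup>2 / \<epsilon>\<^sup>2 + 1" by blast
      then show ?thesis unfolding width_def of_nat_add by linarith
    qed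
    also have "\<dots> \<le> 16 * K\<^sup>2 * ?D + 2 * ?D" using main D1 by linarith
    finally show ?thesis by (simp add: distrib_right)
  qed
  have C0: "0 < 16 * K\<^sup>2 + K + 2" using K by (intro add_nonneg_pos) auto
  show ?thesis
  proof (rule exI[of _ "16 * K\<^sup>2 + K + 2"], rule conjI[OF C0], rule exI[of _ C1], rule conjI[OF C1],
      rule exI[of _ C2], rule conjI[OF C2], intro allI impI conjI)
    fix d :: nat and \<epsilon> :: real assume d: "2 \<le> d" and \<epsilon>: "0 < \<epsilon> \<and> \<epsilon> < 1/2"
    have "K * real d powr (C2 * \<bar>ln \<epsilon>\<bar>) \<le> (16 * K\<^sup>2 + K + 2) * real d powr (C2 * \<bar>ln \<epsilon>\<bar>)"
      by (intro mult_right_mono) auto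
    then show "M d \<epsilon> \<le> (16 * K\<^sup>2 + K + 2) * real d powr (C2 * \<bar>ln \<epsilon>\<bar>)" using Mle[OF d] \<epsilon> by force
    have "(16 * K\<^sup>2 + 2) * real d powr (C1 * \<bar>ln \<epsilon>\<bar>) \<le> (16 * K\<^sup>2 + K + 2) * real d powr (C1 * \<bar>ln \<epsilon>\<bar>)"
      using K by (intro mult_right_mono) auto
    then show "real (width d \<epsilon>) \<le> (16 * K\<^sup>2 + K + 2) * real d powr (C1 * \<bar>ln \<epsilon>\<bar>)" using Wle[OF d] \<epsilon> by force
  qed
qed

end


section \<open>The approximation theorem\<close>

lemma (in elliptic) rate_constants_holds:
  assumes "barron_assumptions d A c" "0 \<le> lf" "0 \<le> F"
  shows "rate_constants amin amax cmin cmax (ell_A d A) (ell_c d c) lf F"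
proof
  show "0 < \<mu>" "\<mu> \<le> \<Lambda>" by (rule lam)+
  show "0 < ell_c d c"
    by (rule approximable_pos[OF c_approximable[OF assms(1)] _ cmin_pos]) (use c_bounds in auto)
qed (use assms in \<open>auto simp: ell_A_def\<close>)

text \<open>The error budget is \<open>\<epsilon> / 2\<close> for the finite number of steps, \<open>\<epsilon> / 4\<close> for the truncations and \<open>\<epsilon> / 4\<close> for the
  sampling.\<close>

lemma (in elliptic) network_for_solution:
  assumes bc: "boundary_condition d D V" and b: "barron_assumptions d A c"
    and f: "approximable d D 0 lf f" and lf: "0 \<le> lf"
    and F: "0 \<le> F" "\<And>v. v \<in> V \<Longrightarrow> l2_inner d f v \<le> F * H1_norm d v"
    and u: "u \<in> V" "\<And>v. v \<in> V \<Longrightarrow> weak_identity d A c f u v" and \<epsilon>: "0 < \<epsilon>"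
    and M: "M = M_const amin amax cmin cmax (ell_A d A) (ell_c d c) lf F d \<epsilon>"
    and k: "k = rate_constants.width amin amax cmin cmax (ell_A d A) (ell_c d c) lf F d \<epsilon>"
  shows "\<exists>a w b. (\<forall>i\<in>{1..k}. \<bar>a i\<bar> \<le> M \<and> (\<forall>j<d. \<exists>z::int. w i j = pi * real_of_int z)) \<and>
    1 / real k * (\<Sum>i=1..k. \<bar>a i\<bar> * (1 + (L2_set (w i) {..<d})\<^sup>2)) \<le> M \<and>
    barron_e_norm d 2 (cos_network d k a w b) \<le> ennreal M \<and>
    H1_norm d (\<lambda>x. cos_network d k a w b x - u x) \<le> \<epsilon>"
proof -
  interpret boundary_condition d D V by (rule bc)
  interpret R: rate_constants amin amax cmin cmax "ell_A d A" "ell_c d c" lf F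
    by (rule rate_constants_holds[OF b lf F(1)])
  let ?T = "T_const amin amax cmin cmax F \<epsilon>" and ?\<beta> = "beta_star amin amax cmin cmax"
  have d: "0 < d" using d2 by simp
  have sol: "bform d A c u v = l2_inner d f v" if "v \<in> V" for v
    using u(2)[OF that] weak_identity_iff[OF V_H1[OF u(1)] V_H1[OF that]] by simp
  have n0: "0 \<le> nrm u" by (rule nrm_nonneg[OF u(1)])
  have "\<mu> * (nrm u)\<^sup>2 \<le> F * nrm u"
    using bform_coercive[OF V_H1[OF u(1)]] sol[OF u(1)] F(2)[OF u(1)] by (simp add: nrm_H1)
  then have apriori: "nrm u \<le> F / \<mu>"
    using n0 lam F(1) by (cases "nrm u = 0") (auto simp: power2_eq_square field_simps)
  have "\<exists>u'. combo (trig d D) (wt d)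
      (\<Sum>t<?T. (1 + \<mu> / \<Lambda>\<^sup>2 * (ell_A d A * (real d)\<^sup>2 + ell_c d c)) ^ t * (\<mu> / \<Lambda>\<^sup>2 * (lf / 2))) u' \<and>
    nrm (\<lambda>x. u' x + (-1) * u x) \<le> sqrt (1 - \<mu>\<^sup>2 / \<Lambda>\<^sup>2) ^ ?T * nrm u + \<epsilon> / 4"
  proof (rule iteration[OF coefficients_approximable[OF d2 b] c_approximable[OF b] f _ _ _ lam u(1) sol])
    fix v w z assume "v \<in> V" "w \<in> V" "z \<in> V"
    then show "bform d A c (\<lambda>x. v x + (-1) * w x) z = bform d A c v z - bform d A c w z"
      by (intro bform_left V_H1)
  next
    fix v w assume "v \<in> V" "w \<in> V"
    then show "\<bar>bform d A c v w\<bar> \<le> \<Lambda> * nrm v * nrm w"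
      unfolding nrm_H1 by (intro bform_bounded V_H1)
  next
    fix v assume "v \<in> V"
    then show "\<mu> * (nrm v)\<^sup>2 \<le> bform d A c v v" unfolding nrm_H1 by (intro bform_coercive V_H1)
  qed (use \<epsilon> in auto)
  then obtain u' where u': "combo (trig d D) (wt d)
      (\<Sum>t<?T. (1 + \<mu> / \<Lambda>\<^sup>2 * (ell_A d A * (real d)\<^sup>2 + ell_c d c)) ^ t * (\<mu> / \<Lambda>\<^sup>2 * (lf / 2))) u'"
    and le: "nrm (\<lambda>x. u' x + (-1) * u x) \<le> ?\<beta> ^ ?T * nrm u + \<epsilon> / 4"
    unfolding beta_star_def by blast
  have u'M: "combo (trig d D) (wt d) M u'"
    unfolding M by (rule combo_mono[OF u' R.iteration_mass])
  have "?\<beta> ^ ?T * nrm u \<le> ?\<beta> ^ ?T * (F / \<mu>)"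
    using R.beta_bounds(1) by (intro mult_left_mono apriori) auto
  with R.contraction_suffices[OF \<epsilon>] le have e1: "nrm (\<lambda>x. u' x + (-1) * u x) \<le> 3 * \<epsilon> / 4" by linarith
  have k1: "1 \<le> k" unfolding k R.width_def by simp
  from network_approximation[OF d u'M k1] obtain a w b where
    n: "\<forall>i\<in>{1..k}. \<bar>a i\<bar> \<le> M \<and> (\<forall>j<d. \<exists>z::int. w i j = pi * real_of_int z)"
      "1 / real k * (\<Sum>i=1..k. \<bar>a i\<bar> * (1 + (L2_set (w i) {..<d})\<^sup>2)) \<le> M"
      "barron_e_norm d 2 (cos_network d k a w b) \<le> ennreal M"
    and NH: "cos_network d k a w b \<in> H1 d"
    and e2: "H1_norm d (\<lambda>x. cos_network d k a w b x + (-1) * u' x) \<le> M / sqrt (real k)" by blast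
  have u'H: "u' \<in> H1 d" and uH: "u \<in> H1 d" using combo_in_V[OF u'] u(1) V_H1 by auto
  have "H1_norm d (\<lambda>x. (cos_network d k a w b x + (-1) * u' x) + 1 * (u' x + (-1) * u x))
      \<le> H1_norm d (\<lambda>x. cos_network d k a w b x + (-1) * u' x) + \<bar>1\<bar> * H1_norm d (\<lambda>x. u' x + (-1) * u x)"
    using H1.triangle[OF H1_lincomb[OF NH u'H] H1_lincomb[OF u'H uH]] unfolding H1_nrm .
  also have "\<dots> \<le> \<epsilon> / 4 + 1 * (3 * \<epsilon> / 4)"
  proof -
    have "M / sqrt (real k) \<le> \<epsilon> / 4" unfolding M k by (rule R.sampling_error[OF \<epsilon>])
    then show ?thesis using e1 e2 unfolding nrm_H1 by linarith
  qed
  finally have "H1_norm d (\<lambda>x. cos_network d k a w b x - u x) \<le> \<epsilon>" by simp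
  with n show ?thesis by blast
qed

text \<open>The part of the theorem that the two boundary conditions share: constants that serve all
  problems with the given data, whatever the dimension.\<close>

definition admissible_constants ::
  "real \<Rightarrow> real \<Rightarrow> real \<Rightarrow> real \<Rightarrow> real \<Rightarrow> real \<Rightarrow> real \<Rightarrow> real \<Rightarrow> real \<Rightarrow> real \<Rightarrow> real \<Rightarrow> bool" where
  "admissible_constants amin amax cmin cmax lA lc lf F C0 C1 C2 \<longleftrightarrow>
    (\<forall>d A c f D V u \<epsilon>. 2 \<le> d \<longrightarrow> basic_assumptions d amin amax cmin cmax A c f \<longrightarrow> barron_assumptions d A c \<longrightarrow>
      lA = ell_A d A \<longrightarrow> lc = ell_c d c \<longrightarrow> boundary_condition d D V \<longrightarrow> approximable d D 0 lf f \<longrightarrow>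
      0 \<le> lf \<longrightarrow> 0 \<le> F \<longrightarrow> (\<forall>v\<in>V. l2_inner d f v \<le> F * H1_norm d v) \<longrightarrow>
      u \<in> V \<longrightarrow> (\<forall>v\<in>V. weak_identity d A c f u v) \<longrightarrow> 0 < \<epsilon> \<longrightarrow> \<epsilon> < 1/2 \<longrightarrow>
      (let M = M_const amin amax cmin cmax lA lc lf F d \<epsilon> in
        M \<le> C0 * real d powr (C2 * \<bar>ln \<epsilon>\<bar>) \<and>
        (\<exists>k a w b.
          k \<ge> 1 \<and> real k \<le> C0 * real d powr (C1 * \<bar>ln \<epsilon>\<bar>) \<and>
          (\<forall>i\<in>{1..k}. \<bar>a i\<bar> \<le> M \<and> (\<forall>j<d. \<exists>z::int. w i j = pi * real_of_int z)) \<and>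
          1 / real k * (\<Sum>i=1..k. \<bar>a i\<bar> * (1 + (L2_set (w i) {..<d})\<^sup>2)) \<le> M \<and>
          barron_e_norm d 2 (cos_network d k a w b) \<le> ennreal M \<and>
          H1_norm d (\<lambda>x. cos_network d k a w b x - u x) \<le> \<epsilon>)))"

lemma uniform_constants:
  obtains C0 C1 C2 where "0 < C0" "0 < C1" "0 < C2"
    "admissible_constants amin amax cmin cmax lA lc lf F C0 C1 C2"
proof (cases "rate_constants amin amax cmin cmax lA lc lf F")
  case R: True
  obtain C0 C1 C2 :: real where C: "0 < C0" "0 < C1" "0 < C2"
    and rates: "\<And>d \<epsilon>. 2 \<le> d \<Longrightarrow> 0 < \<epsilon> \<Longrightarrow> \<epsilon> < 1/2 \<Longrightarrow>
      M_const amin amax cmin cmax lA lc lf F d \<epsilon> \<le> C0 * real d powr (C2 * \<bar>ln \<epsilon>\<bar>) \<and>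
      real (rate_constants.width amin amax cmin cmax lA lc lf F d \<epsilon>) \<le> C0 * real d powr (C1 * \<bar>ln \<epsilon>\<bar>)"
    using rate_constants.polynomial_rates[OF R] by metis
  have "admissible_constants amin amax cmin cmax lA lc lf F C0 C1 C2"
    unfolding admissible_constants_def
  proof (intro allI impI, goal_cases)
    case (1 d A c f D V u \<epsilon>)
    interpret elliptic d A c f amin amax cmin cmax by (rule elliptic.intro[OF 1(1,2)])
    let ?M = "M_const amin amax cmin cmax lA lc lf F d \<epsilon>"
    define k where "k = rate_constants.width amin amax cmin cmax lA lc lf F d \<epsilon>"
    have "1 \<le> k" unfolding k_def rate_constants.width_def[OF R] by simp
    moreover have "?M \<le> C0 * real d powr (C2 * \<bar>ln \<epsilon>\<bar>)" "real k \<le> C0 * real d powr (C1 * \<bar>ln \<epsilon>\<bar>)"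
      using rates[OF 1(1,13,14)] unfolding k_def by auto
    moreover have "\<exists>a w b. (\<forall>i\<in>{1..k}. \<bar>a i\<bar> \<le> ?M \<and> (\<forall>j<d. \<exists>z::int. w i j = pi * real_of_int z)) \<and>
        1 / real k * (\<Sum>i=1..k. \<bar>a i\<bar> * (1 + (L2_set (w i) {..<d})\<^sup>2)) \<le> ?M \<and>
        barron_e_norm d 2 (cos_network d k a w b) \<le> ennreal ?M \<and>
        H1_norm d (\<lambda>x. cos_network d k a w b x - u x) \<le> \<epsilon>"
      using network_for_solution[OF 1(6,3,7,8,9) bspec[OF 1(10)] 1(11) bspec[OF 1(12)] 1(13) refl refl]
      unfolding k_def 1(4,5) by blast
    ultimately show ?case unfolding Let_def by blast
  qed
  with C show ?thesis by (rule that)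
next
  \<comment> \<open>No problem has such data, and any constants will do.\<close>
  case False
  have "admissible_constants amin amax cmin cmax lA lc lf F 1 1 1"
    unfolding admissible_constants_def
  proof (intro allI impI, goal_cases)
    case (1 d A c f D V u \<epsilon>)
    interpret elliptic d A c f amin amax cmin cmax by (rule elliptic.intro[OF 1(1,2)])
    have "rate_constants amin amax cmin cmax lA lc lf F"
      unfolding 1(4,5) by (rule rate_constants_holds[OF 1(3,8,9)])
    with False show ?case by contradiction
  qed
  then show ?thesis using that[of 1 1 1] by simp
qed

theorem theorem2p7:
  shows "(\<forall>amin amax cmin cmax lA lc lf F :: real.
      \<exists>C0>0. \<exists>C1>0. \<exists>C2>0.
      \<forall>d\<ge>2. \<forall>A c f u.
        basic_assumptions d amin amax cmin cmax A c f \<and> barron_assumptions d A c \<and>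
        lA = ell_A d A \<and> lc = ell_c d c \<and>
        f \<in> barron_s d 0 \<and> lf = enn2real (barron_s_norm d 0 f) \<and> F = H_minus1_norm d f \<and>
        weak_sol_dirichlet d A c f u \<longrightarrow>
        (\<forall>\<epsilon>. 0 < \<epsilon> \<and> \<epsilon> < 1/2 \<longrightarrow>
          (let M = M_const amin amax cmin cmax lA lc lf F d \<epsilon> in
            M \<le> C0 * real d powr (C2 * \<bar>ln \<epsilon>\<bar>) \<and>
            (\<exists>k a w b.
              k \<ge> 1 \<and> real k \<le> C0 * real d powr (C1 * \<bar>ln \<epsilon>\<bar>) \<and>
              (\<forall>i\<in>{1..k}. \<bar>a i\<bar> \<le> M \<and> (\<forall>j<d. \<exists>z::int. w i j = pi * real_of_int z)) \<and>
              1 / real k * (\<Sum>i=1..k. \<bar>a i\<bar> * (1 + (L2_set (w i) {..<d})\<^sup>2)) \<le> M \<and>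
              barron_e_norm d 2 (cos_network d k a w b) \<le> ennreal M \<and>
              H1_norm d (\<lambda>x. cos_network d k a w b x - u x) \<le> \<epsilon>))))
    \<and>
    (\<forall>amin amax cmin cmax lA lc lf F :: real.
      \<exists>C0>0. \<exists>C1>0. \<exists>C2>0.
      \<forall>d\<ge>2. \<forall>A c f u.
        basic_assumptions d amin amax cmin cmax A c f \<and> barron_assumptions d A c \<and>
        lA = ell_A d A \<and> lc = ell_c d c \<and>
        f \<in> barron_c d 0 \<and> lf = enn2real (barron_c_norm d 0 f) \<and> F = H1_dual_norm d f \<and>
        weak_sol_neumann d A c f u \<longrightarrow>
        (\<forall>\<epsilon>. 0 < \<epsilon> \<and> \<epsilon> < 1/2 \<longrightarrow>
          (let M = M_const amin amax cmin cmax lA lc lf F d \<epsilon> in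
            M \<le> C0 * real d powr (C2 * \<bar>ln \<epsilon>\<bar>) \<and>
            (\<exists>k a w b.
              k \<ge> 1 \<and> real k \<le> C0 * real d powr (C1 * \<bar>ln \<epsilon>\<bar>) \<and>
              (\<forall>i\<in>{1..k}. \<bar>a i\<bar> \<le> M \<and> (\<forall>j<d. \<exists>z::int. w i j = pi * real_of_int z)) \<and>
              1 / real k * (\<Sum>i=1..k. \<bar>a i\<bar> * (1 + (L2_set (w i) {..<d})\<^sup>2)) \<le> M \<and>
              barron_e_norm d 2 (cos_network d k a w b) \<le> ennreal M \<and>
              H1_norm d (\<lambda>x. cos_network d k a w b x - u x) \<le> \<epsilon>))))"
proof (intro conjI allI, goal_cases)
  case (1 amin amax cmin cmax lA lc lf F)
  obtain C0 C1 C2 :: real where C: "0 < C0" "0 < C1" "0 < C2"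
    and main: "admissible_constants amin amax cmin cmax lA lc lf F C0 C1 C2"
    by (rule uniform_constants) (rule that; assumption)
  show ?case
  proof (rule exI[of _ C0], rule conjI[OF C(1)], rule exI[of _ C1], rule conjI[OF C(2)],
      rule exI[of _ C2], rule conjI[OF C(3)], intro allI impI, goal_cases)
    case (1 d A c f u \<epsilon>)
    have d0: "0 < d" using 1(1) by simp
    have f: "approximable d UNIV 0 lf f" using 1(2) approximable_sin by blast
    show ?case
    proof (rule main[unfolded admissible_constants_def, rule_format, OF 1(1) _ _ _ _ boundary_condition_dirichlet[OF d0] f])
      show "0 \<le> lf" using 1(2) by simp
      show "0 \<le> F" using dual_norm_dirichlet(1)[OF d0 f] 1(2) by simp
      show "l2_inner d f v \<le> F * H1_norm d v" if "v \<in> H10 d" for v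
        using dual_norm_dirichlet(2)[OF d0 f that] 1(2) by simp
    qed (use 1 in \<open>auto simp: weak_sol_dirichlet_def\<close>)
  qed
next
  case (2 amin amax cmin cmax lA lc lf F)
  obtain C0 C1 C2 :: real where C: "0 < C0" "0 < C1" "0 < C2"
    and main: "admissible_constants amin amax cmin cmax lA lc lf F C0 C1 C2"
    by (rule uniform_constants) (rule that; assumption)
  show ?case
  proof (rule exI[of _ C0], rule conjI[OF C(1)], rule exI[of _ C1], rule conjI[OF C(2)],
      rule exI[of _ C2], rule conjI[OF C(3)], intro allI impI, goal_cases)
    case (1 d A c f u \<epsilon>)
    have d0: "0 < d" using 1(1) by simp
    have f: "approximable d {} 0 lf f" using 1(2) approximable_cos by blast
    then have fL: "f \<in> L2 d" by (simp add: approximable_def)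
    show ?case
    proof (rule main[unfolded admissible_constants_def, rule_format, OF 1(1) _ _ _ _ boundary_condition_neumann[OF d0] f])
      show "0 \<le> lf" using 1(2) by simp
      show "0 \<le> F" using dual_norm_neumann(1)[OF fL d0] 1(2) by simp
      show "l2_inner d f v \<le> F * H1_norm d v" if "v \<in> H1 d" for v
        using dual_norm_neumann(2)[OF fL d0 that] 1(2) by simp
    qed (use 1 in \<open>auto simp: weak_sol_neumann_def\<close>)
  qed
qed

end
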